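(* Let $K\in\mathbb{N}$. For each $N$ let $0=M_0^{(N)}<M_1^{(N)}<\dots<M_K^{(N)}=N$ be integers such that, for each $k=1,\dots,K$, $(M_k^{(N)}-M_{k-1}^{(N)})/N\to\alpha_k\in(0,1]$ as $N\to\infty$, with $\sum_{k=1}^K\alpha_k=1$. Let all service times $S_i(j)$ ($1\le i\le N$, $j\ge1$) be non-negative and mutually independent, with $S_i(j)\sim S_k$ whenever $M_{k-1}^{(N)}<i\le M_k^{(N)}$. Let $(A(j))_{j\ge1}$ be i.i.d. non-negative random variables distributed as $A$, independent of the service times, with $\mathbb{E}[A]=1/\lambda$ and $\operatorname{Var}(A)=\sigma_A^2<\infty$, and suppose $\mathbb{E}[S_k-A]=-\mu_k$ with $\mu_k>0$ for each $k$. Let $\Lambda_k(\theta)=\log\mathbb{E}[\exp(\theta(S_k-1/\lambda))]$ and assume that for each $k$ there exists $\gamma_k>0$ such that $\Lambda_k(\gamma_k)=0$ and $\gamma_k$ lies in the interior of $\{\theta:\Lambda_k(\theta)<\infty\}$. Assume that the minimum of $\{\gamma_1,\dots,\gamma_K\}$ is attained at exactly one index $k^*$. Let $W_1(\infty),\dots,W_N(\infty)$ be the steady-state waiting times in the $N$-server fork-join queue with these interarrival and service times. Then, as $N\to\infty$, $$\frac{\max_{i\le N}W_i(\infty)-\frac{1}{\gamma_{k^*}}\log N}{\sqrt{\log N}}\ \xrightarrow{d}\ \frac{\sigma_A}{\sqrt{\Lambda_{k^*}'(\gamma_{k^*})\gamma_{k^*}}}\,X,$$ where $X\sim\mathcal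{N}(0,1)$.
   Context: Fork-join queue with $N$ servers: tasks arrive, with $A(j)$ the interarrival time between the $(j-1)$-st and $j$-th task. On arrival, each task places one subtask at each of the $N$ single-server FCFS queues; $S_i(j)$ is the service time of the $j$-th subtask in queue $i$. The servers $i$ with $M_{k-1}^{(N)}<i\le M_k^{(N)}$ form class $k$. The waiting times (time until start of service) satisfy Lindley's recursion with $W_i(1)=0$ and $W_i(n+1)=\max(0,W_i(n)+S_i(n)-A(n+1))$. The vector $(W_1(\infty),\dots,W_N(\infty))$ denotes the limit in distribution of $(W_1(n),\dots,W_N(n))$ as $n\to\infty$. Equivalently, $\max_{i\le N}W_i(\infty)$ has the same distribution as $\max_{i\le N}\sup_{k\ge 0}\sum_{j=1}^k(S_i(j)-A(j))$ (the empty sum being $0$), where the sequence $(A(j))$ is common to all $i$. *)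

theory Defs
  imports "HOL-Probability.Probability"
begin

text \<open>Lindley's recursion for one queue with service times \<open>s j\<close> and interarrival times \<open>a j\<close>.
  Tasks are numbered from 1; the value at 0 has no meaning.\<close>

fun waiting_time :: "(nat \<Rightarrow> real) \<Rightarrow> (nat \<Rightarrow> real) \<Rightarrow> nat \<Rightarrow> real" where
  "waiting_time s a 0 = 0"
| "waiting_time s a (Suc 0) = 0"
| "waiting_time s a (Suc (Suc n)) =
     max 0 (waiting_time s a (Suc n) + s (Suc n) - a (Suc (Suc n)))"

text \<open>The library's \<^const>\<open>weak_conv_m\<close> covers laws on the real line only. The version below is
  needed for random vectors, which are taken as elements of \<^typ>\<open>nat \<Rightarrow> real\<close> with the product
  topology.\<close>

definition tendsto_in_distribution ::
  "(nat \<Rightarrow> 'a measure) \<Rightarrow> (nat \<Rightarrow> 'a \<Rightarrow> 'c::topological_space) \<Rightarrow> 'b measure \<Rightarrow> ('b \<Rightarrow> 'c) \<Rightarrow> bool" where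
  "tendsto_in_distribution P X Q Y \<longleftrightarrow>
     (\<forall>f :: 'c \<Rightarrow> real. continuous_on UNIV f \<and> bounded (range f) \<longrightarrow>
        (\<lambda>n. \<integral>\<omega>. f (X n \<omega>) \<partial>P n) \<longlonglongrightarrow> (\<integral>\<omega>. f (Y \<omega>) \<partial>Q))"

text \<open>\<open>W i\<close>, for \<open>i \<in> {1..N}\<close>, are steady-state waiting times for the queues with service times
  \<open>S i j\<close> and common interarrival times \<open>A j\<close>. They may live on a space \<open>Q\<close> of their own. Outside
  \<open>{1..N}\<close> both restricted functions are the same constant, so this is convergence in
  distribution of vectors of length \<open>N\<close>.\<close>

definition steady_state_waiting_times ::
  "nat \<Rightarrow> 'a measure \<Rightarrow> (nat \<Rightarrow> nat \<Rightarrow> 'a \<Rightarrow> real) \<Rightarrow> (nat \<Rightarrow> 'a \<Rightarrow> real) \<Rightarrow>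
   'b measure \<Rightarrow> (nat \<Rightarrow> 'b \<Rightarrow> real) \<Rightarrow> bool" where
  "steady_state_waiting_times N P S A Q W \<longleftrightarrow>
     prob_space Q \<and> (\<forall>i\<in>{1..N}. W i \<in> borel_measurable Q) \<and>
     tendsto_in_distribution
       (\<lambda>_. P) (\<lambda>n \<omega>. \<lambda>i\<in>{1..N}. waiting_time (\<lambda>j. S i j \<omega>) (\<lambda>j. A j \<omega>) n)
       Q (\<lambda>\<omega>. \<lambda>i\<in>{1..N}. W i \<omega>)"

text \<open>The function \<open>cgf\<close> is meaningful only on \<open>cgf_domain\<close>, the set where it is finite: elsewhere
  the Bochner integral is 0 and \<open>ln 0 = 0\<close>.\<close>

definition cgf :: "'a measure \<Rightarrow> ('a \<Rightarrow> real) \<Rightarrow> real \<Rightarrow> real" where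
  "cgf M X \<theta> = ln (\<integral>\<omega>. exp (\<theta> * X \<omega>) \<partial>M)"

definition cgf_domain :: "'a measure \<Rightarrow> ('a \<Rightarrow> real) \<Rightarrow> real set" where
  "cgf_domain M X = {\<theta>. integrable M (\<lambda>\<omega>. exp (\<theta> * X \<omega>))}"

end

theory Submission
  imports Defs "HOL-Real_Asymp.Real_Asymp"
begin

text \<open>
Reversing time turns the waiting time of server \<open>i\<close> at task \<open>n + 1\<close> into the maximum over
\<open>k \<le> n\<close> of \<open>V\<^sub>i(k) + U(k)\<close>. Here \<open>V\<^sub>i\<close> is a random walk with the steps \<open>S - 1/\<lambda>\<close> of
server \<open>i\<close>, independent across servers, and \<open>U\<close> is a centred walk with steps \<open>1/\<lambda> - A\<close> that all
servers share (\<open>less_waiting_time_iff_sums\<close>).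

Leave out \<open>U\<close> for a moment. Let \<open>\<gamma>\<close> be the smallest of the decay rates and \<open>m\<close> the derivative
\<open>\<Lambda>'(\<gamma>)\<close> for its class. By Cramer's estimate, \<open>V\<^sub>i(k)\<close> exceeds \<open>y\<close> with probability about
\<open>exp (-\<gamma> y)\<close> at the time \<open>k = y/m\<close>, and with a probability smaller by a factor
\<open>exp (-c (k - y/m)\<^sup>2/y)\<close> at other times near it. So the maximum of \<open>N\<close> such walks has height
\<open>log N/\<gamma>\<close>, with fluctuations of order one, and it is reached near the time
\<open>t = log N/(\<gamma> m)\<close>. A class with a larger decay rate stays below this height. The shared walk adds
its value near the time \<open>t\<close>, and by the central limit theorem \<open>U(t)/sqrt (log N)\<close> is asymptotically
normal with variance \<open>\<sigma>\<^sub>A\<^sup>2/(\<gamma> m)\<close>. This is the limit in the theorem.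

For the upper bound, put a window of half-width \<open>t powr (15/16)\<close> around \<open>t\<close>. Outside it, the
penalty \<open>exp (-c t powr (7/8))\<close> is far stronger than the \<open>exp (O(sqrt t))\<close> gained by lowering the
level by a multiple of \<open>sqrt t\<close> (\<open>conv_power_tail_off_window\<close>). Inside it, \<open>U\<close> gains at most
\<open>o(sqrt t)\<close> over its value at the left end of the window. Indeed the steps of \<open>U\<close> have sub-Gaussian
upper tails, because \<open>A\<close> is non-negative with a second moment (\<open>mgf_centered_negative_le\<close>), so an
increment as large as a multiple of \<open>sqrt t\<close> has probability at most
\<open>exp (-c t powr (1/16))\<close>. All these probabilities are small enough to be added up over the times
and the servers (\<open>perturbed_maximum_union_bound\<close>, \<open>union_error_bound\<close>).

For the lower bound, the single time \<open>\<lfloor>t\<rfloor>\<close> suffices. Tilting the law of the steps by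
\<open>exp (\<gamma> x)\<close> gives it mean \<open>m\<close>, and the central limit theorem under the tilted law shows that
\<open>exp (\<gamma> m n)\<close> times the probability of \<open>V\<^sub>i(n) > m n - a sqrt n\<close> tends to infinity
(\<open>conv_power_tail_lower_bound\<close>). Hence one of the many independent walks in the class with decay
rate \<open>\<gamma>\<close> reaches this level at time \<open>\<lfloor>t\<rfloor>\<close> with probability close to one.

The bounds for \<open>N\<close> servers hold uniformly in the number of the task. They therefore pass to the steady
state, by testing the weak convergence against continuous functions of the maximum
(\<open>steady_state_max_cdf_bounds\<close>).
\<close>

section \<open>Convolution powers and exponential tilting\<close>

text \<open>The law of a sum of \<open>n\<close> independent variables with law \<open>\<nu>\<close>. The probability spaces in the theorem
change with the number of servers, while the laws of the partial sums do not; all estimates are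
therefore stated for these laws.\<close>
primrec conv_power :: "real measure \<Rightarrow> nat \<Rightarrow> real measure" where
  "conv_power \<nu> 0 = return borel 0"
| "conv_power \<nu> (Suc n) = convolution \<nu> (conv_power \<nu> n)"

lemma real_distribution_conv_power:
  assumes "real_distribution \<nu>"
  shows "real_distribution (conv_power \<nu> n)"
proof (induction n)
  case 0
  show ?case
    by (auto simp: real_distribution_def real_distribution_axioms_def intro: prob_space_return)
next
  case (Suc n)
  interpret \<nu>: real_distribution \<nu> by fact
  interpret c: real_distribution "conv_power \<nu> n" by fact
  interpret p: pair_prob_space \<nu> "conv_power \<nu> n" ..
  show ?case
    by (auto simp: real_distribution_def real_distribution_axioms_def convolution_def
             intro!: p.prob_space_distr)
qed

lemma sets_conv_power [simp, measurable_cong]: "sets (conv_power \<nu> n) = sets borel"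
  by (cases n) auto

lemma space_conv_power [simp]: "space (conv_power \<nu> n) = UNIV"
  by (cases n) auto

lemma (in prob_space) distr_sum_eq_conv_power:
  assumes "finite J" "indep_vars (\<lambda>_. borel) X J" "\<And>j. j \<in> J \<Longrightarrow> distr M borel (X j) = \<nu>"
  shows "distr M borel (\<lambda>\<omega>. \<Sum>j\<in>J. X j \<omega>) = conv_power \<nu> (card J)"
  using assms
proof (induction J)
  case empty
  show ?case
    by (auto intro!: measure_eqI simp: emeasure_distr indicator_def emeasure_space_1)
next
  case (insert j J)
  have rv: "X i \<in> borel_measurable M" if "i \<in> insert j J" for i
    using insert.prems(1) that by (auto simp: indep_vars_def)
  have "distr M borel (\<lambda>\<omega>. X j \<omega> + (\<Sum>i\<in>J. X i \<omega>)) =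
      convolution (distr M borel (X j)) (distr M borel (\<lambda>\<omega>. \<Sum>i\<in>J. X i \<omega>))"
    using insert.hyps insert.prems rv
    by (intro sum_indep_random_variable indep_vars_sum borel_measurable_sum) auto
  moreover have "distr M borel (\<lambda>\<omega>. \<Sum>i\<in>J. X i \<omega>) = conv_power \<nu> (card J)"
    using insert.prems by (intro insert.IH) (auto intro: indep_vars_subset)
  ultimately show ?case
    using insert by simp
qed

lemma nn_integral_conv_power_exp:
  assumes "real_distribution \<nu>"
  shows "(\<integral>\<^sup>+x. ennreal (exp (\<theta> * x)) \<partial>conv_power \<nu> n) =
    (\<integral>\<^sup>+x. ennreal (exp (\<theta> * x)) \<partial>\<nu>) ^ n"
proof (induction n)
  case 0
  show ?case by (simp add: nn_integral_return)
next
  case (Suc n)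
  interpret \<nu>: real_distribution \<nu> by fact
  interpret c: real_distribution "conv_power \<nu> n"
    by (rule real_distribution_conv_power) fact
  have "(\<integral>\<^sup>+x. ennreal (exp (\<theta> * x)) \<partial>conv_power \<nu> (Suc n)) =
      (\<integral>\<^sup>+x. \<integral>\<^sup>+y. ennreal (exp (\<theta> * x)) * ennreal (exp (\<theta> * y)) \<partial>conv_power \<nu> n \<partial>\<nu>)"
    by (simp add: nn_integral_convolution \<nu>.finite_measure_axioms c.finite_measure_axioms
        ring_distribs exp_add ennreal_mult)
  also have "\<dots> = (\<integral>\<^sup>+x. ennreal (exp (\<theta> * x)) \<partial>\<nu>) * (\<integral>\<^sup>+x. ennreal (exp (\<theta> * x)) \<partial>conv_power \<nu> n)"
    by (simp add: nn_integral_cmult nn_integral_multc)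
  finally show ?case using Suc by simp
qed

text \<open>Markov's inequality for \<open>exp (\<theta> x)\<close>, whose integral is multiplicative under convolution.\<close>
lemma chernoff_bound_conv_power:
  assumes \<nu>: "real_distribution \<nu>" and int: "integrable \<nu> (\<lambda>x. exp (\<theta> * x))" and "0 \<le> \<theta>"
  shows "measure (conv_power \<nu> n) {y<..} \<le> exp (- \<theta> * y) * (\<integral>x. exp (\<theta> * x) \<partial>\<nu>) ^ n"
proof -
  interpret c: real_distribution "conv_power \<nu> n"
    by (rule real_distribution_conv_power) fact
  have "emeasure (conv_power \<nu> n) {y<..} = (\<integral>\<^sup>+x. indicator {y<..} x \<partial>conv_power \<nu> n)"
    by simp
  also have "\<dots> \<le> (\<integral>\<^sup>+x. ennreal (exp (- \<theta> * y)) * ennreal (exp (\<theta> * x)) \<partial>conv_power \<nu> n)"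
  proof (rule nn_integral_mono)
    fix x
    have "1 \<le> exp (- \<theta> * y) * exp (\<theta> * x)" if "y < x"
      using that \<open>0 \<le> \<theta>\<close> by (simp add: exp_add[symmetric] mult_left_mono)
    then show "indicator {y<..} x \<le> ennreal (exp (- \<theta> * y)) * ennreal (exp (\<theta> * x))"
      by (auto simp: indicator_def ennreal_mult[symmetric])
  qed
  also have "\<dots> = ennreal (exp (- \<theta> * y)) * ennreal ((\<integral>x. exp (\<theta> * x) \<partial>\<nu>)) ^ n"
    using int by (simp add: nn_integral_cmult nn_integral_conv_power_exp[OF \<nu>] nn_integral_eq_integral)
  also have "\<dots> = ennreal (exp (- \<theta> * y) * (\<integral>x. exp (\<theta> * x) \<partial>\<nu>) ^ n)"
    by (simp add: ennreal_mult ennreal_power integral_nonneg_AE)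
  finally show ?thesis
    by (simp add: c.emeasure_eq_measure integral_nonneg_AE)
qed

text \<open>The Esscher transform, normalised only when the moment generating function of \<open>\<nu>\<close> is 1 at \<open>\<theta>\<close>.\<close>
definition tilt :: "real \<Rightarrow> real measure \<Rightarrow> real measure" where
  "tilt \<theta> \<nu> = density \<nu> (\<lambda>x. ennreal (exp (\<theta> * x)))"

lemma sets_tilt [simp, measurable_cong]: "sets (tilt \<theta> \<nu>) = sets \<nu>"
  by (simp add: tilt_def)

lemma real_distribution_tilt:
  assumes "real_distribution \<nu>" "integrable \<nu> (\<lambda>x. exp (\<theta> * x))" "(\<integral>x. exp (\<theta> * x) \<partial>\<nu>) = 1"
  shows "real_distribution (tilt \<theta> \<nu>)"
proof -
  interpret real_distribution \<nu> by fact
  have "emeasure (tilt \<theta> \<nu>) UNIV = (\<integral>\<^sup>+x. ennreal (exp (\<theta> * x)) \<partial>\<nu>)"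
    using emeasure_density[of "\<lambda>x. ennreal (exp (\<theta> * x))" \<nu> UNIV] by (simp add: tilt_def)
  also have "\<dots> = 1"
    using assms by (simp add: nn_integral_eq_integral)
  finally show ?thesis
    by (auto simp: real_distribution_def real_distribution_axioms_def tilt_def intro!: prob_spaceI)
qed

text \<open>Tilting commutes with convolution because \<open>exp (\<theta> (x + y))\<close> factorises. Under the tilted law an
event that is rare for the original sum becomes typical, and the density \<open>exp (-\<theta> x)\<close> converts its
probability back.\<close>
lemma nn_integral_conv_power_tilt:
  assumes \<nu>: "real_distribution \<nu>" "integrable \<nu> (\<lambda>x. exp (\<theta> * x))" "(\<integral>x. exp (\<theta> * x) \<partial>\<nu>) = 1"
    and [measurable]: "f \<in> borel_measurable borel"
  shows "(\<integral>\<^sup>+x. f x \<partial>conv_power \<nu> n) =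
    (\<integral>\<^sup>+x. f x * ennreal (exp (- \<theta> * x)) \<partial>conv_power (tilt \<theta> \<nu>) n)"
  using assms(4)
proof (induction n arbitrary: f)
  case 0
  then show ?case by (simp add: nn_integral_return)
next
  case (Suc n)
  note [measurable] = Suc.prems
  interpret \<nu>: real_distribution \<nu> by fact
  interpret \<nu>': real_distribution "tilt \<theta> \<nu>" by (rule real_distribution_tilt) fact+
  interpret c: real_distribution "conv_power \<nu> n"
    by (rule real_distribution_conv_power) fact
  interpret c': real_distribution "conv_power (tilt \<theta> \<nu>) n"
    by (intro real_distribution_conv_power real_distribution_tilt) fact+
  have cancel: "ennreal (exp (\<theta> * x)) * (a * ennreal (exp (- \<theta> * (x + y)))) =
      a * ennreal (exp (- \<theta> * y))" for x y a
  proof -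
    have "ennreal (exp (\<theta> * x)) * ennreal (exp (- \<theta> * (x + y))) = ennreal (exp (- \<theta> * y))"
      by (simp add: ennreal_mult[symmetric] exp_add[symmetric] algebra_simps)
    then show ?thesis by (metis mult.left_commute)
  qed
  have "(\<integral>\<^sup>+x. f x * ennreal (exp (- \<theta> * x)) \<partial>conv_power (tilt \<theta> \<nu>) (Suc n)) =
     (\<integral>\<^sup>+x. \<integral>\<^sup>+y. f (x + y) * ennreal (exp (- \<theta> * (x + y))) \<partial>conv_power (tilt \<theta> \<nu>) n \<partial>tilt \<theta> \<nu>)"
    by (simp add: nn_integral_convolution \<nu>'.finite_measure_axioms c'.finite_measure_axioms)
  also have "\<dots> = (\<integral>\<^sup>+x. ennreal (exp (\<theta> * x)) *
      (\<integral>\<^sup>+y. f (x + y) * ennreal (exp (- \<theta> * (x + y))) \<partial>conv_power (tilt \<theta> \<nu>) n) \<partial>\<nu>)"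
    unfolding tilt_def by (subst nn_integral_density) (auto simp: tilt_def[symmetric])
  also have "\<dots> = (\<integral>\<^sup>+x. \<integral>\<^sup>+y. f (x + y) * ennreal (exp (- \<theta> * y)) \<partial>conv_power (tilt \<theta> \<nu>) n \<partial>\<nu>)"
    by (subst nn_integral_cmult[symmetric]) (simp_all only: cancel, measurable)
  also have "\<dots> = (\<integral>\<^sup>+x. \<integral>\<^sup>+y. f (x + y) \<partial>conv_power \<nu> n \<partial>\<nu>)"
    by (simp add: Suc.IH)
  also have "\<dots> = (\<integral>\<^sup>+x. f x \<partial>conv_power \<nu> (Suc n))"
    by (simp add: nn_integral_convolution \<nu>.finite_measure_axioms c.finite_measure_axioms)
  finally show ?case ..
qed

section \<open>The central limit theorem for convolution powers\<close>

text \<open>Slutsky's theorem for deterministic factors: on the space given by Skorohod's theorem the convergence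
is pointwise, and there multiplication by a convergent sequence is harmless.\<close>
lemma weak_conv_m_scale:
  assumes \<mu>: "\<And>n. real_distribution (\<mu> n)" and M: "real_distribution M"
    and conv: "weak_conv_m \<mu> M" and c: "c \<longlonglongrightarrow> (c' :: real)"
  shows "weak_conv_m (\<lambda>n. distr (\<mu> n) borel (\<lambda>x. c n * x)) (distr M borel (\<lambda>x. c' * x))"
proof -
  from Skorohod[OF \<mu> M conv] obtain \<Omega> :: "real measure" and Y_seq :: "nat \<Rightarrow> real \<Rightarrow> real" and Y :: "real \<Rightarrow> real"
    where \<Omega>: "prob_space \<Omega>" and Ys [measurable]: "\<And>n. Y_seq n \<in> measurable \<Omega> borel"
      and Ys_distr: "\<And>n. distr \<Omega> borel (Y_seq n) = \<mu> n"
      and Y': "Y \<in> measurable \<Omega> lborel" and Y_distr: "distr \<Omega> borel Y = M"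
      and lim: "\<And>x. x \<in> space \<Omega> \<Longrightarrow> (\<lambda>n. Y_seq n x) \<longlonglongrightarrow> Y x"
    by blast
  from Y' have [measurable]: "Y \<in> measurable \<Omega> borel" by simp
  interpret \<Omega>: prob_space \<Omega> by fact
  have 1: "distr (\<mu> n) borel (\<lambda>x. c n * x) = distr \<Omega> borel (\<lambda>x. c n * Y_seq n x)" for n
    unfolding Ys_distr[symmetric] by (subst distr_distr) (auto simp: o_def)
  have 2: "distr M borel (\<lambda>x. c' * x) = distr \<Omega> borel (\<lambda>x. c' * Y x)"
    unfolding Y_distr[symmetric] by (subst distr_distr) (auto simp: o_def)
  show ?thesis
    unfolding 1 2
  proof (rule integral_bdd_continuous_conv_imp_weak_conv)
    fix f :: "real \<Rightarrow> real"
    assume f: "\<And>x. isCont f x" "\<And>x. \<bar>f x\<bar> \<le> 1"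
    have [measurable]: "f \<in> borel_measurable borel"
      using f by (intro borel_measurable_continuous_onI continuous_at_imp_continuous_on) auto
    have "(\<lambda>n. \<integral>x. f (c n * Y_seq n x) \<partial>\<Omega>) \<longlonglongrightarrow> (\<integral>x. f (c' * Y x) \<partial>\<Omega>)"
    proof (rule integral_dominated_convergence[where w="\<lambda>_. 1"])
      show "AE x in \<Omega>. (\<lambda>n. f (c n * Y_seq n x)) \<longlonglongrightarrow> f (c' * Y x)"
        by (rule AE_I2) (rule isCont_tendsto_compose[OF f(1)], rule tendsto_mult[OF c lim])
    qed (use f in auto)
    then show "(\<lambda>n. \<integral>x. f x \<partial>distr \<Omega> borel (\<lambda>x. c n * Y_seq n x)) \<longlonglongrightarrow>
        (\<integral>x. f x \<partial>distr \<Omega> borel (\<lambda>x. c' * Y x))"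
      by (simp add: integral_distr)
  qed simp_all
qed

lemma weak_conv_m_compose:
  assumes "weak_conv_m \<mu> M" "filterlim f at_top sequentially"
  shows "weak_conv_m (\<lambda>n. \<mu> (f n)) M"
  using assms filterlim_compose[OF _ assms(2)] unfolding weak_conv_m_def weak_conv_def
  by blast

text \<open>The sums live on the infinite product of \<open>\<nu>\<close>, whose coordinates are independent with law \<open>\<nu>\<close>.\<close>
lemma central_limit_theorem_conv_power_pos:
  assumes \<nu>: "real_distribution \<nu>" and mean: "(\<integral>x. x \<partial>\<nu>) = 0" 
    and sq: "integrable \<nu> (\<lambda>x. x\<^sup>2)" and var: "(\<integral>x. x\<^sup>2 \<partial>\<nu>) = \<sigma>\<^sup>2" and "0 < \<sigma>"
  shows "weak_conv_m (\<lambda>n. distr (conv_power \<nu> n) borel (\<lambda>x. x / sqrt (real n * \<sigma>\<^sup>2))) std_normal_distribution"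
proof -
  interpret \<nu>: real_distribution \<nu> by fact
  interpret P: prob_space "PiM (UNIV :: nat set) (\<lambda>_. \<nu>)" by (intro prob_space_PiM \<nu>.prob_space_axioms)
  interpret PP: product_prob_space "\<lambda>_::nat. \<nu>" UNIV ..
  let ?P = "PiM (UNIV :: nat set) (\<lambda>_. \<nu>)"
  have sets_P: "sets ?P = sets (PiM UNIV (\<lambda>_. borel))"
    by (rule sets_PiM_cong[OF refl \<nu>.events_eq_borel])
  have rv: "(\<lambda>\<omega>. \<omega> i) \<in> borel_measurable ?P" for i
    unfolding measurable_cong_sets[OF sets_P refl]
    by (rule measurable_component_singleton) simp
  have law: "distr ?P borel (\<lambda>\<omega>. \<omega> i) = \<nu>" for i
  proof -
    have "distr ?P borel (\<lambda>\<omega>. \<omega> i) = distr ?P \<nu> (\<lambda>\<omega>. \<omega> i)"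
      by (rule distr_cong[OF refl \<nu>.events_eq_borel[symmetric] refl])
    also have "\<dots> = \<nu>"
      by (rule PP.PiM_component) simp
    finally show ?thesis .
  qed
  have indep: "P.indep_vars (\<lambda>_. borel) (\<lambda>i \<omega>. \<omega> i) UNIV"
  proof (subst P.indep_vars_iff_distr_eq_PiM)
    have "distr ?P (PiM UNIV (\<lambda>_. borel)) (\<lambda>x. x) = ?P"
      by (rule distr_id2[OF sets_P[symmetric]])
    then show "distr ?P (PiM UNIV (\<lambda>_. borel)) (\<lambda>x. \<lambda>i\<in>UNIV. x i) = (\<Pi>\<^sub>M i\<in>UNIV. distr ?P borel (\<lambda>\<omega>. \<omega> i))"
      by (simp only: law restrict_UNIV)
  qed (simp_all add: rv)
  have 1: "(\<integral>\<omega>. f (\<omega> i) \<partial>?P) = (\<integral>x. f x \<partial>\<nu>)" if "f \<in> borel_measurable borel" for f :: "real \<Rightarrow> real" and i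
    using integral_distr[OF rv that, of i] by (simp add: law)
  have 2: "integrable ?P (\<lambda>\<omega>. (\<omega> i)\<^sup>2)" for i
    using integrable_distr_eq[OF rv, of "\<lambda>x. x\<^sup>2" i] sq by (simp add: law)
  have "weak_conv_m (\<lambda>n. distr ?P borel (\<lambda>\<omega>. (\<Sum>i<n. \<omega> i) / sqrt (real n * \<sigma>\<^sup>2))) std_normal_distribution"
  proof (rule P.central_limit_theorem_zero_mean[OF indep _ \<open>0 < \<sigma>\<close> _ _ law])
    show m: "P.expectation (\<lambda>\<omega>. \<omega> n) = 0" for n
      using 1[of "\<lambda>x. x" n] mean by simp
    show "integrable ?P (\<lambda>\<omega>. (\<omega> n)\<^sup>2)" for n
      by (rule 2)
    show "P.variance (\<lambda>\<omega>. \<omega> n) = \<sigma>\<^sup>2" for n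
      unfolding m using 1[of "\<lambda>x. x\<^sup>2" n] var by simp
  qed
  also have "(\<lambda>n. distr ?P borel (\<lambda>\<omega>. (\<Sum>i<n. \<omega> i) / sqrt (real n * \<sigma>\<^sup>2))) =
      (\<lambda>n. distr (conv_power \<nu> n) borel (\<lambda>x. x / sqrt (real n * \<sigma>\<^sup>2)))"
  proof
    fix n
    have "distr ?P borel (\<lambda>\<omega>. \<Sum>i<n. \<omega> i) = conv_power \<nu> n"
      using P.distr_sum_eq_conv_power[OF finite_lessThan P.indep_vars_subset[OF indep subset_UNIV] law, of n]
      by simp
    then have "distr (conv_power \<nu> n) borel (\<lambda>x. x / sqrt (real n * \<sigma>\<^sup>2)) =
      distr (distr ?P borel (\<lambda>\<omega>. \<Sum>i<n. \<omega> i)) borel (\<lambda>x. x / sqrt (real n * \<sigma>\<^sup>2))"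
      by simp
    also have "\<dots> = distr ?P borel (\<lambda>\<omega>. (\<Sum>i<n. \<omega> i) / sqrt (real n * \<sigma>\<^sup>2))"
      by (subst distr_distr) (auto simp: o_def)
    finally show "distr ?P borel (\<lambda>\<omega>. (\<Sum>i<n. \<omega> i) / sqrt (real n * \<sigma>\<^sup>2)) =
      distr (conv_power \<nu> n) borel (\<lambda>x. x / sqrt (real n * \<sigma>\<^sup>2))" ..
  qed
  finally show ?thesis .
qed

lemma conv_power_return_0: "conv_power (return borel 0) n = return borel 0"
proof (induction n)
  case (Suc n)
  have "finite_measure (return borel (0 :: real))"
    by (intro prob_space.finite_measure prob_space_return) auto
  then show ?case
    using Suc
    by (intro measure_eqI) (auto simp: convolution_emeasure nn_integral_return)
qed simp

text \<open>The number of summands follows an asymptotically equal normalisation \<open>r\<close>. With \<open>\<sigma> = 0\<close> both sides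
are point masses at 0, so a deterministic interarrival time is covered.\<close>
lemma central_limit_theorem_conv_power:
  assumes \<nu>: "real_distribution \<nu>" and mean: "(\<integral>x. x \<partial>\<nu>) = 0" 
    and sq: "integrable \<nu> (\<lambda>x. x\<^sup>2)" and var: "(\<integral>x. x\<^sup>2 \<partial>\<nu>) = \<sigma>\<^sup>2" and "0 \<le> \<sigma>"
    and f: "filterlim f at_top sequentially"
    and r: "\<And>n. 0 \<le> r n" "(\<lambda>n. real (f n) / r n) \<longlonglongrightarrow> 1"
  shows "weak_conv_m (\<lambda>n. distr (conv_power \<nu> (f n)) borel (\<lambda>x. x / sqrt (r n)))
    (distr std_normal_distribution borel (\<lambda>x. \<sigma> * x))"
proof (cases "\<sigma> = 0")
  case True
  interpret \<nu>: real_distribution \<nu> by fact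
  have "AE x in \<nu>. x\<^sup>2 = 0"
    using var True sq by (subst integral_nonneg_eq_0_iff_AE[symmetric]) auto
  then have AE: "AE x in \<nu>. x = 0" by simp
  have "\<nu> = return borel 0"
  proof (rule measure_eqI)
    fix A assume "A \<in> sets \<nu>"
    have "emeasure \<nu> A = emeasure \<nu> (if 0 \<in> A then UNIV else {})"
      using AE \<open>A \<in> sets \<nu>\<close> by (intro emeasure_eq_AE) auto
    also have "\<dots> = emeasure (return borel 0) A"
      using \<open>A \<in> sets \<nu>\<close> \<nu>.emeasure_space_1 by (simp add: indicator_def)
    finally show "emeasure \<nu> A = emeasure (return borel 0) A" .
  qed simp
  then have 1: "distr (conv_power \<nu> (f n)) borel (\<lambda>x. x / sqrt (r n)) = return borel 0" for n
    by (simp add: conv_power_return_0 distr_return)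
  interpret N: real_distribution std_normal_distribution by (rule real_dist_normal_dist)
  have 2: "distr std_normal_distribution borel (\<lambda>x. \<sigma> * x) = return borel 0"
    using True N.prob_space by (auto intro!: measure_eqI simp: emeasure_distr indicator_def N.emeasure_space_1)
  show ?thesis
    unfolding 1 2 by (simp add: weak_conv_m_def weak_conv_def)
next
  case False
  with \<open>0 \<le> \<sigma>\<close> have "0 < \<sigma>" by simp
  have "(\<lambda>n. sqrt (real (f n) / r n)) \<longlonglongrightarrow> 1"
    using tendsto_real_sqrt[OF r(2)] by simp
  then have c: "(\<lambda>n. \<sigma> * sqrt (real (f n) / r n)) \<longlonglongrightarrow> \<sigma>"
    using tendsto_mult_left[of _ 1 _ \<sigma>] by simp
  have rd: "real_distribution (conv_power \<nu> n)" for n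
    by (intro real_distribution_conv_power \<nu>)
  have rd': "real_distribution (distr (conv_power \<nu> n) borel (\<lambda>x. x / c))" for n c
    using prob_space.real_distribution_distr[of "conv_power \<nu> n" "\<lambda>x. x / c"] rd[of n]
    by (auto simp: real_distribution_def)
  have *: "weak_conv_m (\<lambda>n. distr (distr (conv_power \<nu> (f n)) borel (\<lambda>x. x / sqrt (real (f n) * \<sigma>\<^sup>2))) borel
      (\<lambda>x. \<sigma> * sqrt (real (f n) / r n) * x))
    (distr std_normal_distribution borel (\<lambda>x. \<sigma> * x))"
    by (intro weak_conv_m_scale c rd' real_dist_normal_dist
        weak_conv_m_compose[OF central_limit_theorem_conv_power_pos f] assms \<open>0 < \<sigma>\<close>)
  have ev: "eventually (\<lambda>n. 0 < f n) sequentially"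
    using f eventually_gt_at_top[of 0] by (rule eventually_compose_filterlim[rotated])
  have "eventually (\<lambda>n. distr (distr (conv_power \<nu> (f n)) borel (\<lambda>x. x / sqrt (real (f n) * \<sigma>\<^sup>2))) borel
      (\<lambda>x. \<sigma> * sqrt (real (f n) / r n) * x) = distr (conv_power \<nu> (f n)) borel (\<lambda>x. x / sqrt (r n))) sequentially"
    using ev
  proof eventually_elim
    case (elim n)
    have "(\<sigma> * sqrt (real (f n) / r n) * (x / sqrt (real (f n) * \<sigma>\<^sup>2))) = x / sqrt (r n)" for x
      using elim \<open>0 < \<sigma>\<close> by (simp add: real_sqrt_divide real_sqrt_mult)
    then show ?case
      by (subst distr_distr) (auto simp: o_def)
  qed
  then have "eventually (\<lambda>n. cdf (distr (distr (conv_power \<nu> (f n)) borel (\<lambda>x. x / sqrt (real (f n) * \<sigma>\<^sup>2))) borel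
      (\<lambda>x. \<sigma> * sqrt (real (f n) / r n) * x)) x = cdf (distr (conv_power \<nu> (f n)) borel (\<lambda>x. x / sqrt (r n))) x) sequentially" for x
    by eventually_elim simp
  then show ?thesis
    using * unfolding weak_conv_m_def weak_conv_def
    by (auto intro: Lim_transform_eventually)
qed

text \<open>The atom that is present for \<open>\<sigma> = 0\<close> lies at 0. Excluding this point treats the degenerate and the
non-degenerate limit alike.\<close>
lemma isCont_cdf_scaled_normal:
  assumes "x \<noteq> 0"
  shows "isCont (cdf (distr std_normal_distribution borel (\<lambda>x. \<sigma> * x))) x"
proof -
  interpret N: real_distribution std_normal_distribution by (rule real_dist_normal_dist)
  interpret D: real_distribution "distr std_normal_distribution borel (\<lambda>x. \<sigma> * x)"
    by (rule N.real_distribution_distr) simp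
  have "measure (distr std_normal_distribution borel (\<lambda>x. \<sigma> * x)) {x} = measure std_normal_distribution {u. \<sigma> * u = x}"
    by (subst measure_distr) (auto simp: vimage_def)
  also have "\<dots> = 0"
  proof -
    have sub: "{u. \<sigma> * u = x} \<subseteq> {x / \<sigma>}" using assms by (auto simp: field_simps)
    have "AE u in lborel. u \<notin> {u. \<sigma> * u = x}"
      by (rule AE_mp[OF AE_lborel_singleton[of "x / \<sigma>"]]) (use sub in auto)
    then have "AE u in std_normal_distribution. u \<notin> {u. \<sigma> * u = x}"
      by (subst AE_density) auto
    then show ?thesis
      by (simp add: N.prob_eq_0 )
  qed
  finally show ?thesis by (simp add: D.isCont_cdf)
qed

section \<open>Moment generating functions near the decay rate\<close>

text \<open>From \<open>exp y = (exp (y/2))\<^sup>2 \<ge> (1 + y/2)\<^sup>2\<close> when \<open>1 + y/2 \<ge> 0\<close>.\<close>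
lemma exp_strict_ge_add_one:
  fixes y :: real
  assumes "y \<noteq> 0"
  shows "1 + y < exp y"
proof (cases "-2 \<le> y")
  case True
  have "(1 + y / 2)\<^sup>2 = 1 + y + (y / 2)\<^sup>2"
    by (simp add: power2_eq_square algebra_simps)
  moreover have "0 < (y / 2)\<^sup>2"
    using assms by simp
  ultimately have "1 + y < (1 + y / 2)\<^sup>2"
    by linarith
  also have "\<dots> \<le> (exp (y / 2))\<^sup>2"
    using True exp_ge_add_one_self[of "y / 2"] by (intro power_mono) auto
  also have "\<dots> = exp y"
    by (simp add: power2_eq_square flip: exp_add)
  finally show ?thesis .
next
  case False
  then show ?thesis using exp_gt_zero[of y] by linarith
qed

text \<open>From \<open>(1 - u) exp u \<le> 1\<close>, the remainder is at most \<open>u (exp u - 1)\<close>; a second use of the same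
inequality bounds the last factor.\<close>
lemma exp_quadratic_remainder:
  fixes u :: real
  shows "0 \<le> exp u - 1 - u" "exp u - 1 - u \<le> u\<^sup>2 * exp \<bar>u\<bar>"
proof -
  show "0 \<le> exp u - 1 - u"
    using exp_ge_add_one_self[of u] by linarith
  have "(1 - u) * exp u \<le> exp (- u) * exp u"
    using exp_ge_add_one_self[of "- u"] by (intro mult_right_mono) auto
  then have *: "exp u - 1 \<le> u * exp u"
    by (simp add: algebra_simps flip: exp_add)
  show "exp u - 1 - u \<le> u\<^sup>2 * exp \<bar>u\<bar>"
  proof (cases "0 \<le> u")
    case True
    have "u * (exp u - 1) \<le> u * (u * exp u)"
      by (rule mult_left_mono[OF * True])
    then have "u * exp u - u \<le> u\<^sup>2 * exp u"
      by (simp add: power2_eq_square right_diff_distrib mult.assoc)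
    with * True show ?thesis by simp
  next
    case False
    then have "(- u) * (1 - exp u) \<le> (- u) * (- u)"
      using exp_ge_add_one_self[of u] by (intro mult_left_mono) linarith+
    also have "\<dots> \<le> u\<^sup>2 * exp \<bar>u\<bar>"
      using mult_left_mono[of 1 "exp \<bar>u\<bar>" "u\<^sup>2"] by (simp add: power2_eq_square)
    finally have "u * exp u - u \<le> u\<^sup>2 * exp \<bar>u\<bar>"
      by (simp add: right_diff_distrib)
    with * show ?thesis by linarith
  qed
qed

lemma exp_minus_le_quadratic:
  fixes u :: real
  assumes "0 \<le> u"
  shows "exp (- u) \<le> 1 - u + u\<^sup>2 / 2"
proof -
  have "0 < 1 + u + u\<^sup>2 / 2"
    using assms by (simp add: add_pos_nonneg)
  moreover have "(1 - u + u\<^sup>2 / 2) * (1 + u + u\<^sup>2 / 2) = 1 + (u\<^sup>2 / 2)\<^sup>2"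
    by (simp add: power2_eq_square algebra_simps)
  then have "1 \<le> (1 - u + u\<^sup>2 / 2) * (1 + u + u\<^sup>2 / 2)"
    by (metis zero_le_power2 le_add_same_cancel1)
  ultimately have "1 / (1 + u + u\<^sup>2 / 2) \<le> 1 - u + u\<^sup>2 / 2"
    by (simp only: pos_divide_le_eq)
  moreover have "1 / exp u \<le> 1 / (1 + u + u\<^sup>2 / 2)"
    using exp_lower_Taylor_quadratic[OF assms] \<open>0 < 1 + u + u\<^sup>2 / 2\<close>
    by (intro divide_left_mono) auto
  then have "exp (- u) \<le> 1 / (1 + u + u\<^sup>2 / 2)"
    by (simp only: exp_minus inverse_eq_divide)
  ultimately show ?thesis by linarith
qed

definition mgf :: "real measure \<Rightarrow> real \<Rightarrow> real" where
  "mgf \<nu> \<theta> = (\<integral>x. exp (\<theta> * x) \<partial>\<nu>)"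

text \<open>The second-order Taylor bound at an interior point of the domain. The remainder of
\<open>exp ((\<gamma> + t) x)\<close> is dominated by the two exponentials at the ends of a small interval around
\<open>\<gamma>\<close>, since a factor \<open>exp (h \<bar>x\<bar>)\<close> absorbs \<open>x\<^sup>2\<close>.\<close>
lemma mgf_quadratic:
  assumes \<nu>: "real_distribution \<nu>" and \<gamma>: "\<gamma> \<in> interior {\<theta>. integrable \<nu> (\<lambda>x. exp (\<theta> * x))}"
  obtains h\<^sub>0 C where "0 < h\<^sub>0" "0 < C"
    "integrable \<nu> (\<lambda>x. x * exp (\<gamma> * x))" "integrable \<nu> (\<lambda>x. x\<^sup>2 * exp (\<gamma> * x))"
    "\<And>h. \<bar>h\<bar> \<le> h\<^sub>0 \<Longrightarrow> integrable \<nu> (\<lambda>x. exp ((\<gamma> + h) * x))"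
    "\<And>h. \<bar>h\<bar> \<le> h\<^sub>0 \<Longrightarrow> \<bar>mgf \<nu> (\<gamma> + h) - mgf \<nu> \<gamma> - h * (\<integral>x. x * exp (\<gamma> * x) \<partial>\<nu>)\<bar> \<le> C * h\<^sup>2"
proof -
  interpret real_distribution \<nu> by fact
  from \<gamma> obtain e where e: "0 < e" "ball \<gamma> e \<subseteq> {\<theta>. integrable \<nu> (\<lambda>x. exp (\<theta> * x))}"
    by (auto simp: mem_interior)
  define h where "h = e / 4"
  have h: "0 < h" using e by (simp add: h_def)
  have int: "integrable \<nu> (\<lambda>x. exp (\<theta> * x))" if "\<bar>\<theta> - \<gamma>\<bar> \<le> 2 * h" for \<theta>
  proof -
    have "\<theta> \<in> ball \<gamma> e"
      using that e(1) by (simp add: h_def dist_real_def abs_minus_commute)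
    with e(2) show ?thesis by blast
  qed
  \<comment> \<open>The common integrable majorant for all remainders.\<close>
  define D where "D x = exp ((\<gamma> + 2 * h) * x) + exp ((\<gamma> - 2 * h) * x)" for x
  have D [simp]: "integrable \<nu> D"
    unfolding D_def using h by (intro Bochner_Integration.integrable_add int) auto
  have D_pos: "0 < D x" for x by (simp add: D_def add_pos_pos)
  have D_ge: "exp (\<gamma> * x) * exp (2 * h * \<bar>x\<bar>) \<le> D x" for x
    by (cases "0 \<le> x") (simp_all add: D_def distrib_right left_diff_distrib flip: exp_add)
  have sq: "x\<^sup>2 \<le> 2 / h\<^sup>2 * exp (h * \<bar>x\<bar>)" for x
  proof -
    have "0 \<le> h * \<bar>x\<bar>" using h by simp
    then have "(h * \<bar>x\<bar>)\<^sup>2 / 2 \<le> exp (h * \<bar>x\<bar>)"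
      using exp_lower_Taylor_quadratic[of "h * \<bar>x\<bar>"] by linarith
    then have "2 / h\<^sup>2 * ((h * \<bar>x\<bar>)\<^sup>2 / 2) \<le> 2 / h\<^sup>2 * exp (h * \<bar>x\<bar>)"
      by (rule mult_left_mono) simp
    then show ?thesis using h by (simp add: power_mult_distrib)
  qed
  have sq_D: "x\<^sup>2 * exp (\<gamma> * x) * exp (h * \<bar>x\<bar>) \<le> 2 / h\<^sup>2 * D x" for x
  proof -
    have double: "exp (2 * h * \<bar>x\<bar>) = exp (h * \<bar>x\<bar>) * exp (h * \<bar>x\<bar>)"
      by (simp flip: exp_add)
    have "x\<^sup>2 * (exp (\<gamma> * x) * exp (h * \<bar>x\<bar>)) \<le> 2 / h\<^sup>2 * exp (h * \<bar>x\<bar>) * (exp (\<gamma> * x) * exp (h * \<bar>x\<bar>))"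
      by (intro mult_right_mono sq) auto
    also have "\<dots> = 2 / h\<^sup>2 * (exp (\<gamma> * x) * exp (2 * h * \<bar>x\<bar>))"
      unfolding double by (simp only: mult_ac)
    also have "\<dots> \<le> 2 / h\<^sup>2 * D x"
      using D_ge by (intro mult_left_mono) auto
    finally show ?thesis by (simp add: mult_ac)
  qed
  have int2: "integrable \<nu> (\<lambda>x. x\<^sup>2 * exp (\<gamma> * x))"
  proof (rule Bochner_Integration.integrable_bound)
    show "integrable \<nu> (\<lambda>x. 2 / h\<^sup>2 * D x)" by simp
    have "x\<^sup>2 * exp (\<gamma> * x) \<le> 2 / h\<^sup>2 * D x" for x
      using sq_D[of x] h mult_left_mono[of 1 "exp (h * \<bar>x\<bar>)" "x\<^sup>2 * exp (\<gamma> * x)"] by simp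
    then show "AE x in \<nu>. norm (x\<^sup>2 * exp (\<gamma> * x)) \<le> norm (2 / h\<^sup>2 * D x)"
      using D_pos by (auto simp: abs_mult abs_of_pos less_imp_le)
  qed simp
  have int1: "integrable \<nu> (\<lambda>x. x * exp (\<gamma> * x))"
  proof (rule Bochner_Integration.integrable_bound)
    show "integrable \<nu> (\<lambda>x. exp (\<gamma> * x) + x\<^sup>2 * exp (\<gamma> * x))"
      using h int[of \<gamma>] int2 by auto
    have "\<bar>x\<bar> \<le> 1 + x\<^sup>2" for x :: real
      using zero_le_power2[of "\<bar>x\<bar> - 1"] zero_le_power2[of x]
      unfolding power2_diff power2_abs one_power2 mult_1_right by linarith
    then have "\<bar>x\<bar> * exp (\<gamma> * x) \<le> (1 + x\<^sup>2) * exp (\<gamma> * x)" for x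
      by (intro mult_right_mono) auto
    then show "AE x in \<nu>. norm (x * exp (\<gamma> * x)) \<le> norm (exp (\<gamma> * x) + x\<^sup>2 * exp (\<gamma> * x))"
      by (auto simp: abs_mult algebra_simps)
  qed simp
  have est: "\<bar>mgf \<nu> (\<gamma> + t) - mgf \<nu> \<gamma> - t * (\<integral>x. x * exp (\<gamma> * x) \<partial>\<nu>)\<bar> \<le> (2 / h\<^sup>2 * (\<integral>x. D x \<partial>\<nu>)) * t\<^sup>2"
    if t: "\<bar>t\<bar> \<le> h" for t
  proof -
    let ?g = "\<lambda>x. exp ((\<gamma> + t) * x) - exp (\<gamma> * x) - t * (x * exp (\<gamma> * x))"
    have i1: "integrable \<nu> (\<lambda>x. exp ((\<gamma> + t) * x))"
      using h t by (intro int) auto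
    have i0: "integrable \<nu> (\<lambda>x. exp (\<gamma> * x))"
      using h by (intro int) auto
    have g: "?g x = exp (\<gamma> * x) * (exp (t * x) - 1 - t * x)" for x
      by (simp add: exp_add algebra_simps)
    have g0: "0 \<le> ?g x" for x
      unfolding g using exp_quadratic_remainder(1) by (intro mult_nonneg_nonneg) auto
    have g1: "?g x \<le> t\<^sup>2 * (2 / h\<^sup>2 * D x)" for x
    proof -
      have "?g x \<le> exp (\<gamma> * x) * ((t * x)\<^sup>2 * exp \<bar>t * x\<bar>)"
        unfolding g using exp_quadratic_remainder(2) by (intro mult_left_mono) auto
      also have "\<dots> \<le> exp (\<gamma> * x) * ((t * x)\<^sup>2 * exp (h * \<bar>x\<bar>))"
        using t by (intro mult_left_mono) (auto simp: abs_mult intro: mult_right_mono)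
      also have "\<dots> = t\<^sup>2 * (x\<^sup>2 * exp (\<gamma> * x) * exp (h * \<bar>x\<bar>))"
        by (simp add: power_mult_distrib mult_ac)
      also have "\<dots> \<le> t\<^sup>2 * (2 / h\<^sup>2 * D x)"
        by (intro mult_left_mono sq_D) auto
      finally show ?thesis .
    qed
    have eq: "mgf \<nu> (\<gamma> + t) - mgf \<nu> \<gamma> - t * (\<integral>x. x * exp (\<gamma> * x) \<partial>\<nu>) = (\<integral>x. ?g x \<partial>\<nu>)"
      unfolding mgf_def using i0 i1 int1 by simp
    have "0 \<le> (\<integral>x. ?g x \<partial>\<nu>)"
      using g0 by (intro integral_nonneg_AE) auto
    moreover have "(\<integral>x. ?g x \<partial>\<nu>) \<le> (\<integral>x. t\<^sup>2 * (2 / h\<^sup>2 * D x) \<partial>\<nu>)"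
      using g1 i0 i1 int1 by (intro integral_mono) auto
    ultimately show ?thesis
      unfolding eq by (simp add: mult_ac)
  qed
  have "0 \<le> 2 / h\<^sup>2 * (\<integral>x. D x \<partial>\<nu>)"
    using D_pos by (intro mult_nonneg_nonneg integral_nonneg_AE) (auto intro: less_imp_le)
  then have C: "0 < 2 / h\<^sup>2 * (\<integral>x. D x \<partial>\<nu>) + 1"
    by linarith
  show ?thesis
  proof (rule that[OF h C int1 int2])
    fix t :: real assume t: "\<bar>t\<bar> \<le> h"
    show "integrable \<nu> (\<lambda>x. exp ((\<gamma> + t) * x))"
      using h t by (intro int) auto
    show "\<bar>mgf \<nu> (\<gamma> + t) - mgf \<nu> \<gamma> - t * (\<integral>x. x * exp (\<gamma> * x) \<partial>\<nu>)\<bar> \<le> (2 / h\<^sup>2 * (\<integral>x. D x \<partial>\<nu>) + 1) * t\<^sup>2"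
      using est[OF t] zero_le_power2[of t] unfolding distrib_right by linarith
  qed
qed

lemma DERIV_mgf:
  assumes \<nu>: "real_distribution \<nu>" and \<gamma>: "\<gamma> \<in> interior {\<theta>. integrable \<nu> (\<lambda>x. exp (\<theta> * x))}"
  shows "(mgf \<nu> has_real_derivative (\<integral>x. x * exp (\<gamma> * x) \<partial>\<nu>)) (at \<gamma>)"
proof -
  let ?m = "\<integral>x. x * exp (\<gamma> * x) \<partial>\<nu>"
  from mgf_quadratic[OF assms] obtain h\<^sub>0 C where h: "0 < h\<^sub>0" "0 < C" and
    est: "\<And>h. \<bar>h\<bar> \<le> h\<^sub>0 \<Longrightarrow> \<bar>mgf \<nu> (\<gamma> + h) - mgf \<nu> \<gamma> - h * ?m\<bar> \<le> C * h\<^sup>2"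
    by metis
  have "((\<lambda>h. (mgf \<nu> (\<gamma> + h) - mgf \<nu> \<gamma>) / h - ?m) \<longlongrightarrow> 0) (at 0)"
  proof (rule tendsto_0_le[where K=C])
    show "((\<lambda>h. h) \<longlongrightarrow> (0 :: real)) (at 0)" by (rule tendsto_ident_at)
    have "eventually (\<lambda>h. \<bar>h\<bar> \<le> h\<^sub>0 \<and> h \<noteq> 0) (at (0::real))"
      using h(1) unfolding eventually_at by (intro exI[of _ h\<^sub>0]) (auto simp: dist_real_def)
    then show "eventually (\<lambda>h. norm ((mgf \<nu> (\<gamma> + h) - mgf \<nu> \<gamma>) / h - ?m) \<le> norm h * C) (at 0)"
    proof eventually_elim
      case (elim t)
      have "norm ((mgf \<nu> (\<gamma> + t) - mgf \<nu> \<gamma>) / t - ?m) = \<bar>mgf \<nu> (\<gamma> + t) - mgf \<nu> \<gamma> - t * ?m\<bar> / \<bar>t\<bar>"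
        using elim by (simp add: abs_divide[symmetric] diff_divide_distrib)
      also have "\<dots> \<le> C * t\<^sup>2 / \<bar>t\<bar>"
        using est elim by (intro divide_right_mono) auto
      also have "\<dots> = norm t * C"
        using elim by (cases "0 < t") (auto simp: power2_eq_square field_simps)
      finally show ?case .
    qed
  qed
  then show ?thesis
    unfolding DERIV_def by (simp add: LIM_zero_iff)
qed

lemma mgf_pos:
  assumes "real_distribution \<nu>" "integrable \<nu> (\<lambda>x. exp (\<theta> * x))"
  shows "0 < mgf \<nu> \<theta>"
proof -
  interpret real_distribution \<nu> by fact
  have "mgf \<nu> \<theta> \<noteq> 0"
  proof
    assume "mgf \<nu> \<theta> = 0"
    then have "AE x in \<nu>. exp (\<theta> * x) = 0"
      unfolding mgf_def using assms(2) by (subst (asm) integral_nonneg_eq_0_iff_AE) auto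
    then show False by simp
  qed
  moreover have "0 \<le> mgf \<nu> \<theta>"
    by (auto simp: mgf_def integral_nonneg_AE)
  ultimately show ?thesis by simp
qed

lemma deriv_log_mgf:
  assumes "real_distribution \<nu>" "\<gamma> \<in> interior {\<theta>. integrable \<nu> (\<lambda>x. exp (\<theta> * x))}" "mgf \<nu> \<gamma> = 1"
  shows "deriv (\<lambda>\<theta>. ln (mgf \<nu> \<theta>)) \<gamma> = (\<integral>x. x * exp (\<gamma> * x) \<partial>\<nu>)"
  using DERIV_chain2[OF DERIV_ln DERIV_mgf[OF assms(1,2)]] assms(3)
  by (intro DERIV_imp_deriv) simp

text \<open>Integrating \<open>exp (\<gamma> x) - 1 \<le> \<gamma> x exp (\<gamma> x)\<close>, which is strict for \<open>x \<noteq> 0\<close>,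
turns the value 1 at \<open>\<gamma>\<close> into a positive integral.\<close>
lemma mgf_derivative_pos:
  assumes \<nu>: "real_distribution \<nu>" and int: "integrable \<nu> (\<lambda>x. exp (\<gamma> * x))" "integrable \<nu> (\<lambda>x. x * exp (\<gamma> * x))"
    and one: "mgf \<nu> \<gamma> = 1" and "0 < \<gamma>" and nz: "\<not> (AE x in \<nu>. x = 0)"
  shows "0 < (\<integral>x. x * exp (\<gamma> * x) \<partial>\<nu>)"
proof -
  interpret real_distribution \<nu> by fact
  let ?g = "\<lambda>x. \<gamma> * (x * exp (\<gamma> * x)) - exp (\<gamma> * x) + 1"
  have gt: "0 < ?g x" if "x \<noteq> 0" for x
  proof -
    have "(1 - \<gamma> * x) * exp (\<gamma> * x) < exp (- (\<gamma> * x)) * exp (\<gamma> * x)"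
      using exp_strict_ge_add_one[of "- (\<gamma> * x)"] that \<open>0 < \<gamma>\<close> by (intro mult_strict_right_mono) auto
    then show ?thesis by (simp add: algebra_simps flip: exp_add)
  qed
  have ge: "0 \<le> ?g x" for x
    using gt[of x] by (cases "x = 0") auto
  have i: "integrable \<nu> ?g" using int by auto
  have "(\<integral>x. ?g x \<partial>\<nu>) \<noteq> 0"
  proof
    assume "(\<integral>x. ?g x \<partial>\<nu>) = 0"
    then have "AE x in \<nu>. ?g x = 0"
      using integral_nonneg_eq_0_iff_AE[OF i] ge by auto
    then have "AE x in \<nu>. x = 0"
      by (rule AE_mp) (use gt in \<open>force intro!: AE_I2\<close>)
    with nz show False by simp
  qed
  moreover have "0 \<le> (\<integral>x. ?g x \<partial>\<nu>)"
    using ge by (intro integral_nonneg_AE) auto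
  moreover have "(\<integral>x. ?g x \<partial>\<nu>) = \<gamma> * (\<integral>x. x * exp (\<gamma> * x) \<partial>\<nu>)"
    using int one prob_space by (simp add: mgf_def)
  ultimately have "0 < \<gamma> * (\<integral>x. x * exp (\<gamma> * x) \<partial>\<nu>)"
    by linarith
  with \<open>0 < \<gamma>\<close> show ?thesis
    by (simp add: zero_less_mult_iff)
qed

text \<open>Strict convexity, together with the value 1 at both 0 and \<open>\<gamma>\<close>.\<close>
lemma mgf_less_one_between:
  assumes \<nu>: "real_distribution \<nu>" and int: "integrable \<nu> (\<lambda>x. exp (\<gamma> * x))" 
    and one: "mgf \<nu> \<gamma> = 1" and \<theta>: "0 < \<theta>" "\<theta> < \<gamma>" and nz: "\<not> (AE x in \<nu>. x = 0)"
  shows "integrable \<nu> (\<lambda>x. exp (\<theta> * x))" "mgf \<nu> \<theta> < 1"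
proof -
  interpret real_distribution \<nu> by fact
  define p where "p = \<theta> / \<gamma>"
  have p: "0 < p" "p < 1" using \<theta> by (auto simp: p_def)
  have \<theta>p: "\<theta> = p * \<gamma>" using \<theta> by (simp add: p_def)
  let ?g = "\<lambda>x. 1 - p + p * exp (\<gamma> * x) - exp (\<theta> * x)"
  have gt: "0 < ?g x" if "x \<noteq> 0" for x
  proof -
    let ?u = "\<gamma> * x"
    have "(1 - p * ?u) * exp (p * ?u) < exp (- (p * ?u)) * exp (p * ?u)"
      using exp_strict_ge_add_one[of "- (p * ?u)"] that \<theta> p by (intro mult_strict_right_mono) auto
    then have 1: "(1 - p * ?u) * exp (p * ?u) < 1"
      by (simp flip: exp_add)
    have "(1 + (?u - p * ?u)) * exp (p * ?u) \<le> exp (?u - p * ?u) * exp (p * ?u)"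
      by (intro mult_right_mono exp_ge_add_one_self) auto
    then have 2: "(1 + (?u - p * ?u)) * exp (p * ?u) \<le> exp ?u"
      by (simp flip: exp_add)
    have "exp (\<theta> * x) = (1 - p) * ((1 - p * ?u) * exp (p * ?u)) + p * ((1 + (?u - p * ?u)) * exp (p * ?u))"
      by (simp add: \<theta>p algebra_simps)
    also have "\<dots> < (1 - p) * 1 + p * exp ?u"
      using p 1 2 by (intro add_less_le_mono mult_strict_left_mono mult_left_mono) auto
    finally show ?thesis by simp
  qed
  have ge: "0 \<le> ?g x" for x
    using gt[of x] by (cases "x = 0") auto
  show i\<theta>: "integrable \<nu> (\<lambda>x. exp (\<theta> * x))"
  proof (rule Bochner_Integration.integrable_bound)
    show "integrable \<nu> (\<lambda>x. 1 - p + p * exp (\<gamma> * x))" using int by auto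
    show "AE x in \<nu>. norm (exp (\<theta> * x)) \<le> norm (1 - p + p * exp (\<gamma> * x))"
      using ge p by (intro AE_I2) (smt (verit) exp_gt_zero real_norm_def)
  qed simp
  have i: "integrable \<nu> ?g" using int i\<theta> by auto
  have "(\<integral>x. ?g x \<partial>\<nu>) \<noteq> 0"
  proof
    assume "(\<integral>x. ?g x \<partial>\<nu>) = 0"
    then have "AE x in \<nu>. ?g x = 0"
      using integral_nonneg_eq_0_iff_AE[OF i] ge by auto
    then have "AE x in \<nu>. x = 0"
      by (rule AE_mp) (use gt in \<open>force intro!: AE_I2\<close>)
    with nz show False by simp
  qed
  moreover have "0 \<le> (\<integral>x. ?g x \<partial>\<nu>)"
    using ge by (intro integral_nonneg_AE) auto
  moreover have "(\<integral>x. ?g x \<partial>\<nu>) = 1 - mgf \<nu> \<theta>"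
    using int i\<theta> one prob_space by (simp add: mgf_def)
  ultimately show "mgf \<nu> \<theta> < 1"
    by simp
qed

text \<open>A non-negative variable has a sub-Gaussian lower tail as soon as it has a second moment:
\<open>exp (- u) \<le> 1 - u + u\<^sup>2/2\<close> for \<open>u \<ge> 0\<close>. This is the only exponential estimate on the interarrival
times.\<close>
lemma (in prob_space) mgf_centered_negative_le:
  assumes [measurable]: "X \<in> borel_measurable M" and nonneg: "AE \<omega> in M. 0 \<le> X \<omega>"
    and int: "integrable M X" "integrable M (\<lambda>\<omega>. (X \<omega>)\<^sup>2)" and "0 \<le> s"
  defines "\<rho> \<equiv> distr M borel (\<lambda>\<omega>. expectation X - X \<omega>)"
  shows "integrable \<rho> (\<lambda>x. exp (s * x))"
    and "mgf \<rho> s \<le> exp (s\<^sup>2 * expectation (\<lambda>\<omega>. (X \<omega>)\<^sup>2) / 2)"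
proof -
  let ?a = "expectation X"
  have i: "integrable M (\<lambda>\<omega>. exp (s * (?a - X \<omega>)))"
  proof (rule integrable_const_bound[where B="exp (s * ?a)"])
    show "AE \<omega> in M. norm (exp (s * (?a - X \<omega>))) \<le> exp (s * ?a)"
      using nonneg by eventually_elim (use \<open>0 \<le> s\<close> in \<open>auto intro: mult_left_mono\<close>)
  qed simp
  show "integrable \<rho> (\<lambda>x. exp (s * x))"
    unfolding \<rho>_def using i by (subst integrable_distr_eq) auto
  have "mgf \<rho> s = expectation (\<lambda>\<omega>. exp (s * (?a - X \<omega>)))"
    unfolding mgf_def \<rho>_def by (subst integral_distr) auto
  also have "\<dots> \<le> expectation (\<lambda>\<omega>. exp (s * ?a) * (1 - s * X \<omega> + s\<^sup>2 * (X \<omega>)\<^sup>2 / 2))"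
  proof (rule integral_mono_AE[OF i])
    show "integrable M (\<lambda>\<omega>. exp (s * ?a) * (1 - s * X \<omega> + s\<^sup>2 * (X \<omega>)\<^sup>2 / 2))"
      using int by auto
    show "AE \<omega> in M. exp (s * (?a - X \<omega>)) \<le> exp (s * ?a) * (1 - s * X \<omega> + s\<^sup>2 * (X \<omega>)\<^sup>2 / 2)"
      using nonneg
    proof eventually_elim
      case (elim \<omega>)
      then have "exp (- (s * X \<omega>)) \<le> 1 - s * X \<omega> + (s * X \<omega>)\<^sup>2 / 2"
        using \<open>0 \<le> s\<close> by (intro exp_minus_le_quadratic) auto
      then have "exp (s * ?a) * exp (- (s * X \<omega>)) \<le> exp (s * ?a) * (1 - s * X \<omega> + (s * X \<omega>)\<^sup>2 / 2)"
        by (intro mult_left_mono) auto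
      then show ?case
        by (simp add: power_mult_distrib algebra_simps flip: exp_add)
    qed
  qed
  also have "\<dots> = exp (s * ?a) * (1 + (- (s * ?a) + s\<^sup>2 * expectation (\<lambda>\<omega>. (X \<omega>)\<^sup>2) / 2))"
    using int prob_space by simp
  also have "\<dots> \<le> exp (s * ?a) * exp (- (s * ?a) + s\<^sup>2 * expectation (\<lambda>\<omega>. (X \<omega>)\<^sup>2) / 2)"
    by (intro mult_left_mono exp_ge_add_one_self) auto
  also have "\<dots> = exp (s\<^sup>2 * expectation (\<lambda>\<omega>. (X \<omega>)\<^sup>2) / 2)"
    by (simp flip: exp_add)
  finally show "mgf \<rho> s \<le> exp (s\<^sup>2 * expectation (\<lambda>\<omega>. (X \<omega>)\<^sup>2) / 2)" .
qed

section \<open>A sharp lower bound for the tail\<close>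

lemma nn_integral_conv_power_shift:
  assumes \<nu>: "real_distribution \<nu>" and [measurable]: "f \<in> borel_measurable borel"
  shows "(\<integral>\<^sup>+x. f x \<partial>conv_power (distr \<nu> borel (\<lambda>x. x - c)) n) =
    (\<integral>\<^sup>+x. f (x - real n * c) \<partial>conv_power \<nu> n)"
  using assms(2)
proof (induction n arbitrary: f)
  case 0
  then show ?case by (simp add: nn_integral_return)
next
  case (Suc n)
  note [measurable] = Suc.prems
  interpret \<nu>: real_distribution \<nu> by fact
  interpret \<nu>': real_distribution "distr \<nu> borel (\<lambda>x. x - c)" by (rule \<nu>.real_distribution_distr) simp
  interpret c: real_distribution "conv_power \<nu> n"
    by (rule real_distribution_conv_power) fact
  interpret c': real_distribution "conv_power (distr \<nu> borel (\<lambda>x. x - c)) n"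
    by (intro real_distribution_conv_power \<nu>'.real_distribution_axioms)
  have "(\<integral>\<^sup>+x. f x \<partial>conv_power (distr \<nu> borel (\<lambda>x. x - c)) (Suc n)) =
     (\<integral>\<^sup>+x. \<integral>\<^sup>+y. f (x + y) \<partial>conv_power (distr \<nu> borel (\<lambda>x. x - c)) n \<partial>distr \<nu> borel (\<lambda>x. x - c))"
    by (simp add: nn_integral_convolution \<nu>'.finite_measure_axioms c'.finite_measure_axioms)
  also have "\<dots> = (\<integral>\<^sup>+x. \<integral>\<^sup>+y. f (x + (y - real n * c)) \<partial>conv_power \<nu> n \<partial>distr \<nu> borel (\<lambda>x. x - c))"
    by (intro nn_integral_cong Suc.IH) simp
  also have "\<dots> = (\<integral>\<^sup>+x. \<integral>\<^sup>+y. f (x - c + (y - real n * c)) \<partial>conv_power \<nu> n \<partial>\<nu>)"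
    by (subst nn_integral_distr) auto
  also have "\<dots> = (\<integral>\<^sup>+x. \<integral>\<^sup>+y. f (x + y - real (Suc n) * c) \<partial>conv_power \<nu> n \<partial>\<nu>)"
    by (simp add: algebra_simps)
  also have "\<dots> = (\<integral>\<^sup>+x. f (x - real (Suc n) * c) \<partial>conv_power \<nu> (Suc n))"
    using nn_integral_convolution[OF \<nu>.finite_measure_axioms c.finite_measure_axioms
        c.events_eq_borel \<nu>.events_eq_borel, of "\<lambda>x. f (x - real (Suc n) * c)"]
    by simp
  finally show ?case .
qed

lemma normal_interval_pos:
  assumes "a < b" "0 < \<sigma>"
  shows "0 < measure (distr std_normal_distribution borel (\<lambda>x. \<sigma> * x)) {a<..b}"
proof -
  interpret N: real_distribution std_normal_distribution by (rule real_dist_normal_dist)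
  have eq: "{u. a < \<sigma> * u \<and> \<sigma> * u \<le> b} = {a / \<sigma><..b / \<sigma>}"
    using \<open>0 < \<sigma>\<close> by (auto simp: field_simps)
  have "measure (distr std_normal_distribution borel (\<lambda>x. \<sigma> * x)) {a<..b} =
      measure std_normal_distribution {a / \<sigma><..b / \<sigma>}"
    by (subst measure_distr) (auto simp: vimage_def eq)
  moreover have "measure std_normal_distribution {a / \<sigma><..b / \<sigma>} \<noteq> 0"
  proof
    assume "measure std_normal_distribution {a / \<sigma><..b / \<sigma>} = 0"
    then have "AE u in std_normal_distribution. u \<notin> {a / \<sigma><..b / \<sigma>}"
      by (subst (asm) N.prob_eq_0) auto
    then have "AE u in lborel. 0 < ennreal (std_normal_density u) \<longrightarrow> u \<notin> {a / \<sigma><..b / \<sigma>}"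
      by (subst (asm) AE_density) auto
    then have "AE u in lborel. u \<notin> {a / \<sigma><..b / \<sigma>}"
      by (rule AE_mp) (auto simp: normal_density_pos)
    then have "emeasure lborel {a / \<sigma><..b / \<sigma>} = 0"
      by (subst (asm) AE_iff_measurable[of "{a / \<sigma><..b / \<sigma>}"]) auto
    then show False
      using assms by (simp add: divide_strict_right_mono field_simps)
  qed
  ultimately show ?thesis
    by (simp add: zero_less_measure_iff)
qed

text \<open>Under the tilted law the sum has mean \<open>m n\<close> and falls between \<open>m n - a sqrt n\<close> and
\<open>m n - a/2 sqrt n\<close> with a probability that converges to a positive number. Undoing the tilt costs at
most \<open>exp (-\<gamma> (m n - a/2 sqrt n))\<close>, which beats \<open>exp (-\<gamma> m n)\<close> by the diverging factor
\<open>exp (\<gamma> a/2 sqrt n)\<close>.\<close>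
lemma conv_power_tail_lower_bound:
  fixes \<gamma> a :: real
  assumes \<nu>: "real_distribution \<nu>" and \<gamma>: "\<gamma> \<in> interior {\<theta>. integrable \<nu> (\<lambda>x. exp (\<theta> * x))}"
    and one: "mgf \<nu> \<gamma> = 1" and "0 < \<gamma>" and nz: "\<not> (AE x in \<nu>. x = 0)" and "0 < a"
  defines "m \<equiv> \<integral>x. x * exp (\<gamma> * x) \<partial>\<nu>"
  shows "filterlim (\<lambda>n. exp (\<gamma> * m * real n) * measure (conv_power \<nu> n) {m * real n - a * sqrt (real n)<..})
    at_top sequentially"
proof -
  interpret \<nu>: real_distribution \<nu> by fact
  have int: "integrable \<nu> (\<lambda>x. x * exp (\<gamma> * x))" "integrable \<nu> (\<lambda>x. x\<^sup>2 * exp (\<gamma> * x))"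
    by (rule mgf_quadratic[OF \<nu> \<gamma>], assumption)+
  have int0: "integrable \<nu> (\<lambda>x. exp (\<gamma> * x))"
    using interior_subset \<gamma> by blast
  have m: "0 < m"
    unfolding m_def by (rule mgf_derivative_pos[OF \<nu> int0 int(1) one \<open>0 < \<gamma>\<close> nz])
  define \<mu> where "\<mu> = tilt \<gamma> \<nu>"
  interpret \<mu>: real_distribution \<mu>
    unfolding \<mu>_def using one by (intro real_distribution_tilt \<nu> int0) (simp add: mgf_def)
  have integrable_\<mu>: "integrable \<mu> f \<longleftrightarrow> integrable \<nu> (\<lambda>x. exp (\<gamma> * x) * f x)"
    and integral_\<mu>: "(\<integral>x. f x \<partial>\<mu>) = (\<integral>x. exp (\<gamma> * x) * f x \<partial>\<nu>)"
    if "f \<in> borel_measurable borel" for f :: "real \<Rightarrow> real"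
    using that unfolding \<mu>_def tilt_def
    by (simp_all add: integrable_density integral_density)
  have \<mu>1: "integrable \<mu> (\<lambda>x. x)" and \<mu>2: "integrable \<mu> (\<lambda>x. x\<^sup>2)" and mean: "(\<integral>x. x \<partial>\<mu>) = m"
    using int by (simp_all add: integrable_\<mu> integral_\<mu> m_def mult.commute)
  define \<mu>' where "\<mu>' = distr \<mu> borel (\<lambda>x. x - m)"
  interpret \<mu>': real_distribution \<mu>'
    unfolding \<mu>'_def by (rule \<mu>.real_distribution_distr) simp
  have int': "integrable \<mu>' (\<lambda>x. x\<^sup>2)"
  proof -
    have "integrable \<mu> (\<lambda>x. x\<^sup>2 - 2 * m * x + m\<^sup>2)"
      using \<mu>1 \<mu>2 by simp
    also have "(\<lambda>x. x\<^sup>2 - 2 * m * x + m\<^sup>2) = (\<lambda>x. (x - m)\<^sup>2)"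
      by (simp add: fun_eq_iff power2_eq_square algebra_simps)
    finally show ?thesis
      unfolding \<mu>'_def by (simp add: integrable_distr_eq)
  qed
  have mean': "(\<integral>x. x \<partial>\<mu>') = 0"
  proof -
    have "(\<integral>x. x \<partial>\<mu>') = (\<integral>x. x - m \<partial>\<mu>)"
      unfolding \<mu>'_def by (rule integral_distr) simp_all
    also have "\<dots> = (\<integral>x. x \<partial>\<mu>) - (\<integral>x. m \<partial>\<mu>)"
      by (rule Bochner_Integration.integral_diff[OF \<mu>1]) simp
    also have "\<dots> = 0"
      using \<mu>.prob_space unfolding mean by simp
    finally show ?thesis .
  qed
  define \<sigma> where "\<sigma> = sqrt (\<integral>x. x\<^sup>2 \<partial>\<mu>')"
  \<comment> \<open>A law concentrated at a single point would have to sit at 0 to satisfy the equation for \<open>\<gamma>\<close>, but its mean \<open>m\<close> is positive.\<close>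
  have "(\<integral>x. x\<^sup>2 \<partial>\<mu>') \<noteq> 0"
  proof
    assume "(\<integral>x. x\<^sup>2 \<partial>\<mu>') = 0"
    then have "AE x in \<mu>'. x\<^sup>2 = 0"
      using int' by (subst integral_nonneg_eq_0_iff_AE[symmetric]) auto
    then have "AE x in \<mu>. x = m"
      unfolding \<mu>'_def by (simp add: AE_distr_iff)
    then have AE_m: "AE x in \<nu>. x = m"
      unfolding \<mu>_def tilt_def by (simp add: AE_density)
    then have "mgf \<nu> \<gamma> = (\<integral>x. exp (\<gamma> * m) \<partial>\<nu>)"
      unfolding mgf_def using AE_mp[OF AE_m] by (intro integral_cong_AE) auto
    with one have "exp (\<gamma> * m) = 1"
      using \<nu>.prob_space by simp
    with m \<open>0 < \<gamma>\<close> show False by simp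
  qed
  moreover have "0 \<le> (\<integral>x. x\<^sup>2 \<partial>\<mu>')"
    by (intro integral_nonneg_AE) auto
  ultimately have "0 < (\<integral>x. x\<^sup>2 \<partial>\<mu>')"
    by linarith
  then have \<sigma>: "0 < \<sigma>" "(\<integral>x. x\<^sup>2 \<partial>\<mu>') = \<sigma>\<^sup>2"
    unfolding \<sigma>_def by simp_all
  define D where "D n = distr (conv_power \<mu>' n) borel (\<lambda>x. x / sqrt (real n))" for n
  have clt: "weak_conv_m D (distr std_normal_distribution borel (\<lambda>x. \<sigma> * x))"
    unfolding D_def
  proof (rule central_limit_theorem_conv_power[OF \<mu>'.real_distribution_axioms mean' int' \<sigma>(2)])
    show "(\<lambda>n. real n / real n) \<longlonglongrightarrow> 1"
      by (rule tendsto_eventually) (auto intro!: eventually_sequentiallyI[of 1])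
  qed (use \<sigma> in \<open>auto simp: filterlim_ident\<close>)
  interpret N: real_distribution "distr std_normal_distribution borel (\<lambda>x. \<sigma> * x)"
    by (intro prob_space.real_distribution_distr real_distribution.axioms(1)[OF real_dist_normal_dist]) simp
  have rdD: "real_distribution (D n)" for n
    unfolding D_def
    by (intro prob_space.real_distribution_distr
        real_distribution.axioms(1)[OF real_distribution_conv_power] \<mu>'.real_distribution_axioms) simp
  \<comment> \<open>The limiting probability, under the tilted law, of the strip used for the bound.\<close>
  define c where "c = measure (distr std_normal_distribution borel (\<lambda>x. \<sigma> * x)) {-a<..-a/2}"
  have c: "0 < c"
    unfolding c_def using \<open>0 < a\<close> \<sigma> by (intro normal_interval_pos) auto
  have lim: "(\<lambda>n. measure (D n) {-a<..-a/2}) \<longlonglongrightarrow> c"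
  proof -
    have cdf_lim: "(\<lambda>n. cdf (D n) x) \<longlonglongrightarrow> cdf (distr std_normal_distribution borel (\<lambda>x. \<sigma> * x)) x" if "x \<noteq> 0" for x
      using clt isCont_cdf_scaled_normal[OF that] by (simp add: weak_conv_m_def weak_conv_def)
    have "(\<lambda>n. cdf (D n) (-a/2) - cdf (D n) (-a)) \<longlonglongrightarrow>
      cdf (distr std_normal_distribution borel (\<lambda>x. \<sigma> * x)) (-a/2) - cdf (distr std_normal_distribution borel (\<lambda>x. \<sigma> * x)) (-a)"
      using \<open>0 < a\<close> by (intro tendsto_diff cdf_lim) auto
    moreover have "cdf (D n) (-a/2) - cdf (D n) (-a) = measure (D n) {-a<..-a/2}" for n
      using finite_borel_measure.cdf_diff_eq[OF real_distribution.finite_borel_measure_M[OF rdD[of n]], of "-a" "-a/2"] \<open>0 < a\<close>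
      by simp
    ultimately show ?thesis
      using N.cdf_diff_eq[of "-a" "-a/2"] \<open>0 < a\<close> by (simp add: c_def)
  qed
  have bound: "exp (\<gamma> * a / 2 * sqrt (real n)) * measure (D n) {-a<..-a/2} \<le>
      exp (\<gamma> * m * real n) * measure (conv_power \<nu> n) {m * real n - a * sqrt (real n)<..}" if "0 < n" for n
  proof -
    let ?s = "sqrt (real n)"
    define B where "B = {m * real n - a * ?s<..m * real n - a / 2 * ?s}"
    have [measurable]: "B \<in> sets borel" by (simp add: B_def)
    have s: "0 < ?s" using that by simp
    interpret cn: real_distribution "conv_power \<nu> n"
      by (rule real_distribution_conv_power) fact
    interpret cm: real_distribution "conv_power \<mu> n"
      by (rule real_distribution_conv_power[OF \<mu>.real_distribution_axioms])
    have "emeasure (D n) {-a<..-a/2} = (\<integral>\<^sup>+x. indicator {-a<..-a/2} (x / ?s) \<partial>conv_power \<mu>' n)"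
      unfolding D_def by (subst nn_integral_indicator[symmetric]) (simp_all add: nn_integral_distr del: nn_integral_indicator)
    also have "\<dots> = (\<integral>\<^sup>+x. indicator {-a<..-a/2} ((x - real n * m) / ?s) \<partial>conv_power \<mu> n)"
      unfolding \<mu>'_def by (rule nn_integral_conv_power_shift[OF \<mu>.real_distribution_axioms]) simp
    also have "\<dots> = (\<integral>\<^sup>+x. indicator B x \<partial>conv_power \<mu> n)"
      using s by (intro nn_integral_cong) (auto simp: indicator_def B_def field_simps)
    finally have D_eq: "emeasure (D n) {-a<..-a/2} = emeasure (conv_power \<mu> n) B"
      by simp
    have "ennreal (exp (- \<gamma> * (m * real n - a / 2 * ?s))) * emeasure (conv_power \<mu> n) B =
        (\<integral>\<^sup>+x. ennreal (exp (- \<gamma> * (m * real n - a / 2 * ?s))) * indicator B x \<partial>conv_power \<mu> n)"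
      by (simp add: nn_integral_cmult)
    also have "\<dots> \<le> (\<integral>\<^sup>+x. indicator B x * ennreal (exp (- \<gamma> * x)) \<partial>conv_power \<mu> n)"
      using \<open>0 < \<gamma>\<close> by (intro nn_integral_mono) (auto simp: indicator_def B_def intro!: ennreal_leI)
    also have "\<dots> = (\<integral>\<^sup>+x. indicator B x \<partial>conv_power \<nu> n)"
      unfolding \<mu>_def using one
      by (intro nn_integral_conv_power_tilt[symmetric] \<nu> int0) (auto simp: mgf_def)
    also have "\<dots> = emeasure (conv_power \<nu> n) B" by simp
    also have "\<dots> \<le> emeasure (conv_power \<nu> n) {m * real n - a * ?s<..}"
      by (intro emeasure_mono) (auto simp: B_def)
    finally have "exp (- \<gamma> * (m * real n - a / 2 * ?s)) * measure (conv_power \<mu> n) B \<le>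
        measure (conv_power \<nu> n) {m * real n - a * ?s<..}"
      by (simp add: cn.emeasure_eq_measure cm.emeasure_eq_measure ennreal_mult[symmetric])
    then have "exp (\<gamma> * m * real n) * (exp (- \<gamma> * (m * real n - a / 2 * ?s)) * measure (conv_power \<mu> n) B) \<le>
        exp (\<gamma> * m * real n) * measure (conv_power \<nu> n) {m * real n - a * ?s<..}"
      by (intro mult_left_mono) auto
    moreover have "exp (\<gamma> * m * real n) * exp (- \<gamma> * (m * real n - a / 2 * ?s)) = exp (\<gamma> * a / 2 * ?s)"
      by (simp add: algebra_simps flip: exp_add)
    moreover have "measure (conv_power \<mu> n) B = measure (D n) {-a<..-a/2}"
      using D_eq by (simp add: measure_def)
    ultimately show ?thesis
      by (simp only: mult.assoc[symmetric])
  qed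
  have "filterlim (\<lambda>n. exp (\<gamma> * a / 2 * sqrt (real n))) at_top sequentially"
    using \<open>0 < \<gamma>\<close> \<open>0 < a\<close> by real_asymp
  then have "filterlim (\<lambda>n. measure (D n) {-a<..-a/2} * exp (\<gamma> * a / 2 * sqrt (real n))) at_top sequentially"
    by (rule filterlim_tendsto_pos_mult_at_top[OF lim c])
  then show ?thesis
    by (rule filterlim_at_top_mono)
       (use bound in \<open>auto intro!: eventually_sequentiallyI[of 1] simp: mult.commute\<close>)
qed

section \<open>Lindley's recursion and the steady state\<close>

text \<open>Unfolding the recursion backwards from task \<open>n + 1\<close>: the maximising \<open>k\<close> counts the tasks since
the queue was last empty. The term \<open>k = 0\<close> is an empty sum and stands for the 0 in the maximum.\<close>
lemma less_waiting_time_iff: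
  "y < waiting_time s a (Suc n) \<longleftrightarrow> (\<exists>k\<le>n. y < (\<Sum>l<k. s (n - l) - a (Suc n - l)))"
proof (induction n arbitrary: y)
  case 0
  show ?case by simp
next
  case (Suc n)
  let ?c = "s (Suc n) - a (Suc (Suc n))"
  have sum: "(\<Sum>l<Suc k. s (Suc n - l) - a (Suc (Suc n) - l)) = ?c + (\<Sum>l<k. s (n - l) - a (Suc n - l))" for k
    by (subst sum.lessThan_Suc_shift) simp
  have "y < waiting_time s a (Suc (Suc n)) \<longleftrightarrow> y < 0 \<or> y - ?c < waiting_time s a (Suc n)"
    by (auto simp: less_max_iff_disj)
  also have "\<dots> \<longleftrightarrow> y < 0 \<or> (\<exists>k\<le>n. y < (\<Sum>l<Suc k. s (Suc n - l) - a (Suc (Suc n) - l)))"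
    unfolding Suc.IH sum by (auto simp: algebra_simps)
  also have "\<dots> \<longleftrightarrow> (\<exists>k\<le>Suc n. y < (\<Sum>l<k. s (Suc n - l) - a (Suc (Suc n) - l)))"
  proof safe
    fix k assume "k \<le> Suc n" "y < (\<Sum>l<k. s (Suc n - l) - a (Suc (Suc n) - l))"
      and "\<not> (\<exists>k\<le>n. y < (\<Sum>l<Suc k. s (Suc n - l) - a (Suc (Suc n) - l)))"
    then show "y < 0" by (cases k) auto
  qed (auto intro: exI[of _ 0] exI[of _ "Suc _"])
  finally show ?case .
qed

lemma waiting_time_measurable:
  assumes "\<And>j. 1 \<le> j \<Longrightarrow> s j \<in> borel_measurable P" "\<And>j. 1 \<le> j \<Longrightarrow> a j \<in> borel_measurable P"
  shows "(\<lambda>\<omega>. waiting_time (\<lambda>j. s j \<omega>) (\<lambda>j. a j \<omega>) n) \<in> borel_measurable P"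
proof (induction n)
  case (Suc n)
  then show ?case
    using assms by (cases n) auto
qed simp

lemma continuous_on_Max_coordinates:
  assumes "finite I" "I \<noteq> {}"
  shows "continuous_on UNIV (\<lambda>x :: 'i \<Rightarrow> real. Max (x ` I))"
  using assms
proof (induction I rule: finite_ne_induct)
  case (insert i I)
  have "(\<lambda>x :: 'i \<Rightarrow> real. Max (x ` insert i I)) = (\<lambda>x. max (x i) (Max (x ` I)))"
    using insert by (simp add: fun_eq_iff)
  then show ?case
    using insert by (auto intro!: continuous_on_max)
qed simp

lemma cts_step_continuous: "a < b \<Longrightarrow> continuous_on UNIV (cts_step a b)"
  by (intro uniformly_continuous_imp_continuous cts_step_uniformly_continuous)

text \<open>The maximum of finitely many coordinates is continuous in the product topology, so a continuous
bounded function of it is an admissible test function.\<close>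
lemma steady_state_max_integral_limit:
  assumes st: "steady_state_waiting_times N P S A Q W" and "1 \<le> N" and "prob_space P"
    and S: "\<And>i j. i \<in> {1..N} \<Longrightarrow> 1 \<le> j \<Longrightarrow> S i j \<in> borel_measurable P"
    and A: "\<And>j. 1 \<le> j \<Longrightarrow> A j \<in> borel_measurable P" and "a < b"
  defines "D n \<equiv> distr P borel (\<lambda>\<omega>. Max ((\<lambda>i. waiting_time (\<lambda>j. S i j \<omega>) (\<lambda>j. A j \<omega>) n) ` {1..N}))"
    and "D' \<equiv> distr Q borel (\<lambda>\<omega>. Max ((\<lambda>i. W i \<omega>) ` {1..N}))"
  shows "(\<lambda>n. \<integral>x. cts_step a b x \<partial>D n) \<longlonglongrightarrow> (\<integral>x. cts_step a b x \<partial>D')"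
    and "real_distribution (D n)" and "real_distribution D'"
proof -
  interpret P: prob_space P by fact
  interpret Q: prob_space Q using st by (simp add: steady_state_waiting_times_def)
  let ?V = "\<lambda>n \<omega>. Max ((\<lambda>i. waiting_time (\<lambda>j. S i j \<omega>) (\<lambda>j. A j \<omega>) n) ` {1..N})"
  let ?U = "\<lambda>\<omega>. Max ((\<lambda>i. W i \<omega>) ` {1..N})"
  have V: "?V n \<in> borel_measurable P" for n
    using S A by (intro borel_measurable_Max waiting_time_measurable) auto
  have U: "?U \<in> borel_measurable Q"
    using st by (intro borel_measurable_Max) (auto simp: steady_state_waiting_times_def)
  show "real_distribution (D n)" "real_distribution D'"
    unfolding D_def D'_def using V U by simp_all
  let ?f = "\<lambda>x :: nat \<Rightarrow> real. cts_step a b (Max (x ` {1..N}))"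
  have cont: "continuous_on UNIV ?f"
    by (rule continuous_on_compose2[OF cts_step_continuous[OF \<open>a < b\<close>] continuous_on_Max_coordinates])
       (use \<open>1 \<le> N\<close> in auto)
  have "\<bar>cts_step a b x\<bar> \<le> 1" for x
    using \<open>a < b\<close> by (auto simp: cts_step_def abs_if field_simps)
  then have "bounded (range ?f)"
    by (intro boundedI[of _ 1]) auto
  with st cont have "(\<lambda>n. \<integral>\<omega>. ?f (\<lambda>i\<in>{1..N}. waiting_time (\<lambda>j. S i j \<omega>) (\<lambda>j. A j \<omega>) n) \<partial>P) \<longlonglongrightarrow>
      (\<integral>\<omega>. ?f (\<lambda>i\<in>{1..N}. W i \<omega>) \<partial>Q)"
    unfolding steady_state_waiting_times_def tendsto_in_distribution_def by blast
  moreover have [measurable]: "cts_step a b \<in> borel_measurable borel"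
    by (intro borel_measurable_continuous_onI cts_step_continuous \<open>a < b\<close>)
  moreover have "restrict g {1..N} ` {1..N} = g ` {1..N}" for g :: "nat \<Rightarrow> real"
    by (rule image_cong) auto
  ultimately show "(\<lambda>n. \<integral>x. cts_step a b x \<partial>D n) \<longlonglongrightarrow> (\<integral>x. cts_step a b x \<partial>D')"
    unfolding D_def D'_def using V U by (simp only: integral_distr)
qed

text \<open>A continuous step from 1 to 0 between \<open>a\<close> and \<open>b\<close> lies between the indicators of \<open>{..a}\<close> and
\<open>{..b}\<close>; the gap between the two levels pays for the discontinuity of the indicators.\<close>
lemma steady_state_max_cdf_bounds:
  assumes st: "steady_state_waiting_times N P S A Q W" and N: "1 \<le> N" and P: "prob_space P"
    and S: "\<And>i j. i \<in> {1..N} \<Longrightarrow> 1 \<le> j \<Longrightarrow> S i j \<in> borel_measurable P"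
    and A: "\<And>j. 1 \<le> j \<Longrightarrow> A j \<in> borel_measurable P" and ab: "a < b"
  defines "F n \<equiv> \<lambda>y. measure P {\<omega>\<in>space P. \<forall>i\<in>{1..N}. waiting_time (\<lambda>j. S i j \<omega>) (\<lambda>j. A j \<omega>) n \<le> y}"
    and "G \<equiv> \<lambda>y. measure Q {\<omega>\<in>space Q. Max ((\<lambda>i. W i \<omega>) ` {1..N}) \<le> y}"
  shows "eventually (\<lambda>n. F n b \<le> u) sequentially \<Longrightarrow> G a \<le> u"
    and "eventually (\<lambda>n. l \<le> F n a) sequentially \<Longrightarrow> l \<le> G b"
proof -
  interpret P: prob_space P by fact
  interpret Q: prob_space Q using st by (simp add: steady_state_waiting_times_def)
  let ?V = "\<lambda>n \<omega>. Max ((\<lambda>i. waiting_time (\<lambda>j. S i j \<omega>) (\<lambda>j. A j \<omega>) n) ` {1..N})"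
  let ?D = "\<lambda>n. distr P borel (?V n)"
  let ?D' = "distr Q borel (\<lambda>\<omega>. Max ((\<lambda>i. W i \<omega>) ` {1..N}))"
  note lim = steady_state_max_integral_limit[OF st N P S A ab]
  have V: "?V n \<in> borel_measurable P" for n
    using S A by (intro borel_measurable_Max waiting_time_measurable) auto
  have U: "(\<lambda>\<omega>. Max ((\<lambda>i. W i \<omega>) ` {1..N})) \<in> borel_measurable Q"
    using st by (intro borel_measurable_Max) (auto simp: steady_state_waiting_times_def)
  have F: "F n y = cdf (?D n) y" for n y
    unfolding F_def cdf_def using V N
    by (subst measure_distr) (auto intro!: arg_cong[where f="measure P"])
  have G: "G y = cdf ?D' y" for y
    unfolding G_def cdf_def using U
    by (subst measure_distr) (auto intro!: arg_cong[where f="measure Q"])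
  show "G a \<le> u" if ev: "eventually (\<lambda>n. F n b \<le> u) sequentially"
  proof -
    have "(\<integral>x. cts_step a b x \<partial>?D') \<le> u"
    proof (rule tendsto_upperbound[OF lim(1)])
      show "eventually (\<lambda>n. (\<integral>x. cts_step a b x \<partial>?D n) \<le> u) sequentially"
        using ev
      proof eventually_elim
        case (elim n)
        with real_distribution.cdf_cts_step(2)[OF lim(2) ab, of n] F[of n b] show ?case by linarith
      qed
    qed auto
    with real_distribution.cdf_cts_step(1)[OF lim(3) ab] show ?thesis
      unfolding G by linarith
  qed
  show "l \<le> G b" if ev: "eventually (\<lambda>n. l \<le> F n a) sequentially"
  proof -
    have "l \<le> (\<integral>x. cts_step a b x \<partial>?D')"
    proof (rule tendsto_lowerbound[OF lim(1)])
      show "eventually (\<lambda>n. l \<le> (\<integral>x. cts_step a b x \<partial>?D n)) sequentially"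
        using ev
      proof eventually_elim
        case (elim n)
        with real_distribution.cdf_cts_step(1)[OF lim(2) ab, of n] F[of n a] show ?case by linarith
      qed
    qed auto
    with real_distribution.cdf_cts_step(2)[OF lim(3) ab] show ?thesis
      unfolding G by linarith
  qed
qed

section \<open>Tail bounds on the scale of the maximum\<close>

text \<open>From here on \<open>q\<close> is the 16th root of the time at which the maximum is attained. With this scale the
time \<open>q^16\<close>, the fluctuations \<open>q^8\<close>, the window \<open>q^15\<close> and the tilts are all integer powers.\<close>
lemma sum_power_le_geometric:
  fixes r :: real
  assumes "0 \<le> r" "r < 1" "finite I"
  shows "(\<Sum>k\<in>I. r ^ k) \<le> 1 / (1 - r)"
proof -
  have "(\<Sum>k\<in>I. r ^ k) \<le> (\<Sum>k. r ^ k)"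
    using assms by (intro sum_le_suminf summable_geometric) auto
  then show ?thesis using assms by (simp add: suminf_geometric)
qed

lemma conv_power_tail_subgaussian:
  assumes \<rho>: "real_distribution \<rho>" and "0 \<le> s" and int: "integrable \<rho> (\<lambda>x. exp (s * x))"
    and mgf: "mgf \<rho> s \<le> exp (s\<^sup>2 * v / 2)"
  shows "measure (conv_power \<rho> k) {y<..} \<le> exp (- s * y + real k * (s\<^sup>2 * v / 2))"
proof -
  have "measure (conv_power \<rho> k) {y<..} \<le> exp (- s * y) * mgf \<rho> s ^ k"
    unfolding mgf_def by (rule chernoff_bound_conv_power[OF \<rho> int \<open>0 \<le> s\<close>])
  also have "\<dots> \<le> exp (- s * y) * exp (s\<^sup>2 * v / 2) ^ k"
    by (intro mult_left_mono power_mono mgf) (auto simp: mgf_def integral_nonneg_AE)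
  also have "\<dots> = exp (- s * y + real k * (s\<^sup>2 * v / 2))"
    by (simp only: exp_add exp_of_nat_mult)
  finally show ?thesis .
qed

text \<open>The barrier \<open>q^8 + k/q^4\<close> holds for the shared walk at all times simultaneously, since the bounds are
summable in \<open>k\<close>; its slope \<open>1/q^4\<close> is small enough not to disturb the bounds for the service times.\<close>
lemma conv_power_tail_linear_barrier:
  assumes \<rho>: "real_distribution \<rho>" and int: "\<And>s. 0 \<le> s \<Longrightarrow> integrable \<rho> (\<lambda>x. exp (s * x))"
    and mgf: "\<And>s. 0 \<le> s \<Longrightarrow> mgf \<rho> s \<le> exp (s\<^sup>2 * v / 2)" and "0 < v" "0 < q"
  shows "measure (conv_power \<rho> k) {q ^ 8 + real k / q ^ 4<..} \<le> exp (- (q ^ 4 / v)) * exp (- (1 / (2 * v * q ^ 8))) ^ k"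
proof -
  \<comment> \<open>This exponent spends half of the slope \<open>1/q^4\<close> on the variance.\<close>
  define s where "s = 1 / (v * q ^ 4)"
  have "0 \<le> s" using assms by (simp add: s_def)
  obtain Q where q8: "q ^ 4 = Q" "q ^ 8 = Q * Q"
    by (simp flip: power_add)
  then have "0 < Q" using \<open>0 < q\<close> by auto
  have "- s * (q ^ 8 + real k / q ^ 4) + real k * (s\<^sup>2 * v / 2) = - (q ^ 4 / v) + real k * - (1 / (2 * v * q ^ 8))"
  proof -
    have 1: "s * q ^ 8 = q ^ 4 / v"
      unfolding s_def q8 using \<open>0 < v\<close> \<open>0 < Q\<close> by simp
    have 2: "s * (real k / q ^ 4) = real k * (1 / (v * q ^ 8))"
      unfolding s_def q8 by simp
    have 3: "s\<^sup>2 * v / 2 = 1 / (2 * v * q ^ 8)"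
      unfolding s_def q8 using \<open>0 < v\<close> \<open>0 < Q\<close> by (simp add: power_divide power2_eq_square)
    show ?thesis
      unfolding 3 mult_minus_left distrib_left 1 2 by (simp add: field_simps)
  qed
  with conv_power_tail_subgaussian[OF \<rho> \<open>0 \<le> s\<close> int[OF \<open>0 \<le> s\<close>] mgf[OF \<open>0 \<le> s\<close>], of k "q ^ 8 + real k / q ^ 4"]
  show ?thesis by (simp only: exp_add exp_of_nat_mult)
qed

lemma conv_power_tail_short_increment:
  assumes \<rho>: "real_distribution \<rho>" and int: "\<And>s. 0 \<le> s \<Longrightarrow> integrable \<rho> (\<lambda>x. exp (s * x))"
    and mgf: "\<And>s. 0 \<le> s \<Longrightarrow> mgf \<rho> s \<le> exp (s\<^sup>2 * v / 2)" and "0 < v" "0 < q" "0 < e"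
    and k: "real k \<le> 2 * q ^ 15"
  shows "measure (conv_power \<rho> k) {e * q ^ 8<..} \<le> exp (- (e\<^sup>2 / (4 * v) * q))"
proof -
  \<comment> \<open>The minimiser of the quadratic exponent for \<open>k = 2 q^15\<close>.\<close>
  define s where "s = e / (2 * v * q ^ 7)"
  have "0 \<le> s" using assms by (simp add: s_def)
  obtain Q where Q: "q ^ 7 = Q" "q ^ 8 = q * Q" "q ^ 14 = Q * Q" "q ^ 15 = q * (Q * Q)"
    by (simp flip: power_add power_Suc)
  then have "0 < Q" using \<open>0 < q\<close> by auto
  have 1: "s * (e * q ^ 8) = e\<^sup>2 / (2 * v) * q"
    unfolding s_def Q using \<open>0 < v\<close> \<open>0 < Q\<close> by (simp add: power2_eq_square)
  have 2: "s\<^sup>2 * v / 2 = e\<^sup>2 / (8 * v * q ^ 14)"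
    unfolding s_def Q using \<open>0 < v\<close> \<open>0 < Q\<close> by (simp add: power_divide power2_eq_square)
  have "real k * (s\<^sup>2 * v / 2) \<le> (2 * q ^ 15) * (s\<^sup>2 * v / 2)"
    using k assms by (intro mult_right_mono) auto
  also have "\<dots> = e\<^sup>2 / (4 * v) * q"
    unfolding 2 Q using \<open>0 < v\<close> \<open>0 < Q\<close> by simp
  finally have "- s * (e * q ^ 8) + real k * (s\<^sup>2 * v / 2) \<le> - (e\<^sup>2 / (2 * v) * q) + e\<^sup>2 / (4 * v) * q"
    unfolding mult_minus_left 1 by linarith
  also have "\<dots> = - (e\<^sup>2 / (4 * v) * q)"
    by (simp add: field_simps)
  finally have "exp (- s * (e * q ^ 8) + real k * (s\<^sup>2 * v / 2)) \<le> exp (- (e\<^sup>2 / (4 * v) * q))"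
    by simp
  with conv_power_tail_subgaussian[OF \<rho> \<open>0 \<le> s\<close> int[OF \<open>0 \<le> s\<close>] mgf[OF \<open>0 \<le> s\<close>], of k "e * q ^ 8"]
  show ?thesis by linarith
qed

text \<open>For a time \<open>k\<close> with \<open>u = k - q^16\<close> the exponent \<open>\<gamma> + h\<close> in the Chernoff bound gives, up to small
terms, \<open>-\<gamma> m q^16 + u m h + k C h\<^sup>2\<close>. Taking \<open>h = - sgn u d/q\<close> makes the linear term negative and,
as \<open>k \<le> 2 q \<bar>u\<bar>\<close> outside the window, at least twice the size of the quadratic one. The gain \<open>\<bar>u\<bar>/q\<close> also
exceeds the allowance \<open>q^8 + k/q^4\<close> made for the shared walk, and what remains of it is summable
in \<open>k\<close>.\<close>
lemma conv_power_tail_off_window: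
  assumes \<nu>: "real_distribution \<nu>" and \<gamma>: "\<gamma> \<in> interior {\<theta>. integrable \<nu> (\<lambda>x. exp (\<theta> * x))}"
    and one: "mgf \<nu> \<gamma> = 1" and "0 < \<gamma>" and nz: "\<not> (AE x in \<nu>. x = 0)"
  defines "m \<equiv> \<integral>x. x * exp (\<gamma> * x) \<partial>\<nu>"
  obtains c where "0 < c" "eventually (\<lambda>q::real. \<forall>k. q ^ 15 < \<bar>real k - q ^ 16\<bar> \<longrightarrow>
    measure (conv_power \<nu> k) {m * q ^ 16 + z * q ^ 8 - (q ^ 8 + real k / q ^ 4)<..}
      \<le> exp (- (\<gamma> * m * q ^ 16)) * (exp (- (c * q ^ 14)) * exp (- (c / q\<^sup>2)) ^ k)) at_top"
proof -
  obtain h\<^sub>0 C where h0: "0 < h\<^sub>0" "0 < C"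
    and int1: "integrable \<nu> (\<lambda>x. x * exp (\<gamma> * x))" and "integrable \<nu> (\<lambda>x. x\<^sup>2 * exp (\<gamma> * x))"
    and int: "\<And>h. \<bar>h\<bar> \<le> h\<^sub>0 \<Longrightarrow> integrable \<nu> (\<lambda>x. exp ((\<gamma> + h) * x))"
    and est: "\<And>h. \<bar>h\<bar> \<le> h\<^sub>0 \<Longrightarrow> \<bar>mgf \<nu> (\<gamma> + h) - mgf \<nu> \<gamma> - h * m\<bar> \<le> C * h\<^sup>2"
  proof (rule mgf_quadratic[OF \<nu> \<gamma>, folded m_def], goal_cases)
    case (1 h\<^sub>0 C)
    show ?case by (rule 1(1)[OF 1(2-)])
  qed
  have m: "0 < m"
    unfolding m_def using int[of 0] h0 by (intro mgf_derivative_pos[OF \<nu> _ int1 one \<open>0 < \<gamma>\<close> nz]) simp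
  define d where "d = m / (4 * C)"
  have d: "0 < d" "C * d = m / 4" using m h0 by (auto simp: d_def)
  define c where "c = m * d / 16"
  have c: "0 < c" using m d by (simp add: c_def)
  have ev: "eventually (\<lambda>q. 1 \<le> q \<and> d / q \<le> h\<^sub>0 \<and> d / q \<le> \<gamma> \<and> 8 * \<gamma> * (3 + \<bar>z\<bar>) / (m * d) \<le> q\<^sup>2) at_top"
  proof (intro eventually_conj)
    show "eventually (\<lambda>q. d / q \<le> h\<^sub>0) at_top" using h0 d by real_asymp
    show "eventually (\<lambda>q. d / q \<le> \<gamma>) at_top" using \<open>0 < \<gamma>\<close> d by real_asymp
    show "eventually (\<lambda>q. 8 * \<gamma> * (3 + \<bar>z\<bar>) / (m * d) \<le> q\<^sup>2) at_top" by real_asymp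
  qed (rule eventually_ge_at_top)
  show ?thesis
  proof (rule that[OF c], use ev in eventually_elim, intro allI impI)
    fix q :: real and k :: nat
    assume q: "1 \<le> q \<and> d / q \<le> h\<^sub>0 \<and> d / q \<le> \<gamma> \<and> 8 * \<gamma> * (3 + \<bar>z\<bar>) / (m * d) \<le> q\<^sup>2"
      and k: "q ^ 15 < \<bar>real k - q ^ 16\<bar>"
    then have q1: "1 \<le> q" "0 < q" by auto
    define u where "u = real k - q ^ 16"
    \<comment> \<open>Early times are penalised by a larger exponent, late times by a smaller one.\<close>
    define h where "h = (if 0 \<le> u then - d / q else d / q)"
    have habs: "\<bar>h\<bar> = d / q" using d q1 by (simp add: h_def)
    have hle: "\<bar>h\<bar> \<le> h\<^sub>0" "0 \<le> \<gamma> + h" "\<gamma> + h \<le> 2 * \<gamma>"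
      using q habs by linarith+
    have uh: "u * h = - (\<bar>u\<bar> * d / q)" by (simp add: h_def)
    have u15: "q ^ 15 \<le> \<bar>u\<bar>" using k by (simp add: u_def)
    have "q * q ^ 15 \<le> q * \<bar>u\<bar>" using u15 q1 by (intro mult_left_mono) auto
    then have "q ^ 16 \<le> q * \<bar>u\<bar>" by (simp flip: power_Suc)
    moreover have "\<bar>u\<bar> \<le> q * \<bar>u\<bar>" using q1 by (simp add: mult_le_cancel_right1)
    ultimately have k2: "real k \<le> 2 * q * \<bar>u\<bar>" unfolding u_def by linarith
    define V where "V = m * d * (\<bar>u\<bar> / q)"
    define y where "y = m * q ^ 16 + z * q ^ 8 - (q ^ 8 + real k / q ^ 4)"
    define B where "B = (1 - z) * q ^ 8 + real k / q ^ 4"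
    have y: "y = m * q ^ 16 - B" by (simp add: y_def B_def algebra_simps)
    have "mgf \<nu> (\<gamma> + h) \<le> 1 + (m * h + C * h\<^sup>2)"
      using est[OF hle(1)] one by (simp add: mult.commute)
    also have "\<dots> \<le> exp (m * h + C * h\<^sup>2)" by (rule exp_ge_add_one_self)
    finally have mgf: "mgf \<nu> (\<gamma> + h) \<le> exp (m * h + C * h\<^sup>2)" .
    have "measure (conv_power \<nu> k) {y<..} \<le> exp (- (\<gamma> + h) * y) * mgf \<nu> (\<gamma> + h) ^ k"
      unfolding mgf_def by (rule chernoff_bound_conv_power[OF \<nu> int hle(2)]) (rule hle)
    also have "\<dots> \<le> exp (- (\<gamma> + h) * y) * exp (m * h + C * h\<^sup>2) ^ k"
      by (intro mult_left_mono power_mono mgf) (auto simp: mgf_def integral_nonneg_AE)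
    also have "\<dots> = exp (- (\<gamma> + h) * y + real k * (m * h + C * h\<^sup>2))"
      by (simp only: exp_add exp_of_nat_mult)
    also have "- (\<gamma> + h) * y + real k * (m * h + C * h\<^sup>2) =
        - (\<gamma> * m * q ^ 16) + (m * (u * h) + real k * (C * h\<^sup>2)) + (\<gamma> + h) * B"
      unfolding y u_def by (simp add: algebra_simps)
    also have "\<dots> \<le> - (\<gamma> * m * q ^ 16) + - (V / 2) + V / 4"
    proof (intro add_mono order_refl)
      have "h\<^sup>2 = d\<^sup>2 / q\<^sup>2" by (metis habs power2_abs power_divide)
      then have "real k * (C * h\<^sup>2) \<le> 2 * q * \<bar>u\<bar> * (C * (d\<^sup>2 / q\<^sup>2))"
        using h0 by (simp only:) (intro mult_right_mono k2, simp)
      also have "\<dots> = 2 * (C * d) * d * (\<bar>u\<bar> / q)"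
        using q1 by (simp add: power2_eq_square)
      also have "\<dots> = V / 2"
        unfolding d(2) V_def by simp
      finally have "real k * (C * h\<^sup>2) \<le> V / 2" .
      moreover have "m * (u * h) = - V"
        unfolding uh V_def by simp
      ultimately show "m * (u * h) + real k * (C * h\<^sup>2) \<le> - (V / 2)"
        by linarith
      have B: "B \<le> (3 + \<bar>z\<bar>) * (\<bar>u\<bar> / q ^ 3)"
      proof -
        have q8: "q ^ 8 \<le> \<bar>u\<bar> / q ^ 3"
        proof -
          have "q ^ 8 * q ^ 3 \<le> q ^ 15"
            using q1 by (simp flip: power_add add: power_increasing)
          with u15 q1 show ?thesis by (simp add: pos_le_divide_eq)
        qed
        have "(1 - z) * q ^ 8 \<le> (1 + \<bar>z\<bar>) * q ^ 8"
          using q1 by (intro mult_right_mono) auto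
        also have "\<dots> \<le> (1 + \<bar>z\<bar>) * (\<bar>u\<bar> / q ^ 3)"
          by (intro mult_left_mono q8) auto
        finally have B1: "(1 - z) * q ^ 8 \<le> (1 + \<bar>z\<bar>) * (\<bar>u\<bar> / q ^ 3)" .
        have "real k / q ^ 4 \<le> 2 * q * \<bar>u\<bar> / q ^ 4"
          using k2 q1 by (intro divide_right_mono) auto
        also have "\<dots> = 2 * (\<bar>u\<bar> / q ^ 3)"
          using q1 by (simp add: power4_eq_xxxx power3_eq_cube)
        finally have B2: "real k / q ^ 4 \<le> 2 * (\<bar>u\<bar> / q ^ 3)" .
        have "(3 + \<bar>z\<bar>) * w = (1 + \<bar>z\<bar>) * w + 2 * w" for w
          by (simp add: algebra_simps)
        then show ?thesis
          unfolding B_def by (simp only: add_mono[OF B1 B2])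
      qed
      have "(\<gamma> + h) * B \<le> (\<gamma> + h) * ((3 + \<bar>z\<bar>) * (\<bar>u\<bar> / q ^ 3))"
        by (intro mult_left_mono B hle)
      also have "\<dots> \<le> 2 * \<gamma> * ((3 + \<bar>z\<bar>) * (\<bar>u\<bar> / q ^ 3))"
        using q1 by (intro mult_right_mono hle) auto
      also have "\<dots> = (8 * \<gamma> * (3 + \<bar>z\<bar>) / (m * d)) * (m * d / 4 * (\<bar>u\<bar> / q ^ 3))"
        using m d by simp
      also have "\<dots> \<le> q\<^sup>2 * (m * d / 4 * (\<bar>u\<bar> / q ^ 3))"
        using q m d q1 by (intro mult_right_mono) auto
      also have "\<dots> = V / 4"
        unfolding V_def using q1 by (simp add: power2_eq_square power3_eq_cube)
      finally show "(\<gamma> + h) * B \<le> V / 4" .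
    qed
    also have "\<dots> = - (\<gamma> * m * q ^ 16) - 4 * c * (\<bar>u\<bar> / q)"
      by (simp add: c_def V_def)
    also have "\<dots> \<le> - (\<gamma> * m * q ^ 16) + (- (c * q ^ 14) + real k * - (c / q\<^sup>2))"
    proof -
      have 1: "q ^ 14 \<le> \<bar>u\<bar> / q"
        using u15 q1 by (simp add: pos_le_divide_eq flip: power_Suc2)
      have 2: "real k / q\<^sup>2 \<le> 2 * (\<bar>u\<bar> / q)"
        using divide_right_mono[OF k2, of "q\<^sup>2"] q1 by (simp add: power2_eq_square)
      have "0 \<le> \<bar>u\<bar> / q" using q1 by simp
      with 1 2 have "q ^ 14 + real k / q\<^sup>2 \<le> 4 * (\<bar>u\<bar> / q)" by linarith
      then have "c * (q ^ 14 + real k / q\<^sup>2) \<le> c * (4 * (\<bar>u\<bar> / q))"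
        using c by (intro mult_left_mono) auto
      then show ?thesis by (simp add: algebra_simps)
    qed
    finally have "measure (conv_power \<nu> k) {y<..} \<le> exp (- (\<gamma> * m * q ^ 16) + (- (c * q ^ 14) + real k * - (c / q\<^sup>2)))"
      by simp
    then show "measure (conv_power \<nu> k) {m * q ^ 16 + z * q ^ 8 - (q ^ 8 + real k / q ^ 4)<..}
      \<le> exp (- (\<gamma> * m * q ^ 16)) * (exp (- (c * q ^ 14)) * exp (- (c / q\<^sup>2)) ^ k)"
      unfolding y_def by (simp only: exp_add exp_of_nat_mult)
  qed
qed

lemma power8_dominated_by_power16:
  fixes a b :: real
  assumes "0 < b"
  shows "eventually (\<lambda>q. a * q ^ 8 \<le> b * q ^ 16) at_top"
  using assms by real_asymp

text \<open>An exponent \<open>\<theta> > \<gamma>\<close> at which the moment generating function is below 1 makes the probabilities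
summable in \<open>k\<close> and smaller than \<open>exp (-\<gamma> m q^16)\<close> by a factor \<open>exp (-c q^16)\<close>. The conclusion
has the weaker form that also holds for the class with the smallest decay rate, so that all classes can be treated
together.\<close>
lemma conv_power_tail_light_class:
  fixes m \<gamma> :: real
  assumes \<nu>: "real_distribution \<nu>" and int: "integrable \<nu> (\<lambda>x. exp (\<theta> * x))"
    and less: "mgf \<nu> \<theta> < 1" and "0 < \<gamma>" "\<gamma> < \<theta>" and nz: "0 < m"
  obtains c where "0 < c" "eventually (\<lambda>q::real. \<forall>k. 
    measure (conv_power \<nu> k) {m * q ^ 16 + z * q ^ 8 - (q ^ 8 + real k / q ^ 4)<..}
      \<le> exp (- (\<gamma> * m * q ^ 16)) * (exp (- (c * q ^ 14)) * exp (- (c / q\<^sup>2)) ^ k)) at_top"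
proof -
  have mgf0: "0 \<le> mgf \<nu> \<theta>" by (auto simp: mgf_def integral_nonneg_AE)
  define r where "r = (1 + mgf \<nu> \<theta>) / 2"
  have r: "mgf \<nu> \<theta> < r" "r < 1" "0 < r" using mgf0 less by (auto simp: r_def)
  define c where "c = min ((\<theta> - \<gamma>) * m / 2) (- ln r)"
  have c: "0 < c" using r assms by (simp add: c_def)
  have ev: "eventually (\<lambda>q. 1 \<le> q \<and> mgf \<nu> \<theta> * exp (\<theta> / q ^ 4) \<le> r \<and> 
      \<theta> * (1 - z) * q ^ 8 \<le> (\<theta> - \<gamma>) * m / 2 * q ^ 16) at_top"
  proof (intro eventually_conj)
    have "((\<lambda>q. mgf \<nu> \<theta> * exp (\<theta> / q ^ 4)) \<longlongrightarrow> mgf \<nu> \<theta>) at_top"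
      by real_asymp
    then have "eventually (\<lambda>q. mgf \<nu> \<theta> * exp (\<theta> / q ^ 4) < r) at_top"
      using r by (intro order_tendstoD)
    then show "eventually (\<lambda>q. mgf \<nu> \<theta> * exp (\<theta> / q ^ 4) \<le> r) at_top"
      by eventually_elim simp
    have "0 < (\<theta> - \<gamma>) * m / 2" using assms by simp
    then show "eventually (\<lambda>q. \<theta> * (1 - z) * q ^ 8 \<le> (\<theta> - \<gamma>) * m / 2 * q ^ 16) at_top"
      by (rule power8_dominated_by_power16)
  qed (rule eventually_ge_at_top)
  show ?thesis
  proof (rule that[OF c], use ev in eventually_elim, intro allI)
    fix q :: real and k :: nat
    assume q: "1 \<le> q \<and> mgf \<nu> \<theta> * exp (\<theta> / q ^ 4) \<le> r \<and> \<theta> * (1 - z) * q ^ 8 \<le> (\<theta> - \<gamma>) * m / 2 * q ^ 16"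
    let ?y = "m * q ^ 16 + z * q ^ 8 - (q ^ 8 + real k / q ^ 4)"
    have "measure (conv_power \<nu> k) {?y<..} \<le> exp (- \<theta> * ?y) * mgf \<nu> \<theta> ^ k"
      unfolding mgf_def using assms by (intro chernoff_bound_conv_power) auto
    also have "- \<theta> * ?y = - (\<gamma> * m * q ^ 16) + (- ((\<theta> - \<gamma>) * m * q ^ 16) + \<theta> * (1 - z) * q ^ 8) + real k * (\<theta> / q ^ 4)"
      by (simp add: algebra_simps)
    also have "exp (\<dots>) * mgf \<nu> \<theta> ^ k = exp (- (\<gamma> * m * q ^ 16)) *
        (exp (- ((\<theta> - \<gamma>) * m * q ^ 16) + \<theta> * (1 - z) * q ^ 8) * (mgf \<nu> \<theta> * exp (\<theta> / q ^ 4)) ^ k)"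
      by (simp only: exp_add exp_of_nat_mult power_mult_distrib mult_ac)
    also have "\<dots> \<le> exp (- (\<gamma> * m * q ^ 16)) * (exp (- (c * q ^ 14)) * exp (- (c / q\<^sup>2)) ^ k)"
    proof (intro mult_left_mono mult_mono power_mono)
      have "c * q ^ 14 \<le> (\<theta> - \<gamma>) * m / 2 * q ^ 16"
        using q assms by (intro mult_mono power_increasing) (auto simp: c_def)
      also have "\<dots> \<le> (\<theta> - \<gamma>) * m * q ^ 16 - \<theta> * (1 - z) * q ^ 8"
      proof -
        have "(\<theta> - \<gamma>) * m / 2 * q ^ 16 = (\<theta> - \<gamma>) * m * q ^ 16 / 2" by simp
        with q show ?thesis by linarith
      qed
      finally show "exp (- ((\<theta> - \<gamma>) * m * q ^ 16) + \<theta> * (1 - z) * q ^ 8) \<le> exp (- (c * q ^ 14))"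
        by simp
      have "c / q\<^sup>2 \<le> c / 1" using q c by (intro divide_left_mono) auto
      also have "\<dots> \<le> - ln r" by (simp add: c_def)
      finally have "exp (ln r) \<le> exp (- (c / q\<^sup>2))" by (simp only: exp_le_cancel_iff)
      with r have "r \<le> exp (- (c / q\<^sup>2))" by simp
      with q show "mgf \<nu> \<theta> * exp (\<theta> / q ^ 4) \<le> exp (- (c / q\<^sup>2))" by linarith
    qed (use mgf0 in auto)
    finally show "measure (conv_power \<nu> k) {?y<..} \<le> \<dots>" .
  qed
qed

section \<open>A fork-join queue with finitely many servers\<close>

lemma (in prob_space) distr_block_sum:
  assumes X: "indep_vars (\<lambda>_. borel) X J" and J': "J' \<subseteq> J" "finite J'"
    and law: "\<And>j. j \<in> J' \<Longrightarrow> distr M borel (X j) = \<kappa>" and g: "g \<in> borel_measurable borel"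
  shows "distr M borel (\<lambda>\<omega>. \<Sum>j\<in>J'. g (X j \<omega>)) = conv_power (distr \<kappa> borel g) (card J')"
proof (rule distr_sum_eq_conv_power[OF J'(2)])
  show "indep_vars (\<lambda>_. borel) (\<lambda>j \<omega>. g (X j \<omega>)) J'"
    by (rule indep_vars_compose2[OF indep_vars_subset[OF X J'(1)] g])
  fix j assume j: "j \<in> J'"
  then have "X j \<in> borel_measurable M"
    using X J' by (auto simp: indep_vars_def)
  then have "distr M borel (\<lambda>\<omega>. g (X j \<omega>)) = distr (distr M borel (X j)) borel g"
    using g by (simp add: distr_distr o_def)
  then show "distr M borel (\<lambda>\<omega>. g (X j \<omega>)) = distr \<kappa> borel g"
    by (simp only: law[OF j])
qed

lemma (in prob_space) indep_vars_block_sums: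
  fixes g :: "real \<Rightarrow> real"
  assumes X: "indep_vars (\<lambda>_. borel) X J" and B: "\<And>i. i \<in> L \<Longrightarrow> B i \<subseteq> J" "disjoint_family_on B L"
    and g: "g \<in> borel_measurable borel"
  shows "indep_vars (\<lambda>_. borel) (\<lambda>i \<omega>. \<Sum>j\<in>B i. g (X j \<omega>)) L"
proof -
  have "indep_vars (\<lambda>_. borel) (\<lambda>i \<omega>. (\<lambda>f. \<Sum>j\<in>B i. g (f j)) (restrict (\<lambda>j. X j \<omega>) (B i))) L"
  proof (rule indep_vars_compose2[OF indep_vars_restrict[OF X B]])
    fix i assume "i \<in> L"
    show "(\<lambda>f. \<Sum>j\<in>B i. g (f j)) \<in> borel_measurable (Pi\<^sub>M (B i) (\<lambda>_. borel))"
      by (intro borel_measurable_sum measurable_compose[OF _ g] measurable_component_singleton)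
  qed
  also have "(\<lambda>i \<omega>. (\<lambda>f. \<Sum>j\<in>B i. g (f j)) (restrict (\<lambda>j. X j \<omega>) (B i))) = (\<lambda>i \<omega>. \<Sum>j\<in>B i. g (X j \<omega>))"
    by simp
  finally show ?thesis .
qed

text \<open>If \<open>s i k + \<tau> k\<close> exceeds \<open>x + z\<close> at a time in the window, then \<open>s i k\<close> exceeds \<open>x + e\<close>, or
\<open>\<tau>\<close> has grown by more than \<open>e\<close> since \<open>k0\<close>, or \<open>\<tau> k0\<close> is above \<open>z - 2 e\<close>. At a time outside
the window, either \<open>\<tau>\<close> crosses the barrier \<open>b\<close> or \<open>s i k\<close> alone exceeds \<open>x + z - b k\<close>. Only the
event for \<open>\<tau> k0\<close> keeps a probability of order one in the limit.\<close>
lemma (in prob_space) perturbed_maximum_union_bound: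
  fixes s :: "'i \<Rightarrow> nat \<Rightarrow> 'a \<Rightarrow> real" and \<tau> :: "nat \<Rightarrow> 'a \<Rightarrow> real" and e x z :: real
  assumes I: "finite I" and win: "win \<subseteq> {k0..n}" and k0: "k0 \<le> n"
    and s: "\<And>i k. i \<in> I \<Longrightarrow> k \<le> n \<Longrightarrow> s i k \<in> borel_measurable M"
    and \<tau>: "\<And>k. k \<le> n \<Longrightarrow> \<tau> k \<in> borel_measurable M"
    and s_law: "\<And>i k. i \<in> I \<Longrightarrow> k \<le> n \<Longrightarrow> distr M borel (s i k) = conv_power (\<nu> i) k"
    and \<tau>_law: "\<And>k. k \<le> n \<Longrightarrow> distr M borel (\<tau> k) = conv_power \<rho> k"
    and inc_law: "\<And>k. k0 \<le> k \<Longrightarrow> k \<le> n \<Longrightarrow> distr M borel (\<lambda>\<omega>. \<tau> k \<omega> - \<tau> k0 \<omega>) = conv_power \<rho> (k - k0)"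
  shows "prob {\<omega>\<in>space M. \<exists>i\<in>I. \<exists>k\<le>n. x + z < s i k \<omega> + \<tau> k \<omega>} \<le>
    measure (conv_power \<rho> k0) {z - 2 * e<..} + (\<Sum>k\<in>win. measure (conv_power \<rho> (k - k0)) {e<..})
     + (\<Sum>k\<le>n. measure (conv_power \<rho> k) {b k<..})
     + (\<Sum>i\<in>I. (\<Sum>k\<in>win. measure (conv_power (\<nu> i) k) {x + e<..})
            + (\<Sum>k\<in>{..n} - win. measure (conv_power (\<nu> i) k) {x + z - b k<..}))"
proof -
  have win': "finite win" "\<And>k. k \<in> win \<Longrightarrow> k0 \<le> k \<and> k \<le> n"
    using win finite_subset by auto
  have inc: "(\<lambda>\<omega>. \<tau> k \<omega> - \<tau> k0 \<omega>) \<in> borel_measurable M" if "k \<le> n" for k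
    using \<tau>[OF that] \<tau>[OF k0] by simp
  have tail: "{\<omega>\<in>space M. c < X \<omega>} \<in> events \<and> prob {\<omega>\<in>space M. c < X \<omega>} = measure \<mu> {c<..}"
    if "X \<in> borel_measurable M" "distr M borel X = \<mu>" for X :: "'a \<Rightarrow> real" and c \<mu>
  proof -
    have eq: "X -` {c<..} \<inter> space M = {\<omega>\<in>space M. c < X \<omega>}" by auto
    show ?thesis
      using measurable_sets[OF that(1), of "{c<..}"] measure_distr[OF that(1), of "{c<..}"]
      unfolding that(2) eq by simp
  qed
  have union: "(\<Union>k\<in>K. E k) \<in> events \<and> prob (\<Union>k\<in>K. E k) \<le> sum t K"
    if "finite K" "\<And>k. k \<in> K \<Longrightarrow> E k \<in> events" "\<And>k. k \<in> K \<Longrightarrow> prob (E k) = t k"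
    for K :: "nat set" and E t
  proof
    show "(\<Union>k\<in>K. E k) \<in> events" using that by auto
    have "prob (\<Union>k\<in>K. E k) \<le> (\<Sum>k\<in>K. prob (E k))"
      using that by (intro measure_UNION_le) auto
    then show "prob (\<Union>k\<in>K. E k) \<le> sum t K" using that(3) by simp
  qed
  define E0 where "E0 = {\<omega>\<in>space M. z - 2 * e < \<tau> k0 \<omega>}"
  define E1 where "E1 k = {\<omega>\<in>space M. e < \<tau> k \<omega> - \<tau> k0 \<omega>}" for k
  define E2 where "E2 k = {\<omega>\<in>space M. b k < \<tau> k \<omega>}" for k
  define E3 where "E3 i k = {\<omega>\<in>space M. x + e < s i k \<omega>}" for i k
  define E4 where "E4 i k = {\<omega>\<in>space M. x + z - b k < s i k \<omega>}" for i k
  have E0: "E0 \<in> events" "prob E0 = measure (conv_power \<rho> k0) {z - 2 * e<..}"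
    unfolding E0_def using tail[OF \<tau>[OF k0] \<tau>_law[OF k0]] by simp_all
  have E1: "E1 k \<in> events" "prob (E1 k) = measure (conv_power \<rho> (k - k0)) {e<..}" if "k \<in> win" for k
    unfolding E1_def using tail[OF inc inc_law, of k] win'(2)[OF that] by simp_all
  have E2: "E2 k \<in> events" "prob (E2 k) = measure (conv_power \<rho> k) {b k<..}" if "k \<le> n" for k
    unfolding E2_def using tail[OF \<tau> \<tau>_law, of k] that by simp_all
  have E3: "E3 i k \<in> events" "prob (E3 i k) = measure (conv_power (\<nu> i) k) {x + e<..}" if "i \<in> I" "k \<le> n" for i k
    unfolding E3_def using tail[OF s s_law, of i k] that by simp_all
  have E4: "E4 i k \<in> events" "prob (E4 i k) = measure (conv_power (\<nu> i) k) {x + z - b k<..}" if "i \<in> I" "k \<le> n" for i k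
    unfolding E4_def using tail[OF s s_law, of i k] that by simp_all
  define U1 where "U1 = (\<Union>k\<in>win. E1 k)"
  define U2 where "U2 = (\<Union>k\<in>{..n}. E2 k)"
  define U3 where "U3 i = (\<Union>k\<in>win. E3 i k)" for i
  define U4 where "U4 i = (\<Union>k\<in>{..n} - win. E4 i k)" for i
  have "U1 \<in> events \<and> prob U1 \<le> (\<Sum>k\<in>win. measure (conv_power \<rho> (k - k0)) {e<..})"
    unfolding U1_def by (rule union[OF win'(1)]) (simp_all add: E1)
  note U1 = conjunct1[OF this] conjunct2[OF this]
  have "U2 \<in> events \<and> prob U2 \<le> (\<Sum>k\<le>n. measure (conv_power \<rho> k) {b k<..})"
    unfolding U2_def by (rule union[OF finite_atMost]) (simp_all add: E2)
  note U2 = conjunct1[OF this] conjunct2[OF this]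
  have "U3 i \<in> events \<and> prob (U3 i) \<le> (\<Sum>k\<in>win. measure (conv_power (\<nu> i) k) {x + e<..})" if "i \<in> I" for i
    unfolding U3_def by (rule union[OF win'(1)]) (simp_all add: E3[OF that] win'(2))
  note U3 = conjunct1[OF this] conjunct2[OF this]
  have "U4 i \<in> events \<and> prob (U4 i) \<le> (\<Sum>k\<in>{..n} - win. measure (conv_power (\<nu> i) k) {x + z - b k<..})" if "i \<in> I" for i
    unfolding U4_def by (rule union[OF finite_Diff[OF finite_atMost]]) (simp_all add: E4[OF that])
  note U4 = conjunct1[OF this] conjunct2[OF this]
  have U34: "prob (U3 i \<union> U4 i) \<le> (\<Sum>k\<in>win. measure (conv_power (\<nu> i) k) {x + e<..})
            + (\<Sum>k\<in>{..n} - win. measure (conv_power (\<nu> i) k) {x + z - b k<..})" if "i \<in> I" for i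
    using measure_Un_le[OF U3(1)[OF that] U4(1)[OF that]] U3(2)[OF that] U4(2)[OF that] by linarith
  have sets: "(\<Union>i\<in>I. U3 i \<union> U4 i) \<in> events" "E0 \<union> U1 \<in> events" "E0 \<union> U1 \<union> U2 \<in> events"
    using I U1(1) U2(1) E0(1) by (auto intro!: U3(1) U4(1))
  have cover: "\<omega> \<in> E0 \<union> U1 \<union> U2 \<union> (\<Union>i\<in>I. U3 i \<union> U4 i)"
    if \<omega>: "\<omega> \<in> space M" and i: "i \<in> I" and k: "k \<le> n" and gt: "x + z < s i k \<omega> + \<tau> k \<omega>" for \<omega> i k
  proof (rule ccontr)
    assume "\<omega> \<notin> E0 \<union> U1 \<union> U2 \<union> (\<Union>i\<in>I. U3 i \<union> U4 i)"
    then have no: "\<omega> \<notin> E0" "\<omega> \<notin> U1" "\<omega> \<notin> U2" "\<omega> \<notin> U3 i" "\<omega> \<notin> U4 i"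
      using i by blast+
    show False
    proof (cases "k \<in> win")
      case True
      then have "\<omega> \<notin> E1 k" "\<omega> \<notin> E3 i k"
        using no by (auto simp: U1_def U3_def)
      with gt \<omega> no(1) show ?thesis by (simp add: E0_def E1_def E3_def)
    next
      case False
      then have "\<omega> \<notin> E2 k" "\<omega> \<notin> E4 i k"
        using no k by (auto simp: U2_def U4_def)
      with gt \<omega> show ?thesis by (simp add: E2_def E4_def)
    qed
  qed
  have "prob {\<omega>\<in>space M. \<exists>i\<in>I. \<exists>k\<le>n. x + z < s i k \<omega> + \<tau> k \<omega>} \<le> prob (E0 \<union> U1 \<union> U2 \<union> (\<Union>i\<in>I. U3 i \<union> U4 i))"
    by (rule finite_measure_mono[OF _ sets.Un[OF sets(3) sets(1)]]) (use cover in blast)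
  moreover have "prob (\<Union>i\<in>I. U3 i \<union> U4 i) \<le> (\<Sum>i\<in>I. prob (U3 i \<union> U4 i))"
    using I by (intro measure_UNION_le sets.Un U3(1) U4(1))
  moreover have "(\<Sum>i\<in>I. prob (U3 i \<union> U4 i)) \<le> (\<Sum>i\<in>I. (\<Sum>k\<in>win. measure (conv_power (\<nu> i) k) {x + e<..})
            + (\<Sum>k\<in>{..n} - win. measure (conv_power (\<nu> i) k) {x + z - b k<..}))"
    by (intro sum_mono U34)
  ultimately show ?thesis
    using measure_Un_le[OF sets(3) sets(1)] measure_Un_le[OF sets(2) U2(1)] measure_Un_le[OF E0(1) U1(1)]
      E0(2) U1(2) U2(2) by linarith
qed

text \<open>The law \<open>\<kappa> i\<close> of the service times may depend on the server; \<open>\<alpha>\<close> is the law of the interarrival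
times. The constant \<open>a\<close> centres both sums and will be the mean interarrival time.\<close>
locale fork_join = prob_space +
  fixes N :: nat and S :: "nat \<Rightarrow> nat \<Rightarrow> 'a \<Rightarrow> real" and A :: "nat \<Rightarrow> 'a \<Rightarrow> real"
    and \<kappa> :: "nat \<Rightarrow> real measure" and \<alpha> :: "real measure" and a :: real
  assumes indep: "indep_vars (\<lambda>_. borel) (case_sum (\<lambda>(i, j). S i j) A) (({1..N} \<times> {1..}) <+> {1..})"
    and S_law: "\<And>i j. i \<in> {1..N} \<Longrightarrow> 1 \<le> j \<Longrightarrow> distr M borel (S i j) = \<kappa> i"
    and A_law: "\<And>j. 1 \<le> j \<Longrightarrow> distr M borel (A j) = \<alpha>"
begin

abbreviation "X \<equiv> case_sum (\<lambda>(i, j). S i j) A"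

text \<open>The sums over the last \<open>k\<close> tasks before task \<open>n + 1\<close>. The interarrival times are shifted by one
against the service times, as in the recursion.\<close>
definition service_sum :: "nat \<Rightarrow> nat \<Rightarrow> nat \<Rightarrow> 'a \<Rightarrow> real" where
  "service_sum n i k \<omega> = (\<Sum>j\<in>{n - k<..n}. S i j \<omega> - a)"

definition arrival_sum :: "nat \<Rightarrow> nat \<Rightarrow> 'a \<Rightarrow> real" where
  "arrival_sum n k \<omega> = (\<Sum>j\<in>{Suc n - k<..Suc n}. a - A j \<omega>)"

lemma S_measurable: "i \<in> {1..N} \<Longrightarrow> 1 \<le> j \<Longrightarrow> S i j \<in> borel_measurable M"
  using indep unfolding indep_vars_def by (auto dest!: bspec[of _ _ "Inl (i, j)"])

lemma A_measurable: "1 \<le> j \<Longrightarrow> A j \<in> borel_measurable M"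
  using indep unfolding indep_vars_def by (auto dest!: bspec[of _ _ "Inr j"])

lemma service_sum_measurable: "i \<in> {1..N} \<Longrightarrow> service_sum n i k \<in> borel_measurable M"
  unfolding service_sum_def by (intro borel_measurable_sum borel_measurable_diff S_measurable) auto

lemma arrival_sum_measurable: "arrival_sum n k \<in> borel_measurable M"
  unfolding arrival_sum_def by (intro borel_measurable_sum borel_measurable_diff A_measurable) auto

lemma reversed_sum:
  fixes k n :: nat
  assumes "k \<le> n"
  shows "(\<Sum>l<k. f (n - l)) = (\<Sum>j\<in>{n - k<..n}. f j)"
  by (rule sum.reindex_bij_witness[of _ "\<lambda>j. n - j" "\<lambda>l. n - l"]) (use assms in auto)

lemma less_waiting_time_iff_sums:
  "y < waiting_time (\<lambda>j. S i j \<omega>) (\<lambda>j. A j \<omega>) (Suc n) \<longleftrightarrow> (\<exists>k\<le>n. y < service_sum n i k \<omega> + arrival_sum n k \<omega>)"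
proof -
  have "(\<Sum>l<k. S i (n - l) \<omega> - A (Suc n - l) \<omega>) = service_sum n i k \<omega> + arrival_sum n k \<omega>" if "k \<le> n" for k
  proof -
    have "(\<Sum>l<k. S i (n - l) \<omega> - A (Suc n - l) \<omega>) = (\<Sum>l<k. S i (n - l) \<omega> - a) + (\<Sum>l<k. a - A (Suc n - l) \<omega>)"
      unfolding sum.distrib[symmetric] by simp
    then show ?thesis
      using that reversed_sum[of k n "\<lambda>j. S i j \<omega> - a"] reversed_sum[of k "Suc n" "\<lambda>j. a - A j \<omega>"]
      by (simp add: service_sum_def arrival_sum_def)
  qed
  then show ?thesis by (auto simp: less_waiting_time_iff)
qed

lemma service_sum_law:
  assumes "i \<in> {1..N}" "k \<le> n"
  shows "distr M borel (service_sum n i k) = conv_power (distr (\<kappa> i) borel (\<lambda>x. x - a)) k"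
proof -
  let ?B = "(\<lambda>j. Inl (i, j)) ` {n - k<..n} :: (nat \<times> nat + nat) set"
  have inj: "inj_on (\<lambda>j. Inl (i, j) :: nat \<times> nat + nat) {n - k<..n}" by (auto simp: inj_on_def)
  have "distr M borel (\<lambda>\<omega>. \<Sum>j\<in>?B. X j \<omega> - a) = conv_power (distr (\<kappa> i) borel (\<lambda>x. x - a)) (card ?B)"
    by (rule distr_block_sum[OF indep]) (use assms S_law in auto)
  also have "(\<lambda>\<omega>. \<Sum>j\<in>?B. X j \<omega> - a) = service_sum n i k"
    by (simp add: service_sum_def fun_eq_iff sum.reindex[OF inj])
  also have "card ?B = k"
    using assms by (simp add: card_image[OF inj])
  finally show ?thesis .
qed

lemma arrival_block_law:
  assumes "B \<subseteq> {1..}" "finite B"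
  shows "distr M borel (\<lambda>\<omega>. \<Sum>j\<in>B. a - A j \<omega>) = conv_power (distr \<alpha> borel (\<lambda>x. a - x)) (card B)"
proof -
  let ?B = "Inr ` B :: (nat \<times> nat + nat) set"
  have inj: "inj_on (\<lambda>j. Inr j :: nat \<times> nat + nat) B" by (auto simp: inj_on_def)
  have "distr M borel (\<lambda>\<omega>. \<Sum>j\<in>?B. a - X j \<omega>) = conv_power (distr \<alpha> borel (\<lambda>x. a - x)) (card ?B)"
    by (rule distr_block_sum[OF indep]) (use assms A_law in auto)
  also have "(\<lambda>\<omega>. \<Sum>j\<in>?B. a - X j \<omega>) = (\<lambda>\<omega>. \<Sum>j\<in>B. a - A j \<omega>)"
    by (simp add: fun_eq_iff sum.reindex[OF inj])
  also have "card ?B = card B"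
    by (simp add: card_image[OF inj])
  finally show ?thesis .
qed

lemma arrival_sum_law:
  "k \<le> n \<Longrightarrow> distr M borel (arrival_sum n k) = conv_power (distr \<alpha> borel (\<lambda>x. a - x)) k"
  using arrival_block_law[of "{Suc n - k<..Suc n}"] by (simp add: arrival_sum_def[abs_def] subset_iff)

lemma arrival_increment_law:
  assumes "k0 \<le> k" "k \<le> n"
  shows "distr M borel (\<lambda>\<omega>. arrival_sum n k \<omega> - arrival_sum n k0 \<omega>) = conv_power (distr \<alpha> borel (\<lambda>x. a - x)) (k - k0)"
proof -
  have "{Suc n - k<..Suc n} = {Suc n - k<..Suc n - k0} \<union> {Suc n - k0<..Suc n}"
    using assms by auto
  then have "arrival_sum n k \<omega> = (\<Sum>j\<in>{Suc n - k<..Suc n - k0}. a - A j \<omega>) + arrival_sum n k0 \<omega>" for \<omega>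
    unfolding arrival_sum_def by (simp only:) (rule sum.union_disjoint, auto)
  then have "(\<lambda>\<omega>. arrival_sum n k \<omega> - arrival_sum n k0 \<omega>) = (\<lambda>\<omega>. \<Sum>j\<in>{Suc n - k<..Suc n - k0}. a - A j \<omega>)"
    by simp
  then show ?thesis
    using arrival_block_law[of "{Suc n - k<..Suc n - k0}"] assms by (simp add: subset_iff)
qed

text \<open>The right-hand side involves \<open>n\<close> only through the ranges of summation, so it will be bounded
uniformly in \<open>n\<close>.\<close>
lemma prob_some_waiting_time_large_le:
  assumes win: "win \<subseteq> {k0..n}" and k0: "k0 \<le> n"
  defines "\<rho> \<equiv> distr \<alpha> borel (\<lambda>x. a - x)" and "\<nu> i \<equiv> distr (\<kappa> i) borel (\<lambda>x. x - a)"
  shows "prob {\<omega>\<in>space M. \<exists>i\<in>{1..N}. x + z < waiting_time (\<lambda>j. S i j \<omega>) (\<lambda>j. A j \<omega>) (Suc n)} \<le>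
    measure (conv_power \<rho> k0) {z - 2 * e<..} + (\<Sum>k\<in>win. measure (conv_power \<rho> (k - k0)) {e<..})
     + (\<Sum>k\<le>n. measure (conv_power \<rho> k) {b k<..})
     + (\<Sum>i\<in>{1..N}. (\<Sum>k\<in>win. measure (conv_power (\<nu> i) k) {x + e<..})
            + (\<Sum>k\<in>{..n} - win. measure (conv_power (\<nu> i) k) {x + z - b k<..}))"
  unfolding less_waiting_time_iff_sums \<rho>_def \<nu>_def
  by (rule perturbed_maximum_union_bound[OF _ win k0])
     (auto intro: service_sum_measurable arrival_sum_measurable service_sum_law arrival_sum_law arrival_increment_law)

text \<open>Looking at the single time \<open>k\<close> is enough here. If the shared sum exceeds \<open>z + e\<close>, every server in
\<open>L\<close> must have a service sum of at most \<open>x - e\<close>, and these sums are independent.\<close>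
lemma prob_all_waiting_times_small_le:
  assumes L: "L \<subseteq> {1..N}" "L \<noteq> {}" and law: "\<And>i. i \<in> L \<Longrightarrow> \<kappa> i = \<kappa>'" and k: "k \<le> n"
  shows "prob {\<omega>\<in>space M. \<forall>i\<in>{1..N}. waiting_time (\<lambda>j. S i j \<omega>) (\<lambda>j. A j \<omega>) (Suc n) \<le> x + z} \<le>
    measure (conv_power (distr \<alpha> borel (\<lambda>x. a - x)) k) {..z + e}
     + (measure (conv_power (distr \<kappa>' borel (\<lambda>x. x - a)) k) {..x - e}) ^ card L"
proof -
  have finL: "finite L" using L(1) finite_subset by blast
  let ?E = "{\<omega>\<in>space M. arrival_sum n k \<omega> \<le> z + e}"
  let ?B = "\<lambda>i. (\<lambda>j. Inl (i, j)) ` {n - k<..n} :: (nat \<times> nat + nat) set"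
  let ?F = "\<Inter>i\<in>L. service_sum n i k -` {..x - e} \<inter> space M"
  have inj: "inj_on (\<lambda>j. Inl (i, j) :: nat \<times> nat + nat) {n - k<..n}" for i :: nat by (auto simp: inj_on_def)
  have "indep_vars (\<lambda>_. borel) (\<lambda>i \<omega>. \<Sum>j\<in>?B i. X j \<omega> - a) L"
    by (rule indep_vars_block_sums[OF indep]) (use L in \<open>auto simp: disjoint_family_on_def\<close>)
  moreover have "(\<lambda>i \<omega>. \<Sum>j\<in>?B i. X j \<omega> - a) = (\<lambda>i. service_sum n i k)"
    by (simp add: fun_eq_iff service_sum_def sum.reindex[OF inj])
  ultimately have ind: "indep_vars (\<lambda>_. borel) (\<lambda>i. service_sum n i k) L"
    by (simp only:)
  have E_eq: "arrival_sum n k -` {..z + e} \<inter> space M = ?E" by auto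
  have E_event: "?E \<in> events"
    using measurable_sets[OF arrival_sum_measurable, of "{..z + e}" n k] by (simp add: E_eq)
  have F_event: "?F \<in> events"
  proof (rule sets.finite_INT[OF finL L(2)])
    fix i assume "i \<in> L"
    with L have "i \<in> {1..N}" by blast
    then show "service_sum n i k -` {..x - e} \<inter> space M \<in> events"
      by (intro measurable_sets[OF service_sum_measurable]) auto
  qed
  have F: "prob ?F = (measure (conv_power (distr \<kappa>' borel (\<lambda>x. x - a)) k) {..x - e}) ^ card L"
  proof -
    have "prob ?F = (\<Prod>i\<in>L. prob (service_sum n i k -` {..x - e} \<inter> space M))"
      by (rule indep_varsD[OF ind L(2) finL]) auto
    also have "\<dots> = (\<Prod>i\<in>L. measure (conv_power (distr \<kappa>' borel (\<lambda>x. x - a)) k) {..x - e})"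
    proof (rule prod.cong[OF refl])
      fix i assume i: "i \<in> L"
      then have "i \<in> {1..N}" using L by blast
      then show "prob (service_sum n i k -` {..x - e} \<inter> space M) = measure (conv_power (distr \<kappa>' borel (\<lambda>x. x - a)) k) {..x - e}"
        using service_sum_law[OF _ k] law[OF i] measure_distr[OF service_sum_measurable, of i "{..x - e}" n k] by simp
    qed
    finally show ?thesis by simp
  qed
  have "prob {\<omega>\<in>space M. \<forall>i\<in>{1..N}. waiting_time (\<lambda>j. S i j \<omega>) (\<lambda>j. A j \<omega>) (Suc n) \<le> x + z} \<le> prob (?E \<union> ?F)"
  proof (rule finite_measure_mono)
    show "?E \<union> ?F \<in> events"
      by (rule sets.Un[OF E_event F_event])
    show "{\<omega>\<in>space M. \<forall>i\<in>{1..N}. waiting_time (\<lambda>j. S i j \<omega>) (\<lambda>j. A j \<omega>) (Suc n) \<le> x + z} \<subseteq> ?E \<union> ?F"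
    proof (rule subsetI)
      fix \<omega> assume "\<omega> \<in> {\<omega>\<in>space M. \<forall>i\<in>{1..N}. waiting_time (\<lambda>j. S i j \<omega>) (\<lambda>j. A j \<omega>) (Suc n) \<le> x + z}"
      then have \<omega>: "\<omega> \<in> space M"
        and le: "\<And>i. i \<in> {1..N} \<Longrightarrow> waiting_time (\<lambda>j. S i j \<omega>) (\<lambda>j. A j \<omega>) (Suc n) \<le> x + z"
        by blast+
      show "\<omega> \<in> ?E \<union> ?F"
      proof (cases "arrival_sum n k \<omega> \<le> z + e")
        case True
        with \<omega> show ?thesis by simp
      next
        case False
        have "service_sum n i k \<omega> \<le> x - e" if "i \<in> L" for i
        proof -
          have "i \<in> {1..N}" using that L by blast
          from le[OF this] have "service_sum n i k \<omega> + arrival_sum n k \<omega> \<le> x + z"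
            using less_waiting_time_iff_sums[of "x + z" i \<omega> n] k by (meson not_less)
          with False show ?thesis by linarith
        qed
        with \<omega> show ?thesis by auto
      qed
    qed
  qed
  also have "\<dots> \<le> prob ?E + prob ?F"
    by (rule measure_Un_le[OF E_event F_event])
  also have "prob ?E = measure (conv_power (distr \<alpha> borel (\<lambda>x. a - x)) k) {..z + e}"
    using arrival_sum_law[OF k] measure_distr[OF arrival_sum_measurable, of "{..z + e}" n k] by (simp add: E_eq)
  finally show ?thesis unfolding F .
qed

end

section \<open>Vanishing of the error terms\<close>

text \<open>The four summands bound, in this order, the growth of the shared walk inside the window, its crossing
of the linear barrier, the service sums inside the window and those outside it. The number of servers
has cancelled against \<open>exp (-\<gamma> m q^16)\<close>.\<close>
definition upper_error :: "real \<Rightarrow> real \<Rightarrow> real \<Rightarrow> real \<Rightarrow> real \<Rightarrow> real" where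
  "upper_error v e \<gamma> c q =
     (2 * q ^ 15 + 1) * exp (- (e\<^sup>2 / (4 * v) * q)) + exp (- (q ^ 4 / v)) / (1 - exp (- (1 / (2 * v * q ^ 8))))
     + ((2 * q ^ 15 + 1) * exp (- (\<gamma> * e * q ^ 8)) + exp (- (c * q ^ 14)) / (1 - exp (- (c / q\<^sup>2))))"

lemma upper_error_tendsto_0:
  assumes "0 < v" "0 < e" "0 < \<gamma>" "0 < c"
  shows "(upper_error v e \<gamma> c \<longlongrightarrow> 0) at_top"
proof -
  have 1: "((\<lambda>q. (2 * q ^ 15 + 1) * exp (- (d * q))) \<longlongrightarrow> 0) at_top" if "0 < d" for d :: real
    using that by real_asymp
  have 2: "((\<lambda>q. exp (- (q ^ 4 / v)) / (1 - exp (- (1 / (2 * v * q ^ 8))))) \<longlongrightarrow> 0) at_top"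
    using assms by real_asymp
  have 3: "((\<lambda>q. (2 * q ^ 15 + 1) * exp (- (d * q ^ 8))) \<longlongrightarrow> 0) at_top" if "0 < d" for d :: real
    using that by real_asymp
  have 4: "((\<lambda>q. exp (- (c * q ^ 14)) / (1 - exp (- (c / q\<^sup>2)))) \<longlongrightarrow> 0) at_top"
    using assms by real_asymp
  have "((\<lambda>q. (2 * q ^ 15 + 1) * exp (- (e\<^sup>2 / (4 * v) * q)) + exp (- (q ^ 4 / v)) / (1 - exp (- (1 / (2 * v * q ^ 8))))
     + ((2 * q ^ 15 + 1) * exp (- (\<gamma> * e * q ^ 8)) + exp (- (c * q ^ 14)) / (1 - exp (- (c / q\<^sup>2)))))
     \<longlongrightarrow> 0 + 0 + (0 + 0)) at_top"
    using assms by (intro tendsto_add 1 2 3 4) auto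
  then show ?thesis by (simp add: upper_error_def[abs_def])
qed

text \<open>The left end of the window is the reference time for the shared walk: later values differ from it by
sums of fresh steps, for which upper tail bounds are available.\<close>
definition window_start :: "real \<Rightarrow> nat" where
  "window_start q = nat \<lceil>q ^ 16 - q ^ 15\<rceil>"

definition window :: "real \<Rightarrow> nat \<Rightarrow> nat set" where
  "window q n = {k \<in> {window_start q..n}. real k \<le> q ^ 16 + q ^ 15}"

lemma window_start_bounds:
  assumes "1 \<le> q"
  shows "q ^ 16 - q ^ 15 \<le> real (window_start q)" "real (window_start q) \<le> q ^ 16 - q ^ 15 + 1"
proof -
  have "0 \<le> q ^ 16 - q ^ 15"
    using assms power_increasing[of 15 16 q] by simp
  then show "q ^ 16 - q ^ 15 \<le> real (window_start q)" "real (window_start q) \<le> q ^ 16 - q ^ 15 + 1"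
    unfolding window_start_def by linarith+
qed

lemma card_window:
  assumes "1 \<le> q"
  shows "real (card (window q n)) \<le> 2 * q ^ 15 + 1"
proof -
  have pos: "0 \<le> q ^ 16" "0 \<le> q ^ 15" using assms by auto
  let ?k1 = "nat \<lfloor>q ^ 16 + q ^ 15\<rfloor>"
  have k1: "real ?k1 \<le> q ^ 16 + q ^ 15" using pos by linarith
  have "window q n \<subseteq> {window_start q..?k1}"
    by (auto simp: window_def le_nat_floor)
  then have "card (window q n) \<le> Suc ?k1 - window_start q"
    using card_mono[of "{window_start q..?k1}" "window q n"] by simp
  then have "real (card (window q n)) \<le> real (Suc ?k1 - window_start q)"
    by simp
  also have "\<dots> \<le> 2 * q ^ 15 + 1"
  proof (cases "window_start q \<le> Suc ?k1")
    case True
    then show ?thesis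
      using window_start_bounds(1)[OF assms] k1 by (simp add: of_nat_diff)
  qed (use pos in auto)
  finally show ?thesis .
qed

lemma union_error_bound:
  fixes \<nu> :: "'i \<Rightarrow> real measure" and q m \<gamma> e z v c :: real
  assumes q: "1 \<le> q" and \<rho>: "real_distribution \<rho>" and \<rho>_int: "\<And>s. 0 \<le> s \<Longrightarrow> integrable \<rho> (\<lambda>x. exp (s * x))"
    and \<rho>_mgf: "\<And>s. 0 \<le> s \<Longrightarrow> mgf \<rho> s \<le> exp (s\<^sup>2 * v / 2)" and pos: "0 < v" "0 < e" "0 < \<gamma>" "0 < c"
    and I: "finite I" "real (card I) \<le> exp (\<gamma> * m * q ^ 16)"
    and \<nu>: "\<And>i. i \<in> I \<Longrightarrow> real_distribution (\<nu> i)" "\<And>i. i \<in> I \<Longrightarrow> integrable (\<nu> i) (\<lambda>x. exp (\<gamma> * x))"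
       "\<And>i. i \<in> I \<Longrightarrow> mgf (\<nu> i) \<gamma> \<le> 1"
    and off: "\<And>i k. i \<in> I \<Longrightarrow> q ^ 15 < \<bar>real k - q ^ 16\<bar> \<Longrightarrow>
      measure (conv_power (\<nu> i) k) {m * q ^ 16 + z * q ^ 8 - (q ^ 8 + real k / q ^ 4)<..}
        \<le> exp (- (\<gamma> * m * q ^ 16)) * (exp (- (c * q ^ 14)) * exp (- (c / q\<^sup>2)) ^ k)"
  shows "(\<Sum>k\<in>window q n. measure (conv_power \<rho> (k - window_start q)) {e * q ^ 8<..})
     + (\<Sum>k\<le>n. measure (conv_power \<rho> k) {q ^ 8 + real k / q ^ 4<..})
     + (\<Sum>i\<in>I. (\<Sum>k\<in>window q n. measure (conv_power (\<nu> i) k) {m * q ^ 16 + e * q ^ 8<..})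
            + (\<Sum>k\<in>{..n} - window q n. measure (conv_power (\<nu> i) k) {m * q ^ 16 + z * q ^ 8 - (q ^ 8 + real k / q ^ 4)<..}))
    \<le> upper_error v e \<gamma> c q"
proof -
  have q0: "0 < q" using q by simp
  let ?w = "2 * q ^ 15 + 1"
  have finw: "finite (window q n)" by (simp add: window_def)
  have win: "real (k - window_start q) \<le> 2 * q ^ 15" if "k \<in> window q n" for k
    using that window_start_bounds(1)[OF q] by (auto simp: window_def of_nat_diff)
  have const: "(\<Sum>k\<in>window q n. f k) \<le> ?w * b" if "\<And>k. k \<in> window q n \<Longrightarrow> f k \<le> b" "0 \<le> b" for f :: "nat \<Rightarrow> real" and b
  proof -
    have "(\<Sum>k\<in>window q n. f k) \<le> real (card (window q n)) * b"
      using sum_bounded_above[of "window q n" f b] that(1) by simp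
    also have "\<dots> \<le> ?w * b"
      by (intro mult_right_mono card_window q that)
    finally show ?thesis .
  qed
  have 1: "(\<Sum>k\<in>window q n. measure (conv_power \<rho> (k - window_start q)) {e * q ^ 8<..}) \<le> ?w * exp (- (e\<^sup>2 / (4 * v) * q))"
    by (intro const conv_power_tail_short_increment[OF \<rho> \<rho>_int \<rho>_mgf pos(1) q0 pos(2)] win) auto
  have 2: "(\<Sum>k\<le>n. measure (conv_power \<rho> k) {q ^ 8 + real k / q ^ 4<..}) \<le> exp (- (q ^ 4 / v)) / (1 - exp (- (1 / (2 * v * q ^ 8))))"
  proof -
    have "(\<Sum>k\<le>n. measure (conv_power \<rho> k) {q ^ 8 + real k / q ^ 4<..}) \<le> (\<Sum>k\<le>n. exp (- (q ^ 4 / v)) * exp (- (1 / (2 * v * q ^ 8))) ^ k)"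
      by (intro sum_mono conv_power_tail_linear_barrier[OF \<rho> \<rho>_int \<rho>_mgf pos(1) q0])
    also have "\<dots> \<le> exp (- (q ^ 4 / v)) * (1 / (1 - exp (- (1 / (2 * v * q ^ 8)))))"
      unfolding sum_distrib_left[symmetric]
      by (intro mult_left_mono sum_power_le_geometric) (use pos q0 in auto)
    finally show ?thesis by simp
  qed
  define b where "b = exp (- (\<gamma> * m * q ^ 16)) * (?w * exp (- (\<gamma> * e * q ^ 8)) + exp (- (c * q ^ 14)) / (1 - exp (- (c / q\<^sup>2))))"
  have r: "exp (- (c / q\<^sup>2)) < 1" using pos q0 by simp
  have 3: "(\<Sum>k\<in>window q n. measure (conv_power (\<nu> i) k) {m * q ^ 16 + e * q ^ 8<..})
     + (\<Sum>k\<in>{..n} - window q n. measure (conv_power (\<nu> i) k) {m * q ^ 16 + z * q ^ 8 - (q ^ 8 + real k / q ^ 4)<..}) \<le> b"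
    if i: "i \<in> I" for i
  proof -
    have "measure (conv_power (\<nu> i) k) {m * q ^ 16 + e * q ^ 8<..} \<le> exp (- (\<gamma> * m * q ^ 16)) * exp (- (\<gamma> * e * q ^ 8))" for k
    proof -
      have "measure (conv_power (\<nu> i) k) {m * q ^ 16 + e * q ^ 8<..} \<le> exp (- \<gamma> * (m * q ^ 16 + e * q ^ 8)) * mgf (\<nu> i) \<gamma> ^ k"
        unfolding mgf_def using pos by (intro chernoff_bound_conv_power \<nu> i) auto
      also have "\<dots> \<le> exp (- \<gamma> * (m * q ^ 16 + e * q ^ 8)) * 1"
        using \<nu>(3)[OF i] by (intro mult_left_mono power_le_one) (auto simp: mgf_def integral_nonneg_AE)
      also have "\<dots> = exp (- (\<gamma> * m * q ^ 16)) * exp (- (\<gamma> * e * q ^ 8))"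
        by (simp add: algebra_simps flip: exp_add)
      finally show ?thesis .
    qed
    then have a: "(\<Sum>k\<in>window q n. measure (conv_power (\<nu> i) k) {m * q ^ 16 + e * q ^ 8<..}) \<le>
        ?w * (exp (- (\<gamma> * m * q ^ 16)) * exp (- (\<gamma> * e * q ^ 8)))"
      by (intro const) auto
    have "(\<Sum>k\<in>{..n} - window q n. measure (conv_power (\<nu> i) k) {m * q ^ 16 + z * q ^ 8 - (q ^ 8 + real k / q ^ 4)<..})
       \<le> (\<Sum>k\<in>{..n} - window q n. exp (- (\<gamma> * m * q ^ 16)) * (exp (- (c * q ^ 14)) * exp (- (c / q\<^sup>2)) ^ k))"
    proof (intro sum_mono off[OF i])
      fix k assume k: "k \<in> {..n} - window q n"
      show "q ^ 15 < \<bar>real k - q ^ 16\<bar>"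
      proof (cases "window_start q \<le> k")
        case True
        with k show ?thesis by (auto simp: window_def)
      next
        case False
        then have "real k < q ^ 16 - q ^ 15"
          unfolding window_start_def by linarith
        then show ?thesis by linarith
      qed
    qed
    also have "\<dots> = exp (- (\<gamma> * m * q ^ 16)) * (exp (- (c * q ^ 14)) * (\<Sum>k\<in>{..n} - window q n. exp (- (c / q\<^sup>2)) ^ k))"
      by (simp only: sum_distrib_left)
    also have "\<dots> \<le> exp (- (\<gamma> * m * q ^ 16)) * (exp (- (c * q ^ 14)) * (1 / (1 - exp (- (c / q\<^sup>2)))))"
      by (intro mult_left_mono sum_power_le_geometric r) auto
    finally show ?thesis
      using a by (simp add: b_def algebra_simps)
  qed
  have b0: "0 \<le> b"
    unfolding b_def using q0 r by (intro mult_nonneg_nonneg add_nonneg_nonneg) auto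
  have "(\<Sum>i\<in>I. (\<Sum>k\<in>window q n. measure (conv_power (\<nu> i) k) {m * q ^ 16 + e * q ^ 8<..})
     + (\<Sum>k\<in>{..n} - window q n. measure (conv_power (\<nu> i) k) {m * q ^ 16 + z * q ^ 8 - (q ^ 8 + real k / q ^ 4)<..})) \<le> real (card I) * b"
    by (rule sum_bounded_above[OF 3])
  also have "\<dots> \<le> exp (\<gamma> * m * q ^ 16) * b"
    by (intro mult_right_mono I b0)
  also have "\<dots> = ?w * exp (- (\<gamma> * e * q ^ 8)) + exp (- (c * q ^ 14)) / (1 - exp (- (c / q\<^sup>2)))"
    unfolding b_def mult.assoc[symmetric] by (simp flip: exp_add)
  finally show ?thesis
    using 1 2 unfolding upper_error_def by linarith
qed

lemma (in fork_join) prob_all_waiting_times_small_ge: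
  fixes q m \<gamma> e z v c :: real
  defines "\<rho> \<equiv> distr \<alpha> borel (\<lambda>x. a - x)" and "\<nu> i \<equiv> distr (\<kappa> i) borel (\<lambda>x. x - a)"
  assumes q: "1 \<le> q" and \<rho>: "real_distribution \<rho>" and \<rho>_int: "\<And>s. 0 \<le> s \<Longrightarrow> integrable \<rho> (\<lambda>x. exp (s * x))"
    and \<rho>_mgf: "\<And>s. 0 \<le> s \<Longrightarrow> mgf \<rho> s \<le> exp (s\<^sup>2 * v / 2)" and pos: "0 < v" "0 < e" "0 < \<gamma>" "0 < c"
    and N: "real N \<le> exp (\<gamma> * m * q ^ 16)"
    and \<nu>: "\<And>i. i \<in> {1..N} \<Longrightarrow> real_distribution (\<nu> i)" "\<And>i. i \<in> {1..N} \<Longrightarrow> integrable (\<nu> i) (\<lambda>x. exp (\<gamma> * x))"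
       "\<And>i. i \<in> {1..N} \<Longrightarrow> mgf (\<nu> i) \<gamma> \<le> 1"
    and off: "\<And>i k. i \<in> {1..N} \<Longrightarrow> q ^ 15 < \<bar>real k - q ^ 16\<bar> \<Longrightarrow>
      measure (conv_power (\<nu> i) k) {m * q ^ 16 + z * q ^ 8 - (q ^ 8 + real k / q ^ 4)<..}
        \<le> exp (- (\<gamma> * m * q ^ 16)) * (exp (- (c * q ^ 14)) * exp (- (c / q\<^sup>2)) ^ k)"
    and n: "window_start q \<le> n"
  shows "measure (conv_power \<rho> (window_start q)) {..(z - 2 * e) * q ^ 8} - upper_error v e \<gamma> c q \<le>
    prob {\<omega>\<in>space M. \<forall>i\<in>{1..N}. waiting_time (\<lambda>j. S i j \<omega>) (\<lambda>j. A j \<omega>) (Suc n) \<le> m * q ^ 16 + z * q ^ 8}"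
proof -
  let ?y = "m * q ^ 16 + z * q ^ 8"
  let ?V = "\<lambda>i \<omega>. waiting_time (\<lambda>j. S i j \<omega>) (\<lambda>j. A j \<omega>) (Suc n)"
  interpret r: real_distribution "conv_power \<rho> (window_start q)"
    by (rule real_distribution_conv_power[OF \<rho>])
  have win: "window q n \<subseteq> {window_start q..n}" by (auto simp: window_def)
  have union: "(\<Sum>k\<in>window q n. measure (conv_power \<rho> (k - window_start q)) {e * q ^ 8<..})
     + (\<Sum>k\<le>n. measure (conv_power \<rho> k) {q ^ 8 + real k / q ^ 4<..})
     + (\<Sum>i\<in>{1..N}. (\<Sum>k\<in>window q n. measure (conv_power (\<nu> i) k) {m * q ^ 16 + e * q ^ 8<..})
            + (\<Sum>k\<in>{..n} - window q n. measure (conv_power (\<nu> i) k) {m * q ^ 16 + z * q ^ 8 - (q ^ 8 + real k / q ^ 4)<..}))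
    \<le> upper_error v e \<gamma> c q"
    using N by (intro union_error_bound q \<rho> \<rho>_int \<rho>_mgf pos \<nu> off) auto
  have "prob {\<omega>\<in>space M. \<exists>i\<in>{1..N}. ?y < ?V i \<omega>} \<le>
    measure (conv_power \<rho> (window_start q)) {z * q ^ 8 - 2 * (e * q ^ 8)<..}
     + (\<Sum>k\<in>window q n. measure (conv_power \<rho> (k - window_start q)) {e * q ^ 8<..})
     + (\<Sum>k\<le>n. measure (conv_power \<rho> k) {q ^ 8 + real k / q ^ 4<..})
     + (\<Sum>i\<in>{1..N}. (\<Sum>k\<in>window q n. measure (conv_power (\<nu> i) k) {m * q ^ 16 + e * q ^ 8<..})
            + (\<Sum>k\<in>{..n} - window q n. measure (conv_power (\<nu> i) k) {m * q ^ 16 + z * q ^ 8 - (q ^ 8 + real k / q ^ 4)<..}))"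
    unfolding \<rho>_def \<nu>_def by (rule prob_some_waiting_time_large_le[OF win n])
  also have "\<dots> \<le> measure (conv_power \<rho> (window_start q)) {z * q ^ 8 - 2 * (e * q ^ 8)<..} + upper_error v e \<gamma> c q"
    using union by linarith
  finally have "prob {\<omega>\<in>space M. \<exists>i\<in>{1..N}. ?y < ?V i \<omega>} \<le>
      measure (conv_power \<rho> (window_start q)) {(z - 2 * e) * q ^ 8<..} + upper_error v e \<gamma> c q"
    by (simp add: algebra_simps)
  moreover have "measure (conv_power \<rho> (window_start q)) {(z - 2 * e) * q ^ 8<..} = 1 - measure (conv_power \<rho> (window_start q)) {..(z - 2 * e) * q ^ 8}"
    using r.prob_compl[of "{..(z - 2 * e) * q ^ 8}"] by (simp add: Compl_eq_Diff_UNIV[symmetric] Compl_atMost)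
  moreover have "prob {\<omega>\<in>space M. \<exists>i\<in>{1..N}. ?y < ?V i \<omega>} = 1 - prob {\<omega>\<in>space M. \<forall>i\<in>{1..N}. ?V i \<omega> \<le> ?y}"
  proof -
    have ev: "{\<omega>\<in>space M. \<forall>i\<in>{1..N}. ?V i \<omega> \<le> ?y} \<in> events"
    proof (rule sets.sets_Collect_finite_All)
      fix i assume i: "i \<in> {1..N}"
      have "?V i \<in> borel_measurable M"
        by (rule waiting_time_measurable[OF S_measurable[OF i] A_measurable])
      from measurable_sets[OF this, of "{..?y}"] show "{\<omega> \<in> space M. ?V i \<omega> \<le> ?y} \<in> events"
        by (simp add: vimage_def Int_def conj_commute)
    qed simp
    have "{\<omega>\<in>space M. \<exists>i\<in>{1..N}. ?y < ?V i \<omega>} = space M - {\<omega>\<in>space M. \<forall>i\<in>{1..N}. ?V i \<omega> \<le> ?y}"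
      by (auto simp: not_le)
    then show ?thesis using prob_compl[OF ev] by (simp only:)
  qed
  ultimately show ?thesis by linarith
qed

text \<open>The inequalities come with a shift of the argument and are available only away from 0, the
possible atom of the limit law; small shifts that avoid 0 always exist.\<close>
lemma cdf_sandwich_tendsto:
  fixes G :: "nat \<Rightarrow> real \<Rightarrow> real" and \<Phi> :: "real \<Rightarrow> real"
  assumes lower: "\<And>\<epsilon> \<delta>. 0 < \<epsilon> \<Longrightarrow> z - \<epsilon> \<noteq> 0 \<Longrightarrow> 0 < \<delta> \<Longrightarrow> eventually (\<lambda>n. \<Phi> (z - \<epsilon>) - \<delta> \<le> G n z) sequentially"
    and upper: "\<And>\<epsilon> \<delta>. 0 < \<epsilon> \<Longrightarrow> z + \<epsilon> \<noteq> 0 \<Longrightarrow> 0 < \<delta> \<Longrightarrow> eventually (\<lambda>n. G n z \<le> \<Phi> (z + \<epsilon>) + \<delta>) sequentially"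
    and cont: "isCont \<Phi> z"
  shows "(\<lambda>n. G n z) \<longlonglongrightarrow> \<Phi> z"
proof (rule tendstoI)
  fix d :: real assume d: "0 < d"
  with cont obtain r where r: "0 < r" "\<And>y. \<bar>y - z\<bar> < r \<Longrightarrow> \<bar>\<Phi> y - \<Phi> z\<bar> < d / 2"
    unfolding continuous_at_eps_delta dist_real_def by (metis half_gt_zero)
  define \<epsilon>1 where "\<epsilon>1 = (if z = r / 2 then r / 3 else r / 2)"
  define \<epsilon>2 where "\<epsilon>2 = (if z = - (r / 2) then r / 3 else r / 2)"
  have e: "0 < \<epsilon>1" "\<epsilon>1 < r" "z - \<epsilon>1 \<noteq> 0" "0 < \<epsilon>2" "\<epsilon>2 < r" "z + \<epsilon>2 \<noteq> 0"
    using r(1) by (auto simp: \<epsilon>1_def \<epsilon>2_def)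
  have c: "\<bar>\<Phi> (z - \<epsilon>1) - \<Phi> z\<bar> < d / 2" "\<bar>\<Phi> (z + \<epsilon>2) - \<Phi> z\<bar> < d / 2"
    using e r(2)[of "z - \<epsilon>1"] r(2)[of "z + \<epsilon>2"] by simp_all
  have "eventually (\<lambda>n. \<Phi> (z - \<epsilon>1) - d / 4 \<le> G n z) sequentially" "eventually (\<lambda>n. G n z \<le> \<Phi> (z + \<epsilon>2) + d / 4) sequentially"
    using e d by (auto intro!: lower upper)
  then show "eventually (\<lambda>n. dist (G n z) (\<Phi> z) < d) sequentially"
  proof eventually_elim
    case (elim n)
    with c d show ?case unfolding dist_real_def by (simp only: abs_less_iff) linarith
  qed
qed

section \<open>The logarithmic scale\<close>

text \<open>With \<open>b = \<gamma> m\<close> this is the scale \<open>q\<close> of the estimates: it makes \<open>exp (\<gamma> m q^16)\<close> equal to the number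
of servers.\<close>
definition log_scale :: "real \<Rightarrow> nat \<Rightarrow> real" where
  "log_scale b N = root 16 (ln (real N) / b)"

lemma log_scale_power:
  assumes "0 < b" "1 \<le> N"
  shows "log_scale b N ^ 16 = ln (real N) / b" "exp (b * log_scale b N ^ 16) = real N"
proof -
  show 1: "log_scale b N ^ 16 = ln (real N) / b"
    unfolding log_scale_def using assms by (intro real_root_pow_pos2) auto
  show "exp (b * log_scale b N ^ 16) = real N"
    unfolding 1 using assms by simp
qed

lemma log_scale_at_top:
  assumes "0 < b"
  shows "filterlim (log_scale b) at_top sequentially"
  unfolding filterlim_at_top_ge[where c=0]
proof safe
  fix Z :: real assume Z: "0 \<le> Z"
  have "filterlim (\<lambda>N. ln (real N) / b) at_top sequentially"
    using assms by real_asymp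
  then have "eventually (\<lambda>N. Z ^ 16 \<le> ln (real N) / b) sequentially"
    by (simp add: filterlim_at_top)
  then show "eventually (\<lambda>N. Z \<le> log_scale b N) sequentially"
  proof eventually_elim
    case (elim N)
    then have "root 16 (Z ^ 16) \<le> log_scale b N"
      unfolding log_scale_def by simp
    then show ?case using Z by (simp add: real_root_power_cancel)
  qed
qed

lemma nat_sequence_at_top:
  assumes "((\<lambda>q. real (f q) / q ^ 16) \<longlongrightarrow> 1) at_top"
  shows "filterlim f at_top (at_top :: real filter)"
proof -
  have "filterlim (\<lambda>q. real (f q) / q ^ 16 * q ^ 16) at_top (at_top :: real filter)"
    by (rule filterlim_tendsto_pos_mult_at_top[OF assms]) (simp, real_asymp)
  moreover have "eventually (\<lambda>q. real (f q) / q ^ 16 * q ^ 16 = real (f q)) (at_top :: real filter)"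
    using eventually_gt_at_top[of 0] by eventually_elim simp
  ultimately have "filterlim (\<lambda>q. real (f q)) at_top at_top"
    by (simp cong: filterlim_cong)
  then show ?thesis
    by (simp add: filterlim_sequentially_iff_filterlim_real)
qed

lemma window_start_asymp: "((\<lambda>q. real (window_start q) / q ^ 16) \<longlongrightarrow> 1) at_top"
proof (rule tendsto_sandwich)
  show "((\<lambda>q::real. (q ^ 16 - q ^ 15) / q ^ 16) \<longlongrightarrow> 1) at_top"
    "((\<lambda>q::real. (q ^ 16 - q ^ 15 + 1) / q ^ 16) \<longlongrightarrow> 1) at_top"
    by real_asymp+
  show "eventually (\<lambda>q. (q ^ 16 - q ^ 15) / q ^ 16 \<le> real (window_start q) / q ^ 16) at_top"
    "eventually (\<lambda>q. real (window_start q) / q ^ 16 \<le> (q ^ 16 - q ^ 15 + 1) / q ^ 16) at_top"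
    using eventually_ge_at_top[of 1]
    by (eventually_elim, intro divide_right_mono window_start_bounds, auto)+
qed

lemma floor_asymp: "((\<lambda>q. real (nat \<lfloor>q ^ 16\<rfloor>) / q ^ 16) \<longlongrightarrow> 1) (at_top :: real filter)"
proof (rule tendsto_sandwich)
  show "((\<lambda>q::real. (q ^ 16 - 1) / q ^ 16) \<longlongrightarrow> 1) at_top"
    "((\<lambda>q::real. q ^ 16 / q ^ 16) \<longlongrightarrow> 1) at_top"
    by real_asymp+
  show "eventually (\<lambda>q. (q ^ 16 - 1) / q ^ 16 \<le> real (nat \<lfloor>q ^ 16\<rfloor>) / q ^ 16) (at_top :: real filter)"
    "eventually (\<lambda>q. real (nat \<lfloor>q ^ 16\<rfloor>) / q ^ 16 \<le> q ^ 16 / q ^ 16) (at_top :: real filter)"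
    by (intro always_eventually allI divide_right_mono; simp; linarith)+
qed

text \<open>Both the start of the window and the integer part of \<open>q^16\<close> are admissible choices of \<open>f\<close>. They serve
as the observation time of the shared walk in the upper and in the lower bound of the maximum.\<close>
lemma clt_cdf_along_scale:
  fixes q :: "nat \<Rightarrow> real"
  assumes \<rho>: "real_distribution \<rho>" and mean: "(\<integral>x. x \<partial>\<rho>) = 0"
    and sq: "integrable \<rho> (\<lambda>x. x\<^sup>2)" and var: "(\<integral>x. x\<^sup>2 \<partial>\<rho>) = \<sigma>\<^sup>2" and "0 \<le> \<sigma>"
    and q: "filterlim q at_top sequentially" and f: "((\<lambda>q. real (f q) / q ^ 16) \<longlongrightarrow> 1) (at_top :: real filter)"
    and "y \<noteq> 0"
  shows "(\<lambda>N. measure (conv_power \<rho> (f (q N))) {..y * q N ^ 8}) \<longlonglongrightarrow>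
    cdf (distr std_normal_distribution borel (\<lambda>x. \<sigma> * x)) y"
proof -
  have f': "filterlim (\<lambda>N. f (q N)) at_top sequentially"
    by (rule filterlim_compose[OF nat_sequence_at_top[OF f] q])
  have r: "(\<lambda>N. real (f (q N)) / q N ^ 16) \<longlonglongrightarrow> 1"
    by (rule filterlim_compose[OF f q])
  have "weak_conv_m (\<lambda>N. distr (conv_power \<rho> (f (q N))) borel (\<lambda>x. x / sqrt (q N ^ 16)))
    (distr std_normal_distribution borel (\<lambda>x. \<sigma> * x))"
    by (rule central_limit_theorem_conv_power[OF \<rho> mean sq var \<open>0 \<le> \<sigma>\<close> f' _ r]) simp
  then have "(\<lambda>N. cdf (distr (conv_power \<rho> (f (q N))) borel (\<lambda>x. x / sqrt (q N ^ 16))) y) \<longlonglongrightarrow>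
    cdf (distr std_normal_distribution borel (\<lambda>x. \<sigma> * x)) y"
    using isCont_cdf_scaled_normal[OF \<open>y \<noteq> 0\<close>] by (simp add: weak_conv_m_def weak_conv_def)
  moreover have "eventually (\<lambda>N. cdf (distr (conv_power \<rho> (f (q N))) borel (\<lambda>x. x / sqrt (q N ^ 16))) y =
      measure (conv_power \<rho> (f (q N))) {..y * q N ^ 8}) sequentially"
    using eventually_compose_filterlim[OF eventually_gt_at_top[of 0] q]
  proof eventually_elim
    case (elim N)
    have "sqrt (q N ^ 16) = q N ^ 8"
      using elim real_sqrt_abs[of "q N ^ 8"] by (simp flip: power_mult)
    moreover have "(\<lambda>x. x / q N ^ 8) -` {..y} = {..y * q N ^ 8}"
      using elim by (auto simp: field_simps)
    ultimately show ?case
      unfolding cdf_def by (subst measure_distr) auto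
  qed
  ultimately show ?thesis
    by (rule Lim_transform_eventually)
qed

text \<open>If one walk exceeds the level with probability \<open>p\<close>, then \<open>l\<close> walks all stay below with probability at
most \<open>exp (- p l)\<close>. As \<open>l\<close> is of order \<open>exp (\<gamma> m q^16)\<close>, the exponent \<open>p l\<close> diverges by
\<open>conv_power_tail_lower_bound\<close>. Rounding \<open>q^16\<close> down lowers the mean by at most \<open>m\<close>, which half of
the allowance \<open>e q^8\<close> absorbs.\<close>
lemma prob_maximum_of_sums_small_tendsto_0:
  fixes q :: "nat \<Rightarrow> real" and l :: "nat \<Rightarrow> nat" and \<gamma> e \<alpha> :: real
  assumes \<nu>: "real_distribution \<nu>" and \<gamma>: "\<gamma> \<in> interior {\<theta>. integrable \<nu> (\<lambda>x. exp (\<theta> * x))}"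
    and one: "mgf \<nu> \<gamma> = 1" and "0 < \<gamma>" and nz: "\<not> (AE x in \<nu>. x = 0)" and "0 < e"
  defines "m \<equiv> \<integral>x. x * exp (\<gamma> * x) \<partial>\<nu>"
  assumes "0 < m" and q: "filterlim q at_top sequentially" and "0 < \<alpha>"
    and l: "eventually (\<lambda>N. \<alpha> * exp (\<gamma> * m * q N ^ 16) \<le> real (l N)) sequentially"
  shows "(\<lambda>N. measure (conv_power \<nu> (nat \<lfloor>q N ^ 16\<rfloor>)) {..m * q N ^ 16 - e * q N ^ 8} ^ l N) \<longlonglongrightarrow> 0"
proof -
  define g where "g n = exp (\<gamma> * m * real n) * measure (conv_power \<nu> n) {m * real n - e / 2 * sqrt (real n)<..}" for n
  have "filterlim g at_top sequentially"
    unfolding g_def m_def using \<open>0 < e\<close>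
    by (intro conv_power_tail_lower_bound[OF \<nu> \<gamma> one \<open>0 < \<gamma>\<close> nz]) simp
  from filterlim_compose[OF this filterlim_compose[OF nat_sequence_at_top[OF floor_asymp] q]]
  have "filterlim (\<lambda>N. g (nat \<lfloor>q N ^ 16\<rfloor>)) at_top sequentially" .
  then have lim: "(\<lambda>N. exp (- (\<alpha> * g (nat \<lfloor>q N ^ 16\<rfloor>)))) \<longlonglongrightarrow> 0"
    using \<open>0 < \<alpha>\<close>
    by (intro filterlim_compose[OF exp_at_bot] filterlim_compose[OF filterlim_uminus_at_bot_at_top]
        filterlim_tendsto_pos_mult_at_top[OF tendsto_const])
  have "eventually (\<lambda>q. 1 \<le> q \<and> m \<le> e / 2 * q ^ 8) (at_top :: real filter)"
    using \<open>0 < e\<close> by (intro eventually_conj eventually_ge_at_top) real_asymp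
  from eventually_compose_filterlim[OF this q] l
  have "eventually (\<lambda>N. measure (conv_power \<nu> (nat \<lfloor>q N ^ 16\<rfloor>)) {..m * q N ^ 16 - e * q N ^ 8} ^ l N \<le>
      exp (- (\<alpha> * g (nat \<lfloor>q N ^ 16\<rfloor>)))) sequentially"
  proof eventually_elim
    case (elim N)
    let ?k = "nat \<lfloor>q N ^ 16\<rfloor>"
    have q1: "1 \<le> q N" and me: "m \<le> e / 2 * q N ^ 8" using elim by auto
    have "0 \<le> q N ^ 16" by simp
    then have k: "real ?k \<le> q N ^ 16" "q N ^ 16 \<le> real ?k + 1" by linarith+
    interpret c: real_distribution "conv_power \<nu> ?k"
      by (rule real_distribution_conv_power[OF \<nu>])
    define p where "p = measure (conv_power \<nu> ?k) {m * q N ^ 16 - e * q N ^ 8<..}"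
    have eq: "measure (conv_power \<nu> ?k) {..m * q N ^ 16 - e * q N ^ 8} = 1 - p"
      using c.prob_compl[of "{..m * q N ^ 16 - e * q N ^ 8}"]
      by (simp add: p_def Compl_eq_Diff_UNIV[symmetric] Compl_atMost)
    have p: "0 \<le> p" "p \<le> 1" by (auto simp: p_def)
    have "sqrt (real ?k) \<le> sqrt (q N ^ 16)" using k by simp
    also have "sqrt (q N ^ 16) = q N ^ 8"
      using q1 real_sqrt_abs[of "q N ^ 8"] by (simp flip: power_mult)
    finally have "e / 2 * sqrt (real ?k) \<le> e / 2 * q N ^ 8"
      using \<open>0 < e\<close> by (intro mult_left_mono) auto
    moreover have "m * q N ^ 16 \<le> m * (real ?k + 1)"
      using k \<open>0 < m\<close> by (intro mult_left_mono) auto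
    moreover have "e * q N ^ 8 = e / 2 * q N ^ 8 + e / 2 * q N ^ 8" "m * (real ?k + 1) = m * real ?k + m"
      by (simp_all add: algebra_simps)
    ultimately have "m * q N ^ 16 - e * q N ^ 8 \<le> m * real ?k - e / 2 * sqrt (real ?k)"
      using me by linarith
    then have "measure (conv_power \<nu> ?k) {m * real ?k - e / 2 * sqrt (real ?k)<..} \<le> p"
      unfolding p_def by (intro c.finite_measure_mono) auto
    then have "g ?k \<le> exp (\<gamma> * m * q N ^ 16) * p"
      unfolding g_def using k \<open>0 < \<gamma>\<close> \<open>0 < m\<close> by (intro mult_mono) auto
    then have "\<alpha> * g ?k \<le> \<alpha> * (exp (\<gamma> * m * q N ^ 16) * p)"
      using \<open>0 < \<alpha>\<close> by (intro mult_left_mono) auto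
    also have "\<dots> = (\<alpha> * exp (\<gamma> * m * q N ^ 16)) * p" by simp
    also have "\<dots> \<le> real (l N) * p"
      using elim p by (intro mult_right_mono) auto
    finally have gp: "\<alpha> * g ?k \<le> real (l N) * p" .
    have "(1 - p) ^ l N \<le> exp (- p) ^ l N"
      using p exp_ge_add_one_self[of "- p"] by (intro power_mono) auto
    also have "\<dots> = exp (- (real (l N) * p))"
      by (simp flip: exp_of_nat_mult)
    also have "\<dots> \<le> exp (- (\<alpha> * g ?k))"
      using gp by simp
    finally show ?case unfolding eq .
  qed
  then show ?thesis
    by (rule tendsto_sandwich[OF _ _ tendsto_const lim, rotated]) simp
qed

section \<open>The limit theorem\<close>

theorem corollary1:
  fixes K :: nat
    and M :: "nat \<Rightarrow> nat \<Rightarrow> nat"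
    and \<alpha> \<mu> \<gamma> :: "nat \<Rightarrow> real"
    and lam \<sigma>\<^sub>A :: real
    and kstar :: nat
    and R :: "'r measure" and Acl :: "'r \<Rightarrow> real" and Scl :: "nat \<Rightarrow> 'r \<Rightarrow> real"
    and P :: "nat \<Rightarrow> 'a measure"
    and A :: "nat \<Rightarrow> nat \<Rightarrow> 'a \<Rightarrow> real"
    and S :: "nat \<Rightarrow> nat \<Rightarrow> nat \<Rightarrow> 'a \<Rightarrow> real"
    and Q :: "nat \<Rightarrow> 'b measure"
    and W :: "nat \<Rightarrow> nat \<Rightarrow> 'b \<Rightarrow> real"
  assumes K: "1 \<le> K"
    and M_0: "\<And>N. K \<le> N \<Longrightarrow> M N 0 = 0"
    and M_K: "\<And>N. K \<le> N \<Longrightarrow> M N K = N"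
    and M_less: "\<And>N k. K \<le> N \<Longrightarrow> k \<in> {1..K} \<Longrightarrow> M N (k - 1) < M N k"
    and M_limit: "\<And>k. k \<in> {1..K} \<Longrightarrow>
          (\<lambda>N. (real (M N k) - real (M N (k - 1))) / real N) \<longlonglongrightarrow> \<alpha> k"
    and \<alpha>: "\<And>k. k \<in> {1..K} \<Longrightarrow> 0 < \<alpha> k \<and> \<alpha> k \<le> 1"
    and \<alpha>_sum: "(\<Sum>k=1..K. \<alpha> k) = 1"
    and R: "prob_space R"
    and Acl_rv: "Acl \<in> borel_measurable R"
    and Scl_rv: "\<And>k. k \<in> {1..K} \<Longrightarrow> Scl k \<in> borel_measurable R"
    and lam_pos: "0 < lam"
    and A_mean: "prob_space.expectation R Acl = 1 / lam"
    and A_square: "integrable R (\<lambda>\<omega>. (Acl \<omega>)\<^sup>2)"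
    and \<sigma>_nonneg: "0 \<le> \<sigma>\<^sub>A"
    and A_variance: "prob_space.variance R Acl = \<sigma>\<^sub>A\<^sup>2"
    and \<mu>_pos: "\<And>k. k \<in> {1..K} \<Longrightarrow> 0 < \<mu> k"
    and drift: "\<And>k. k \<in> {1..K} \<Longrightarrow>
          prob_space.expectation R (\<lambda>\<omega>. Scl k \<omega> - Acl \<omega>) = - \<mu> k"
    and \<gamma>_pos: "\<And>k. k \<in> {1..K} \<Longrightarrow> 0 < \<gamma> k"
    and \<gamma>_root: "\<And>k. k \<in> {1..K} \<Longrightarrow> cgf R (\<lambda>\<omega>. Scl k \<omega> - 1 / lam) (\<gamma> k) = 0"
    and \<gamma>_interior: "\<And>k. k \<in> {1..K} \<Longrightarrow>
          \<gamma> k \<in> interior (cgf_domain R (\<lambda>\<omega>. Scl k \<omega> - 1 / lam))"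
    and kstar: "{k \<in> {1..K}. \<gamma> k = Min (\<gamma> ` {1..K})} = {kstar}"
    and P: "\<And>N. K \<le> N \<Longrightarrow> prob_space (P N)"
    and indep: "\<And>N. K \<le> N \<Longrightarrow>
          prob_space.indep_vars (P N) (\<lambda>_. borel)
            (case_sum (\<lambda>(i, j). S N i j) (\<lambda>j. A N j)) (({1..N} \<times> {1..}) <+> {1..})"
    and S_nonneg: "\<And>N i j. K \<le> N \<Longrightarrow> i \<in> {1..N} \<Longrightarrow> 1 \<le> j \<Longrightarrow> AE \<omega> in P N. 0 \<le> S N i j \<omega>"
    and A_nonneg: "\<And>N j. K \<le> N \<Longrightarrow> 1 \<le> j \<Longrightarrow> AE \<omega> in P N. 0 \<le> A N j \<omega>"
    and S_distr: "\<And>N k i j. K \<le> N \<Longrightarrow> k \<in> {1..K} \<Longrightarrow> M N (k - 1) < i \<Longrightarrow> i \<le> M N k \<Longrightarrow> 1 \<le> j \<Longrightarrow>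
          distr (P N) borel (S N i j) = distr R borel (Scl k)"
    and A_distr: "\<And>N j. K \<le> N \<Longrightarrow> 1 \<le> j \<Longrightarrow>
          distr (P N) borel (A N j) = distr R borel Acl"
    and W: "\<And>N. K \<le> N \<Longrightarrow> steady_state_waiting_times N (P N) (S N) (A N) (Q N) (W N)"
  shows "weak_conv_m
      (\<lambda>N. distr (Q N) borel
         (\<lambda>\<omega>. (Max ((\<lambda>i. W N i \<omega>) ` {1..N}) - 1 / \<gamma> kstar * ln (real N)) / sqrt (ln (real N))))
      (distr std_normal_distribution borel
         (\<lambda>x. \<sigma>\<^sub>A / sqrt (deriv (cgf R (\<lambda>\<omega>. Scl kstar \<omega> - 1 / lam)) (\<gamma> kstar) * \<gamma> kstar) * x))"
proof -
  interpret R: prob_space R by (rule R)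
  define \<nu> where "\<nu> k = distr R borel (\<lambda>\<omega>. Scl k \<omega> - 1 / lam)" for k
  define \<rho> where "\<rho> = distr R borel (\<lambda>\<omega>. 1 / lam - Acl \<omega>)"

  have A_int: "integrable R Acl"
    using A_mean lam_pos not_integrable_integral_eq[of R Acl] by fastforce
  define v where "v = R.expectation (\<lambda>\<omega>. (Acl \<omega>)\<^sup>2)"
  have "R.variance Acl = v - (1 / lam)\<^sup>2"
    using R.variance_eq[OF A_int A_square] unfolding v_def A_mean by simp
  then have v_eq: "v = \<sigma>\<^sub>A\<^sup>2 + (1 / lam)\<^sup>2"
    unfolding A_variance by simp
  have v: "0 < v"
    unfolding v_eq using lam_pos by (intro add_nonneg_pos) auto
  \<comment> \<open>The hypothesis speaks of the copies \<open>A N j\<close>; the law carries it over to \<open>Acl\<close>.\<close>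
  have A_AE: "AE \<omega> in R. 0 \<le> Acl \<omega>"
  proof -
    interpret PK: prob_space "P K" by (rule P) simp
    have "A K 1 \<in> borel_measurable (P K)"
      using indep[of K] unfolding PK.indep_vars_def by (auto dest!: bspec[of _ _ "Inr 1"])
    then have "AE x in distr (P K) borel (A K 1). 0 \<le> x"
      using A_nonneg[of K 1] by (simp add: AE_distr_iff)
    then have "AE x in distr R borel Acl. 0 \<le> x"
      unfolding A_distr[OF order_refl order_refl] .
    then show ?thesis
      using Acl_rv by (simp add: AE_distr_iff)
  qed
  have \<rho>: "real_distribution \<rho>"
    unfolding \<rho>_def using Acl_rv by (intro R.real_distribution_distr) simp
  have \<rho>_exp: "integrable \<rho> (\<lambda>x. exp (s * x))" "mgf \<rho> s \<le> exp (s\<^sup>2 * v / 2)" if "0 \<le> s" for s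
    using R.mgf_centered_negative_le[OF Acl_rv A_AE A_int A_square that]
    unfolding \<rho>_def v_def A_mean by blast+
  have \<rho>_mean: "(\<integral>x. x \<partial>\<rho>) = 0"
  proof -
    have "(\<integral>x. x \<partial>\<rho>) = (\<integral>\<omega>. 1 / lam - Acl \<omega> \<partial>R)"
      unfolding \<rho>_def using Acl_rv by (intro integral_distr) simp_all
    also have "\<dots> = 0"
      using A_int A_mean R.prob_space by simp
    finally show ?thesis .
  qed
  have sq_swap: "(1 / lam - Acl \<omega>)\<^sup>2 = (Acl \<omega> - 1 / lam)\<^sup>2" for \<omega>
    by (rule power2_commute)
  have \<rho>_sq: "integrable \<rho> (\<lambda>x. x\<^sup>2)"
  proof -
    have "integrable R (\<lambda>\<omega>. (1 / lam)\<^sup>2 + (Acl \<omega>)\<^sup>2 - 2 * (1 / lam) * Acl \<omega>)"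
      using A_int A_square by simp
    then show ?thesis
      unfolding \<rho>_def using Acl_rv by (simp add: integrable_distr_eq power2_diff)
  qed
  have \<rho>_var: "(\<integral>x. x\<^sup>2 \<partial>\<rho>) = \<sigma>\<^sub>A\<^sup>2"
  proof -
    have "(\<integral>x. x\<^sup>2 \<partial>\<rho>) = (\<integral>\<omega>. (1 / lam - Acl \<omega>)\<^sup>2 \<partial>R)"
      unfolding \<rho>_def using Acl_rv by (intro integral_distr) simp_all
    then show ?thesis
      using A_variance unfolding A_mean sq_swap by simp
  qed

  have \<nu>: "real_distribution (\<nu> k)" if "k \<in> {1..K}" for k
    unfolding \<nu>_def using Scl_rv[OF that] by (intro R.real_distribution_distr) simp
  have \<nu>_integrable: "integrable (\<nu> k) (\<lambda>x. exp (\<theta> * x)) \<longleftrightarrow> \<theta> \<in> cgf_domain R (\<lambda>\<omega>. Scl k \<omega> - 1 / lam)"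
    if "k \<in> {1..K}" for k \<theta>
    unfolding \<nu>_def cgf_domain_def using Scl_rv[OF that] by (simp add: integrable_distr_eq)
  have \<nu>_interior: "\<gamma> k \<in> interior {\<theta>. integrable (\<nu> k) (\<lambda>x. exp (\<theta> * x))}" if "k \<in> {1..K}" for k
    using \<gamma>_interior[OF that] \<nu>_integrable[OF that] by simp
  have \<nu>_int: "integrable (\<nu> k) (\<lambda>x. exp (\<gamma> k * x))" if "k \<in> {1..K}" for k
    using \<nu>_interior[OF that] interior_subset by blast
  have cgf_eq: "cgf R (\<lambda>\<omega>. Scl k \<omega> - 1 / lam) = (\<lambda>\<theta>. ln (mgf (\<nu> k) \<theta>))" if "k \<in> {1..K}" for k
  proof
    fix \<theta>
    have "mgf (\<nu> k) \<theta> = (\<integral>\<omega>. exp (\<theta> * (Scl k \<omega> - 1 / lam)) \<partial>R)"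
      unfolding mgf_def \<nu>_def using Scl_rv[OF that] by (intro integral_distr) simp_all
    then show "cgf R (\<lambda>\<omega>. Scl k \<omega> - 1 / lam) \<theta> = ln (mgf (\<nu> k) \<theta>)"
      by (simp add: cgf_def)
  qed
  have \<nu>_one: "mgf (\<nu> k) (\<gamma> k) = 1" if "k \<in> {1..K}" for k
    using \<gamma>_root[OF that] mgf_pos[OF \<nu>[OF that] \<nu>_int[OF that]] by (simp add: cgf_eq[OF that])
  \<comment> \<open>Otherwise \<open>Scl k\<close> would equal the mean of \<open>Acl\<close>, contradicting the negative drift.\<close>
  have \<nu>_nz: "\<not> (AE x in \<nu> k. x = 0)" if "k \<in> {1..K}" for k
  proof
    assume "AE x in \<nu> k. x = 0"
    then have AE: "AE \<omega> in R. Scl k \<omega> - 1 / lam = 0"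
      unfolding \<nu>_def using Scl_rv[OF that] by (simp add: AE_distr_iff)
    have "R.expectation (\<lambda>\<omega>. Scl k \<omega> - Acl \<omega>) = R.expectation (\<lambda>\<omega>. 1 / lam - Acl \<omega>)"
    proof (rule integral_cong_AE)
      show "AE \<omega> in R. Scl k \<omega> - Acl \<omega> = 1 / lam - Acl \<omega>"
        using AE by eventually_elim simp
    qed (use Scl_rv[OF that] Acl_rv in simp_all)
    also have "\<dots> = 0"
      using A_int A_mean R.prob_space by simp
    finally show False
      using drift[OF that] \<mu>_pos[OF that] by simp
  qed

  have ks: "kstar \<in> {1..K}" and \<gamma>_min: "\<gamma> kstar = Min (\<gamma> ` {1..K})"
    using kstar by blast+
  have \<gamma>_less: "\<gamma> kstar < \<gamma> k" if "k \<in> {1..K}" "k \<noteq> kstar" for k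
  proof -
    have "\<gamma> kstar \<le> \<gamma> k"
      unfolding \<gamma>_min using that by (intro Min_le) auto
    moreover have "\<gamma> k \<noteq> \<gamma> kstar"
      using that kstar \<gamma>_min by auto
    ultimately show ?thesis by simp
  qed
  define g where "g = \<gamma> kstar"
  have g: "0 < g" unfolding g_def by (rule \<gamma>_pos[OF ks])
  define m where "m = (\<integral>x. x * exp (g * x) \<partial>\<nu> kstar)"
  have m: "0 < m"
  proof -
    have "integrable (\<nu> kstar) (\<lambda>x. x * exp (g * x))"
      unfolding g_def by (rule mgf_quadratic[OF \<nu>[OF ks] \<nu>_interior[OF ks]])
    then show ?thesis
      unfolding m_def
      using mgf_derivative_pos[OF \<nu>[OF ks] \<nu>_int[OF ks] _ \<nu>_one[OF ks] \<gamma>_pos[OF ks] \<nu>_nz[OF ks]]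
      by (simp add: g_def)
  qed
  have m_deriv: "deriv (cgf R (\<lambda>\<omega>. Scl kstar \<omega> - 1 / lam)) (\<gamma> kstar) = m"
    unfolding cgf_eq[OF ks] m_def g_def
    by (rule deriv_log_mgf[OF \<nu>[OF ks] \<nu>_interior[OF ks] \<nu>_one[OF ks]])
  have \<nu>_g: "integrable (\<nu> k) (\<lambda>x. exp (g * x))" "mgf (\<nu> k) g \<le> 1" if "k \<in> {1..K}" for k
  proof -
    have "integrable (\<nu> k) (\<lambda>x. exp (g * x)) \<and> mgf (\<nu> k) g \<le> 1"
    proof (cases "k = kstar")
      case True
      then show ?thesis using \<nu>_int[OF ks] \<nu>_one[OF ks] by (simp add: g_def)
    next
      case False
      then have "g < \<gamma> k" using \<gamma>_less[OF that] by (simp add: g_def)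
      from mgf_less_one_between[OF \<nu>[OF that] \<nu>_int[OF that] \<nu>_one[OF that] g this \<nu>_nz[OF that]]
      show ?thesis by simp
    qed
    then show "integrable (\<nu> k) (\<lambda>x. exp (g * x))" "mgf (\<nu> k) g \<le> 1" by blast+
  qed
  \<comment> \<open>One constant \<open>c\<close> serves all classes, since the bounds weaken as \<open>c\<close> decreases.\<close>
  have off: "\<exists>c>0. eventually (\<lambda>q::real. \<forall>k\<in>{1..K}. \<forall>j. q ^ 15 < \<bar>real j - q ^ 16\<bar> \<longrightarrow>
      measure (conv_power (\<nu> k) j) {m * q ^ 16 + z * q ^ 8 - (q ^ 8 + real j / q ^ 4)<..}
        \<le> exp (- (g * m * q ^ 16)) * (exp (- (c * q ^ 14)) * exp (- (c / q\<^sup>2)) ^ j)) at_top" for z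
  proof -
    let ?B = "\<lambda>k c (q::real). \<forall>j. q ^ 15 < \<bar>real j - q ^ 16\<bar> \<longrightarrow>
      measure (conv_power (\<nu> k) j) {m * q ^ 16 + z * q ^ 8 - (q ^ 8 + real j / q ^ 4)<..}
        \<le> exp (- (g * m * q ^ 16)) * (exp (- (c * q ^ 14)) * exp (- (c / q\<^sup>2)) ^ j)"
    have "\<exists>c>0. eventually (?B k c) at_top" if k: "k \<in> {1..K}" for k
    proof (cases "k = kstar")
      case True
      show ?thesis
        using conv_power_tail_off_window[OF \<nu>[OF ks] \<nu>_interior[OF ks] \<nu>_one[OF ks] \<gamma>_pos[OF ks] \<nu>_nz[OF ks], of z "\<exists>c>0. eventually (?B k c) at_top"]
        unfolding True m_def g_def by blast
    next
      case False
      define \<theta> where "\<theta> = (g + \<gamma> k) / 2"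
      have \<theta>: "g < \<theta>" "\<theta> < \<gamma> k" "0 < \<theta>"
        using \<gamma>_less[OF k False] g by (simp_all add: \<theta>_def g_def)
      note mgf = mgf_less_one_between[OF \<nu>[OF k] \<nu>_int[OF k] \<nu>_one[OF k] \<theta>(3) \<theta>(2) \<nu>_nz[OF k]]
      obtain c where "0 < c" and ev: "eventually (\<lambda>q::real. \<forall>j.
          measure (conv_power (\<nu> k) j) {m * q ^ 16 + z * q ^ 8 - (q ^ 8 + real j / q ^ 4)<..}
          \<le> exp (- (g * m * q ^ 16)) * (exp (- (c * q ^ 14)) * exp (- (c / q\<^sup>2)) ^ j)) at_top"
        by (rule conv_power_tail_light_class[OF \<nu>[OF k] mgf g \<theta>(1) m])
      from ev have "eventually (?B k c) at_top" by (rule eventually_mono) blast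
      with \<open>0 < c\<close> show ?thesis by blast
    qed
    then have "\<forall>k\<in>{1..K}. \<exists>c. 0 < c \<and> eventually (?B k c) at_top" by blast
    from bchoice[OF this] obtain c where c: "\<And>k. k \<in> {1..K} \<Longrightarrow> 0 < c k" "\<And>k. k \<in> {1..K} \<Longrightarrow> eventually (?B k (c k)) at_top"
      by blast
    define c0 where "c0 = Min (c ` {1..K})"
    have c0: "0 < c0" "\<And>k. k \<in> {1..K} \<Longrightarrow> c0 \<le> c k"
      unfolding c0_def using K c(1) by (auto simp: Min_gr_iff)
    have "eventually (\<lambda>q. \<forall>k\<in>{1..K}. ?B k (c k) q) at_top"
      by (rule eventually_ball_finite) (use c(2) in auto)
    then have "eventually (\<lambda>q. \<forall>k\<in>{1..K}. ?B k c0 q) at_top"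
      using eventually_ge_at_top[of 0]
    proof eventually_elim
      case (elim q)
      show ?case
      proof (intro ballI allI impI)
        fix k j assume k: "k \<in> {1..K}" and j: "q ^ 15 < \<bar>real j - q ^ 16\<bar>"
        have "measure (conv_power (\<nu> k) j) {m * q ^ 16 + z * q ^ 8 - (q ^ 8 + real j / q ^ 4)<..}
          \<le> exp (- (g * m * q ^ 16)) * (exp (- (c k * q ^ 14)) * exp (- (c k / q\<^sup>2)) ^ j)"
          using elim k j by blast
        also have "\<dots> \<le> exp (- (g * m * q ^ 16)) * (exp (- (c0 * q ^ 14)) * exp (- (c0 / q\<^sup>2)) ^ j)"
          using c0(2)[OF k] elim(2)
          by (intro mult_left_mono mult_mono power_mono) (auto intro: mult_right_mono divide_right_mono)
        finally show "measure (conv_power (\<nu> k) j) {m * q ^ 16 + z * q ^ 8 - (q ^ 8 + real j / q ^ 4)<..}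
          \<le> exp (- (g * m * q ^ 16)) * (exp (- (c0 * q ^ 14)) * exp (- (c0 / q\<^sup>2)) ^ j)" .
      qed
    qed
    with c0(1) show ?thesis by blast
  qed

  \<comment> \<open>The class of server \<open>i\<close>.\<close>
  define cl where "cl N i = (LEAST k. i \<le> M N k)" for N i
  have cl: "cl N i \<in> {1..K}" "M N (cl N i - 1) < i" "i \<le> M N (cl N i)" if "K \<le> N" "i \<in> {1..N}" for N i
  proof -
    have iK: "i \<le> M N K" using M_K[OF that(1)] that(2) by simp
    show le: "i \<le> M N (cl N i)"
      unfolding cl_def by (rule LeastI[of _ K]) (rule iK)
    have "cl N i \<noteq> 0"
      using le M_0[OF that(1)] that(2) by (intro notI) simp
    moreover have "cl N i \<le> K"
      unfolding cl_def by (rule Least_le) (rule iK)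
    ultimately show "cl N i \<in> {1..K}" by simp
    have "\<not> i \<le> M N (cl N i - 1)"
      using not_less_Least[of "cl N i - 1" "\<lambda>k. i \<le> M N k"] \<open>cl N i \<noteq> 0\<close> unfolding cl_def by simp
    then show "M N (cl N i - 1) < i" by simp
  qed
  define \<kappa> where "\<kappa> N i = distr R borel (Scl (cl N i))" for N i
  have fj: "fork_join (P N) N (S N) (A N) (\<kappa> N) (distr R borel Acl)" if N: "K \<le> N" for N
    unfolding fork_join_def fork_join_axioms_def \<kappa>_def
    using P[OF N] indep[OF N] S_distr[OF N cl(1)[OF N] cl(2)[OF N] cl(3)[OF N]] A_distr[OF N] by auto
  have \<rho>_alt: "distr (distr R borel Acl) borel (\<lambda>x. 1 / lam - x) = \<rho>"
    unfolding \<rho>_def using Acl_rv by (simp add: distr_distr o_def)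
  have \<nu>_alt: "distr (distr R borel (Scl k)) borel (\<lambda>x. x - 1 / lam) = \<nu> k" if "k \<in> {1..K}" for k
    unfolding \<nu>_def using Scl_rv[OF that] by (simp add: distr_distr o_def)

  define q where "q = log_scale (g * m)"
  have gm: "0 < g * m" using g m by simp
  have q_lim: "filterlim q at_top sequentially"
    unfolding q_def by (rule log_scale_at_top[OF gm])
  have q_exp: "exp (g * m * q N ^ 16) = real N" if "1 \<le> N" for N
    unfolding q_def by (rule log_scale_power(2)[OF gm that])
  have N_ev: "eventually (\<lambda>N. K \<le> N \<and> 1 \<le> q N) sequentially"
    using eventually_ge_at_top[of K] eventually_compose_filterlim[OF eventually_ge_at_top[of 1] q_lim]
    by (rule eventually_conj)
  \<comment> \<open>The distribution function of the maximum, centred at \<open>m q^16 = ln N/g\<close> and in units of \<open>q^8\<close>.\<close>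
  define G where "G N z = measure (Q N) {\<omega>\<in>space (Q N). Max ((\<lambda>i. W N i \<omega>) ` {1..N}) \<le> m * q N ^ 16 + z * q N ^ 8}" for N z
  define \<Phi> where "\<Phi> = cdf (distr std_normal_distribution borel (\<lambda>x. \<sigma>\<^sub>A * x))"
  note clt = clt_cdf_along_scale[OF \<rho> \<rho>_mean \<rho>_sq \<rho>_var \<sigma>_nonneg q_lim, folded \<Phi>_def]

  have lower: "eventually (\<lambda>N. \<Phi> (z - \<epsilon>) - \<delta> \<le> G N z) sequentially"
    if "0 < \<epsilon>" "z - \<epsilon> \<noteq> 0" "0 < \<delta>" for z \<epsilon> \<delta>
  proof -
    \<comment> \<open>One \<open>e\<close> is lost in passing to the steady state and two in the union bound.\<close>
    define e where "e = \<epsilon> / 3"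
    have e: "0 < e" "z - e - 2 * e = z - \<epsilon>" using that by (auto simp: e_def)
    obtain c where c: "0 < c" and ev: "eventually (\<lambda>q::real. \<forall>k\<in>{1..K}. \<forall>j. q ^ 15 < \<bar>real j - q ^ 16\<bar> \<longrightarrow>
      measure (conv_power (\<nu> k) j) {m * q ^ 16 + (z - e) * q ^ 8 - (q ^ 8 + real j / q ^ 4)<..}
        \<le> exp (- (g * m * q ^ 16)) * (exp (- (c * q ^ 14)) * exp (- (c / q\<^sup>2)) ^ j)) at_top"
      using off by blast
    have "(\<lambda>N. measure (conv_power \<rho> (window_start (q N))) {..(z - e - 2 * e) * q N ^ 8} - upper_error v e g c (q N))
        \<longlonglongrightarrow> \<Phi> (z - \<epsilon>) - 0"
      unfolding e(2)
      by (intro tendsto_diff clt[OF window_start_asymp that(2)] filterlim_compose[OF upper_error_tendsto_0[OF v e(1) g c] q_lim])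
    then have lim: "eventually (\<lambda>N. \<Phi> (z - \<epsilon>) - \<delta> <
        measure (conv_power \<rho> (window_start (q N))) {..(z - e - 2 * e) * q N ^ 8} - upper_error v e g c (q N)) sequentially"
      using that(3) by (intro order_tendstoD) auto
    from lim N_ev eventually_compose_filterlim[OF ev q_lim] show ?thesis
    proof eventually_elim
      case (elim N)
      then have N: "K \<le> N" and q1: "1 \<le> q N" by auto
      have N1: "1 \<le> N" using N K by simp
      interpret fj: fork_join "P N" N "S N" "A N" "\<kappa> N" "distr R borel Acl" "1 / lam" by (rule fj[OF N])
      have \<nu>_cl: "distr (\<kappa> N i) borel (\<lambda>x. x - 1 / lam) = \<nu> (cl N i)" if "i \<in> {1..N}" for i
        unfolding \<kappa>_def by (rule \<nu>_alt[OF cl(1)[OF N that]])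
      let ?l = "measure (conv_power \<rho> (window_start (q N))) {..(z - e - 2 * e) * q N ^ 8} - upper_error v e g c (q N)"
      let ?F = "\<lambda>n. measure (P N) {\<omega>\<in>space (P N). \<forall>i\<in>{1..N}. waiting_time (\<lambda>j. S N i j \<omega>) (\<lambda>j. A N j \<omega>) n \<le> m * q N ^ 16 + (z - e) * q N ^ 8}"
      have "?l \<le> ?F (Suc n)" if n: "window_start (q N) \<le> n" for n
      proof (rule fj.prob_all_waiting_times_small_ge[unfolded \<rho>_alt, OF q1 \<rho> \<rho>_exp v e(1) g c _ _ _ _ _ n])
        show "real N \<le> exp (g * m * q N ^ 16)" using q_exp[OF N1] by simp
        fix i assume i: "i \<in> {1..N}"
        show "real_distribution (distr (\<kappa> N i) borel (\<lambda>x. x - 1 / lam))"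
          "integrable (distr (\<kappa> N i) borel (\<lambda>x. x - 1 / lam)) (\<lambda>x. exp (g * x))"
          "mgf (distr (\<kappa> N i) borel (\<lambda>x. x - 1 / lam)) g \<le> 1"
          unfolding \<nu>_cl[OF i] using \<nu>[OF cl(1)[OF N i]] \<nu>_g[OF cl(1)[OF N i]] by blast+
        fix k assume "q N ^ 15 < \<bar>real k - q N ^ 16\<bar>"
        then show "measure (conv_power (distr (\<kappa> N i) borel (\<lambda>x. x - 1 / lam)) k)
            {m * q N ^ 16 + (z - e) * q N ^ 8 - (q N ^ 8 + real k / q N ^ 4)<..}
          \<le> exp (- (g * m * q N ^ 16)) * (exp (- (c * q N ^ 14)) * exp (- (c / (q N)\<^sup>2)) ^ k)"
          unfolding \<nu>_cl[OF i] using elim(3) cl(1)[OF N i] by blast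
      qed
      then have "eventually (\<lambda>n. ?l \<le> ?F (Suc n)) sequentially"
        by (rule eventually_sequentiallyI)
      then have F: "eventually (\<lambda>n. ?l \<le> ?F n) sequentially"
        by (rule eventually_sequentially_Suc[THEN iffD1])
      have "m * q N ^ 16 + (z - e) * q N ^ 8 < m * q N ^ 16 + z * q N ^ 8"
        using e(1) q1 by simp
      from steady_state_max_cdf_bounds(2)[OF W[OF N] N1 P[OF N] fj.S_measurable fj.A_measurable this F]
      have "?l \<le> G N z" unfolding G_def by simp
      with elim(1) show ?case by linarith
    qed
  qed

  have upper: "eventually (\<lambda>N. G N z \<le> \<Phi> (z + \<epsilon>) + \<delta>) sequentially"
    if "0 < \<epsilon>" "z + \<epsilon> \<noteq> 0" "0 < \<delta>" for z \<epsilon> \<delta>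
  proof -
    \<comment> \<open>One \<open>e\<close> is lost in passing to the steady state and one in the bound at a single time.\<close>
    define e where "e = \<epsilon> / 2"
    have e: "0 < e" "z + e + e = z + \<epsilon>" using that by (auto simp: e_def)
    define L where "L N = {M N (kstar - 1)<..M N kstar}" for N
    have L_ev: "eventually (\<lambda>N. \<alpha> kstar / 2 * exp (g * m * q N ^ 16) \<le> real (card (L N))) sequentially"
    proof -
      have "eventually (\<lambda>N. \<alpha> kstar / 2 < (real (M N kstar) - real (M N (kstar - 1))) / real N) sequentially"
        using \<alpha>[OF ks] by (intro order_tendstoD(1)[OF M_limit[OF ks]]) simp
      with N_ev show ?thesis
      proof eventually_elim
        case (elim N)
        then have N: "K \<le> N" "1 \<le> N" using K by auto
        have "\<alpha> kstar / 2 * real N \<le> real (M N kstar) - real (M N (kstar - 1))"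
          using elim N by (simp add: pos_less_divide_eq)
        then show ?case
          using M_less[OF N(1) ks] unfolding q_exp[OF N(2)] by (simp add: L_def of_nat_diff)
      qed
    qed
    let ?k = "\<lambda>N. nat \<lfloor>q N ^ 16\<rfloor>"
    let ?u = "\<lambda>N. measure (conv_power \<rho> (?k N)) {..(z + e + e) * q N ^ 8} +
        measure (conv_power (\<nu> kstar) (?k N)) {..m * q N ^ 16 - e * q N ^ 8} ^ card (L N)"
    have "?u \<longlonglongrightarrow> \<Phi> (z + \<epsilon>) + 0"
      unfolding e(2)
    proof (rule tendsto_add[OF clt[OF floor_asymp that(2)]])
      show "(\<lambda>N. measure (conv_power (\<nu> kstar) (?k N)) {..m * q N ^ 16 - e * q N ^ 8} ^ card (L N)) \<longlonglongrightarrow> 0"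
        unfolding m_def
        using prob_maximum_of_sums_small_tendsto_0[OF \<nu>[OF ks] \<nu>_interior[OF ks] \<nu>_one[OF ks] \<gamma>_pos[OF ks] \<nu>_nz[OF ks] e(1) _ q_lim _ , of "\<alpha> kstar / 2" "\<lambda>N. card (L N)"]
          m L_ev \<alpha>[OF ks] unfolding m_def g_def by simp
    qed
    then have lim: "eventually (\<lambda>N. ?u N < \<Phi> (z + \<epsilon>) + \<delta>) sequentially"
      using that(3) by (intro order_tendstoD) auto
    from lim N_ev show ?thesis
    proof eventually_elim
      case (elim N)
      then have N: "K \<le> N" and q1: "1 \<le> q N" by auto
      have N1: "1 \<le> N" using N K by simp
      interpret fj: fork_join "P N" N "S N" "A N" "\<kappa> N" "distr R borel Acl" "1 / lam" by (rule fj[OF N])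
      let ?F = "\<lambda>n. measure (P N) {\<omega>\<in>space (P N). \<forall>i\<in>{1..N}. waiting_time (\<lambda>j. S N i j \<omega>) (\<lambda>j. A N j \<omega>) n \<le> m * q N ^ 16 + (z + e) * q N ^ 8}"
      have M_mono: "M N j \<le> M N j'" if "j \<le> j'" "j' \<le> K" for j j'
        using that
      proof (induction j' rule: dec_induct)
        case (step i)
        then show ?case using M_less[OF N, of "Suc i"] by simp
      qed simp
      have L: "L N \<subseteq> {1..N}" "L N \<noteq> {}"
      proof -
        have "M N kstar \<le> N" using M_mono[of kstar K] ks M_K[OF N] by simp
        then show "L N \<subseteq> {1..N}" by (auto simp: L_def)
        show "L N \<noteq> {}" using M_less[OF N ks] by (auto simp: L_def)
      qed
      have \<kappa>_L: "\<kappa> N i = distr R borel (Scl kstar)" if i: "i \<in> L N" for i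
      proof -
        have i': "i \<in> {1..N}" using L(1) i by blast
        have "cl N i \<le> kstar"
          unfolding cl_def using i by (intro Least_le) (simp add: L_def)
        moreover have "\<not> cl N i \<le> kstar - 1"
        proof
          assume "cl N i \<le> kstar - 1"
          then have "M N (cl N i) \<le> M N (kstar - 1)" using ks by (intro M_mono) auto
          with cl(3)[OF N i'] i show False by (simp add: L_def)
        qed
        ultimately have "cl N i = kstar" by linarith
        then show ?thesis by (simp add: \<kappa>_def)
      qed
      have "?F (Suc n) \<le> ?u N" if n: "?k N \<le> n" for n
        using fj.prob_all_waiting_times_small_le[OF L \<kappa>_L n, of "m * q N ^ 16" "(z + e) * q N ^ 8" "e * q N ^ 8"]
        unfolding \<rho>_alt \<nu>_alt[OF ks] distrib_right[of _ e "q N ^ 8", symmetric] .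
      then have "eventually (\<lambda>n. ?F (Suc n) \<le> ?u N) sequentially"
        by (rule eventually_sequentiallyI)
      then have F: "eventually (\<lambda>n. ?F n \<le> ?u N) sequentially"
        by (rule eventually_sequentially_Suc[THEN iffD1])
      have "m * q N ^ 16 + z * q N ^ 8 < m * q N ^ 16 + (z + e) * q N ^ 8"
        using e(1) q1 by simp
      from steady_state_max_cdf_bounds(1)[OF W[OF N] N1 P[OF N] fj.S_measurable fj.A_measurable this F]
      have "G N z \<le> ?u N" unfolding G_def by simp
      with elim(1) show ?case by linarith
    qed
  qed

  \<comment> \<open>The ratio of \<open>sqrt (ln N)\<close> to the unit \<open>q^8\<close> of \<open>G\<close>.\<close>
  define c where "c = sqrt (g * m)"
  have c: "0 < c" using gm by (simp add: c_def)
  have target: "cdf (distr std_normal_distribution borel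
      (\<lambda>x. \<sigma>\<^sub>A / sqrt (deriv (cgf R (\<lambda>\<omega>. Scl kstar \<omega> - 1 / lam)) (\<gamma> kstar) * \<gamma> kstar) * x)) x = \<Phi> (x * c)" for x
  proof -
    have "(\<lambda>u. \<sigma>\<^sub>A / sqrt (m * \<gamma> kstar) * u) -` {..x} = (\<lambda>u. \<sigma>\<^sub>A * u) -` {..x * c}"
      using c by (auto simp: c_def g_def field_simps)
    moreover have "cdf (distr std_normal_distribution borel (\<lambda>u. b * u)) y =
        measure std_normal_distribution ((\<lambda>u. b * u) -` {..y})" for b y
      unfolding cdf_def by (subst measure_distr) simp_all
    ultimately show ?thesis
      unfolding m_deriv \<Phi>_def by (simp only:)
  qed
  show ?thesis
    unfolding weak_conv_m_def weak_conv_def target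
  proof (intro allI impI)
    fix x
    assume "isCont (\<lambda>x. \<Phi> (x * c)) x"
    then have "isCont (\<lambda>y. \<Phi> (y / c * c)) (x * c)"
      using c by (intro continuous_at_compose[of "x * c" "\<lambda>y. y / c" "\<lambda>x. \<Phi> (x * c)", unfolded o_def]) (auto intro!: continuous_intros)
    then have "isCont \<Phi> (x * c)" using c by simp
    from cdf_sandwich_tendsto[where G=G and \<Phi>=\<Phi>, OF lower upper this]
    have "(\<lambda>N. G N (x * c)) \<longlonglongrightarrow> \<Phi> (x * c)" by blast
    moreover have "eventually (\<lambda>N. G N (x * c) = cdf (distr (Q N) borel
         (\<lambda>\<omega>. (Max ((\<lambda>i. W N i \<omega>) ` {1..N}) - 1 / \<gamma> kstar * ln (real N)) / sqrt (ln (real N)))) x) sequentially"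
      using N_ev
    proof eventually_elim
      case (elim N)
      then have N: "K \<le> N" "1 \<le> N" and q1: "1 \<le> q N" using K by auto
      have ln: "ln (real N) = g * m * q N ^ 16"
        using log_scale_power(1)[OF gm N(2)] g m unfolding q_def by simp
      have "sqrt (q N ^ 16) = q N ^ 8"
        using q1 real_sqrt_abs[of "q N ^ 8"] by (simp flip: power_mult)
      then have sq: "sqrt (ln (real N)) = c * q N ^ 8"
        unfolding ln c_def by (simp only: real_sqrt_mult)
      have mean: "1 / \<gamma> kstar * ln (real N) = m * q N ^ 16"
        unfolding ln using g by (simp add: g_def)
      have "0 < c * q N ^ 8" using c q1 by simp
      then have iff: "(y - m * q N ^ 16) / (c * q N ^ 8) \<le> x \<longleftrightarrow> y \<le> m * q N ^ 16 + x * c * q N ^ 8" for y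
        by (auto simp: pos_divide_le_eq mult_ac)
      have "(\<lambda>\<omega>. Max ((\<lambda>i. W N i \<omega>) ` {1..N})) \<in> borel_measurable (Q N)"
        using W[OF N(1)] by (intro borel_measurable_Max) (auto simp: steady_state_waiting_times_def)
      then have "(\<lambda>\<omega>. (Max ((\<lambda>i. W N i \<omega>) ` {1..N}) - m * q N ^ 16) / (c * q N ^ 8)) \<in> borel_measurable (Q N)"
        by (intro borel_measurable_divide borel_measurable_diff) auto
      then show ?case
        unfolding G_def cdf_def mean sq
        by (subst measure_distr) (auto simp: iff intro!: arg_cong[where f="measure (Q N)"])
    qed
    ultimately show "(\<lambda>N. cdf (distr (Q N) borel
         (\<lambda>\<omega>. (Max ((\<lambda>i. W N i \<omega>) ` {1..N}) - 1 / \<gamma> kstar * ln (real N)) / sqrt (ln (real N)))) x) \<longlonglongrightarrow> \<Phi> (x * c)"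
      by (rule Lim_transform_eventually)
  qed
qed

end
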